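(* Let $\eta>0$, $p\ge 2$ and $s<-\frac p2$. Let $\Phi(\xi)=-|\xi|^p+\Phi_1(\xi)$ be a real valued Fourier symbol with $|\Phi_1(\xi)|\le C(1+|\xi|^q)$ for some constants $C$ and $0\le q<p$, and let $L$ be the linear operator defined by $\widehat{Lf}(\xi)=-\Phi(\xi)\hat f(\xi)$. Then there does not exist any $T>0$ such that the initial value problem $$v_t+v_{xxx}+\eta Lv+(v^2)_x=0,\quad x\in\mathbb{R},\ t\ge 0,\qquad v(x,0)=v_0(x)$$ admits a unique local solution defined in the interval $[0,T]$ such that the flow-map $v_0\mapsto v$ is $C^2$-differentiable at the origin from $H^s(\mathbb{R})$ to $C([0,T];H^s(\mathbb{R}))$.
   Context: $\hat f(\xi)=\int_{\mathbb{R}}e^{-ix\xi}f(x)\,dx$ (the factor $1/\sqrt{2\pi}$ is omitted). $H^s(\mathbb{R})=\{f\in\mathcal{S}'(\mathbb{R}):\|f\|_{H^s}<\infty\}$ with $\|f\|_{H^s}=\big(\int_{\mathbb{R}}(1+|\xi|^2)^s|\hat f(\xi)|^2d\xi\big)^{1/2}$. The initial value problem is understood in its equivalent integral form $v(t)=V(t)v_0-\int_0^tV(t-t')(v^2)_x(t')\,dt'$, where $\widehat{V(t)w_0}(\xi)=e^{it\xi^3+\eta t\Phi(\xi)}\widehat{w_0}(\xi)$. *)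

theory Defs
  imports "HOL-Analysis.Analysis" "HOL-Library.Function_Algebras"
begin

section \<open>Normed spaces given by a carrier and a norm\<close>

text \<open>
  The spaces \<open>H\<^sup>s\<close> depend on the real parameter \<open>s\<close>, so they are not types. A normed space
  is therefore a linear subspace of an ambient real vector space together with a norm on it.
  The ambient spaces are function spaces with the pointwise operations.
\<close>

instantiation "fun" :: (type, real_vector) real_vector
begin

definition scaleR_fun :: "real \<Rightarrow> ('a \<Rightarrow> 'b) \<Rightarrow> 'a \<Rightarrow> 'b"
  where "scaleR_fun c f = (\<lambda>x. c *\<^sub>R f x)"

instance
  by standard (auto simp: scaleR_fun_def fun_eq_iff algebra_simps)

end

record 'a nspace =
  car :: "'a set"
  nrm :: "'a \<Rightarrow> real"

text \<open>
  Bounded real-linear operators with the operator norm. They are extended by \<open>0\<close> outside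
  the carrier, so that equality of operators is equality on the carrier.
\<close>

definition op_space ::
  "'a::real_vector nspace \<Rightarrow> 'b::real_vector nspace \<Rightarrow> ('a \<Rightarrow> 'b) nspace"
  where "op_space X Y = \<lparr>
    car = {A. (\<forall>x\<in>car X. A x \<in> car Y) \<and> (\<forall>x. x \<notin> car X \<longrightarrow> A x = 0)
            \<and> (\<forall>x\<in>car X. \<forall>y\<in>car X. A (x + y) = A x + A y)
            \<and> (\<forall>c. \<forall>x\<in>car X. A (c *\<^sub>R x) = c *\<^sub>R A x)
            \<and> (\<exists>K. \<forall>x\<in>car X. nrm Y (A x) \<le> K * nrm X x)},
    nrm = (\<lambda>A. Sup {nrm Y (A x) | x. x \<in> car X \<and> nrm X x \<le> 1}) \<rparr>"

definition has_frechet ::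
  "'a::real_vector nspace \<Rightarrow> 'b::real_vector nspace \<Rightarrow> ('a \<Rightarrow> 'b) \<Rightarrow> ('a \<Rightarrow> 'b) \<Rightarrow> 'a \<Rightarrow> bool"
  where "has_frechet X Y f A x \<longleftrightarrow> A \<in> car (op_space X Y) \<and>
    (\<forall>e>0. \<exists>d>0. \<forall>h\<in>car X. nrm X h < d \<longrightarrow> nrm Y (f (x + h) - f x - A h) \<le> e * nrm X h)"

text \<open>
  \<open>f\<close> is defined and twice Frechet differentiable on a ball around \<open>x0\<close>, and its second
  derivative, with values in \<open>L(X, L(X, Y))\<close>, is continuous at \<open>x0\<close>. In particular this
  covers every map that is \<open>C\<^sup>2\<close> on a neighbourhood of \<open>x0\<close>.
\<close>

definition C2_at ::
  "'a::real_vector nspace \<Rightarrow> 'b::real_vector nspace \<Rightarrow> ('a \<Rightarrow> 'b) \<Rightarrow> 'a \<Rightarrow> bool"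
  where "C2_at X Y f x0 \<longleftrightarrow> x0 \<in> car X \<and> (\<exists>r>0. \<exists>D1 D2.
    (\<forall>x\<in>car X. nrm X (x - x0) < r \<longrightarrow>
       f x \<in> car Y \<and> has_frechet X Y f (D1 x) x \<and> has_frechet X (op_space X Y) D1 (D2 x) x) \<and>
    (\<forall>e>0. \<exists>d>0. \<forall>x\<in>car X. nrm X (x - x0) < d \<longrightarrow>
       nrm (op_space X (op_space X Y)) (D2 x - D2 x0) < e))"


section \<open>Schwartz functions and tempered distributions on the real line\<close>

definition vderiv :: "(real \<Rightarrow> complex) \<Rightarrow> real \<Rightarrow> complex"
  where "vderiv f x = vector_derivative f (at x)"

definition schwartz :: "(real \<Rightarrow> complex) set"
  where "schwartz = {f. (\<forall>n x. (vderiv ^^ n) f differentiable (at x)) \<and>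
    (\<forall>k n. bounded (range (\<lambda>x. (x ^ k) *\<^sub>R (vderiv ^^ n) f x)))}"

definition schwartz_seminorm :: "nat \<Rightarrow> nat \<Rightarrow> (real \<Rightarrow> complex) \<Rightarrow> real"
  where "schwartz_seminorm k n f = (SUP x. norm ((x ^ k) *\<^sub>R (vderiv ^^ n) f x))"

type_synonym functional = "(real \<Rightarrow> complex) \<Rightarrow> complex"

text \<open>
  Functionals are extended by \<open>0\<close> outside the Schwartz space, so that equality of
  distributions is equality of functionals.
\<close>

definition tempered :: "functional set"
  where "tempered = {u. (\<forall>f. f \<notin> schwartz \<longrightarrow> u f = 0) \<and>
    (\<forall>f\<in>schwartz. \<forall>g\<in>schwartz. \<forall>a b. u (\<lambda>x. a * f x + b * g x) = a * u f + b * u g) \<and>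
    (\<exists>C m. \<forall>f\<in>schwartz. norm (u f) \<le> C * (\<Sum>k\<le>m. \<Sum>n\<le>m. schwartz_seminorm k n f))}"

definition represents :: "functional \<Rightarrow> (real \<Rightarrow> complex) \<Rightarrow> bool"
  where "represents u h \<longleftrightarrow> h \<in> borel_measurable lebesgue \<and>
    (\<forall>\<phi>\<in>schwartz. integrable lebesgue (\<lambda>x. h x * \<phi> x) \<and> u \<phi> = (LINT x|lebesgue. h x * \<phi> x))"

text \<open>The function (unique up to null sets) representing a distribution, if there is one.\<close>

definition dist_fun :: "functional \<Rightarrow> real \<Rightarrow> complex"
  where "dist_fun u = (SOME h. represents u h)"

definition dist_of :: "(real \<Rightarrow> complex) \<Rightarrow> functional"
  where "dist_of h = (\<lambda>\<phi>. if \<phi> \<in> schwartz then LINT x|lebesgue. h x * \<phi> x else 0)"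

definition dist_deriv :: "functional \<Rightarrow> functional"
  where "dist_deriv u = (\<lambda>\<phi>. if \<phi> \<in> schwartz then - u (vderiv \<phi>) else 0)"

definition fourier :: "(real \<Rightarrow> complex) \<Rightarrow> real \<Rightarrow> complex"
  where "fourier f \<xi> = (LINT x|lebesgue. exp (- \<i> * complex_of_real (x * \<xi>)) * f x)"

definition fourier_dist :: "functional \<Rightarrow> functional"
  where "fourier_dist u = (\<lambda>\<phi>. if \<phi> \<in> schwartz then u (fourier \<phi>) else 0)"

definition fourier_fun :: "functional \<Rightarrow> real \<Rightarrow> complex"
  where "fourier_fun u = dist_fun (fourier_dist u)"

text \<open>
  The tempered distribution with Fourier transform \<open>m \<xi> * fourier_fun u \<xi>\<close>; it is used
  only for \<open>u\<close> whose Fourier transform is a function.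
\<close>

definition fourier_mult :: "(real \<Rightarrow> complex) \<Rightarrow> functional \<Rightarrow> functional"
  where "fourier_mult m u =
    (THE w. w \<in> tempered \<and> represents (fourier_dist w) (\<lambda>\<xi>. m \<xi> * fourier_fun u \<xi>))"


section \<open>The spaces \<open>H\<^sup>s\<close> and \<open>C([0,T]; H\<^sup>s)\<close>\<close>

definition sobolev :: "real \<Rightarrow> functional nspace"
  where "sobolev s = \<lparr>
    car = {u \<in> tempered. (\<exists>h. represents (fourier_dist u) h) \<and>
            integrable lebesgue (\<lambda>\<xi>. (1 + \<bar>\<xi>\<bar>\<^sup>2) powr s * (norm (fourier_fun u \<xi>))\<^sup>2)},
    nrm = (\<lambda>u. sqrt (LINT \<xi>|lebesgue. (1 + \<bar>\<xi>\<bar>\<^sup>2) powr s * (norm (fourier_fun u \<xi>))\<^sup>2)) \<rparr>"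

text \<open>Curves are extended by \<open>0\<close> outside \<open>[0,T]\<close>.\<close>

definition C_sobolev :: "real \<Rightarrow> real \<Rightarrow> (real \<Rightarrow> functional) nspace"
  where "C_sobolev T s = \<lparr>
    car = {v. (\<forall>t\<in>{0..T}. v t \<in> car (sobolev s)) \<and> (\<forall>t. t \<notin> {0..T} \<longrightarrow> v t = 0) \<and>
            (\<forall>t\<in>{0..T}. \<forall>e>0. \<exists>d>0. \<forall>t'\<in>{0..T}. \<bar>t' - t\<bar> < d \<longrightarrow>
               nrm (sobolev s) (v t' - v t) < e)},
    nrm = (\<lambda>v. SUP t\<in>{0..T}. nrm (sobolev s) (v t)) \<rparr>"


section \<open>The integral equation\<close>

text \<open>
  The propagator of \<open>w\<^sub>t + w\<^sub>x\<^sub>x\<^sub>x + \<eta> L w = 0\<close>, where \<open>L\<close> has Fourier symbol \<open>-\<Phi>\<close>.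
\<close>

definition propagator :: "real \<Rightarrow> (real \<Rightarrow> real) \<Rightarrow> real \<Rightarrow> functional \<Rightarrow> functional"
  where "propagator \<eta> \<Phi> t =
    fourier_mult (\<lambda>\<xi>. exp (\<i> * complex_of_real (t * \<xi> ^ 3) + complex_of_real (\<eta> * t * \<Phi> \<xi>)))"

definition is_L2 :: "functional \<Rightarrow> bool"
  where "is_L2 u \<longleftrightarrow> (\<exists>h. represents u h \<and> integrable lebesgue (\<lambda>x. (norm (h x))\<^sup>2))"

text \<open>The square of a distribution that is an \<open>L\<^sup>2\<close> function.\<close>

definition dist_square :: "functional \<Rightarrow> functional"
  where "dist_square u = dist_of (\<lambda>x. (dist_fun u x)\<^sup>2)"

text \<open>
  For negative \<open>s\<close> the square of an element of \<open>H\<^sup>s\<close> has no meaning in general, so a solution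
  \<open>v\<close> in \<open>C([0,T]; H\<^sup>s)\<close> is required to be an \<open>L\<^sup>2\<close> function at almost every time. There is
  no bound on the \<open>L\<^sup>2\<close> norm as \<open>t\<close> tends to \<open>0\<close>, and the Duhamel integral is an integral of
  tempered distributions, i.e. it is taken after pairing with Schwartz functions.
\<close>

definition is_solution ::
  "real \<Rightarrow> (real \<Rightarrow> real) \<Rightarrow> real \<Rightarrow> real \<Rightarrow> functional \<Rightarrow> (real \<Rightarrow> functional) \<Rightarrow> bool"
  where "is_solution \<eta> \<Phi> s T v0 v \<longleftrightarrow>
    v \<in> car (C_sobolev T s) \<and>
    (AE t in lebesgue. t \<in> {0..T} \<longrightarrow> is_L2 (v t)) \<and>
    (\<forall>t\<in>{0..T}. \<forall>\<psi>\<in>schwartz.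
       set_integrable lebesgue {0..t}
         (\<lambda>t'. propagator \<eta> \<Phi> (t - t') (dist_deriv (dist_square (v t'))) \<psi>) \<and>
       v t \<psi> = propagator \<eta> \<Phi> t v0 \<psi> -
         (LINT t':{0..t}|lebesgue.
            propagator \<eta> \<Phi> (t - t') (dist_deriv (dist_square (v t'))) \<psi>))"

end

theory Submission
  imports Defs "HOL-Probability.Levy" "HOL-Probability.Sinc_Integral" "HOL-Real_Asymp.Real_Asymp"
    "HOL-Computational_Algebra.Polynomial"
begin

text \<open>
  If the flow \<open>F\<close> is \<open>C\<^sup>2\<close> at the origin, its second differences
  \<open>F (\<theta> \<phi>) + F (- \<theta> \<phi>) - 2 F 0\<close> are bounded by \<open>K \<theta>\<^sup>2\<close> for small \<open>\<theta>\<close>, with one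
  constant \<open>K\<close> for all \<open>\<phi>\<close> in the unit ball of \<open>H\<^sup>s\<close> (\<open>C2_at_second_difference\<close>). The proof tests
  this at time \<open>T\<close> against a fixed window of low frequencies and lets \<open>\<phi>\<close> concentrate at
  frequencies \<open>\<plusminus>N\<close>.

  For small data with a bounded, compactly supported Fourier transform the equation can be solved by Picard
  iteration on the Fourier side (\<open>picard_fixpoint\<close>). The result is a solution in the required weak sense
  (\<open>freq_curve_is_solution\<close>), so uniqueness identifies it with \<open>F (\<theta> \<phi>)\<close>. Its expansion in
  \<open>\<theta>\<close> is explicit: the linear terms cancel in the second difference, the quadratic terms are the second
  Picard iterate, and the error is cubic (\<open>flow_expansion\<close>). Letting \<open>\<theta>\<close> tend to \<open>0\<close> for fixed
  \<open>\<phi>\<close> bounds the second iterate by \<open>K / 2\<close> (\<open>second_iterate_bound\<close>).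

  On the other hand, frequencies \<open>\<zeta>\<close> near \<open>N\<close> and \<open>\<xi> - \<zeta>\<close> near \<open>- N\<close> produce the
  low frequency \<open>\<xi>\<close> with the amplitude \<open>\<integral>\<^sub>0\<^sup>T exp (\<tau> z) d\<tau>\<close>, where \<open>- Re z\<close> is
  comparable to \<open>N\<^sup>p\<close> because of the dissipation, and \<open>Im z = O(N\<^sup>2)\<close> because of the dispersion.
  As \<open>p \<ge> 2\<close>, this integral has a positive real part of size \<open>N\<^sup>-\<^sup>p\<close>
  (\<open>exp_integral_lower\<close>, \<open>phase_bounds\<close>). A bump of norm \<open>1\<close> in \<open>H\<^sup>s\<close> has height
  comparable to \<open>N\<^sup>-\<^sup>s\<close>, so the second iterate is at least a multiple of \<open>N powr (- 2 s - p)\<close>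
  (\<open>second_iterate_lower\<close>), which is unbounded exactly when \<open>s < - p / 2\<close>.

  The rest is the theory of tempered distributions that makes sense of the equation: Fourier
  inversion on the Schwartz space, uniqueness of representing functions, and the calculus of those
  distributions whose Fourier transform is integrable.
\<close>

section \<open>Schwartz functions\<close>

lemma vderiv_eqI:
  assumes "\<And>x. (f has_vector_derivative f' x) (at x)"
  shows "vderiv f = f'"
  using assms by (auto simp: vderiv_def fun_eq_iff vector_derivative_at)

lemma schwartz_differentiable: "f \<in> schwartz \<Longrightarrow> (vderiv ^^ n) f differentiable (at x)"
  by (simp add: schwartz_def)

lemma schwartz_has_vderiv:
  "f \<in> schwartz \<Longrightarrow> ((vderiv ^^ n) f has_vector_derivative (vderiv ^^ Suc n) f x) (at x)"
  using schwartz_differentiable[of f n x] by (simp add: vderiv_def vector_derivative_works)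

lemma schwartz_has_vderiv0:
  "f \<in> schwartz \<Longrightarrow> (f has_vector_derivative vderiv f x) (at x)"
  using schwartz_has_vderiv[of f 0 x] by simp

text \<open>
  A class of bounded differentiable functions that is stable under differentiation and under
  multiplication by \<open>x\<close> consists of Schwartz functions. This gives membership for Gaussians,
  reflections and Fourier transforms without formulas for their higher derivatives.
\<close>

lemma schwartz_coinduct:
  assumes "f \<in> S"
    and diff: "\<And>f x. f \<in> S \<Longrightarrow> f differentiable (at x)"
    and bdd: "\<And>f. f \<in> S \<Longrightarrow> bounded (range f)"
    and der: "\<And>f. f \<in> S \<Longrightarrow> vderiv f \<in> S"
    and mult: "\<And>f. f \<in> S \<Longrightarrow> (\<lambda>x. x *\<^sub>R f x) \<in> S"
  shows "f \<in> schwartz"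
proof -
  have d: "(vderiv ^^ n) f \<in> S" for n by (induction n) (auto simp: assms)
  have m: "(\<lambda>x. (x ^ k) *\<^sub>R (vderiv ^^ n) f x) \<in> S" for k n
  proof (induction k)
    case 0
    then show ?case using d[of n] by simp
  next
    case (Suc k)
    from mult[OF this] show ?case by simp
  qed
  show ?thesis unfolding schwartz_def using diff[OF d] bdd[OF m] by simp
qed

lemma schwartz_vderiv: "f \<in> schwartz \<Longrightarrow> vderiv f \<in> schwartz"
  unfolding schwartz_def mem_Collect_eq
proof (intro conjI allI; elim conjE)
  fix n x
  assume "\<forall>n x. (vderiv ^^ n) f differentiable at x"
  then show "(vderiv ^^ n) (vderiv f) differentiable at x"
    by (metis funpow_swap1 funpow.simps(2) o_apply)
next
  fix k n
  assume "\<forall>k n. bounded (range (\<lambda>x. x ^ k *\<^sub>R (vderiv ^^ n) f x))"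
  then have "bounded (range (\<lambda>x. x ^ k *\<^sub>R (vderiv ^^ Suc n) f x))" by blast
  then show "bounded (range (\<lambda>x. x ^ k *\<^sub>R (vderiv ^^ n) (vderiv f) x))"
    by (simp add: funpow_swap1)
qed

lemma bounded_range_add:
  fixes f g :: "real \<Rightarrow> complex"
  assumes "bounded (range f)" "bounded (range g)"
  shows "bounded (range (\<lambda>x. f x + g x))"
  using bounded_plus_comp[OF assms] by simp

lemma bounded_range_cmult:
  fixes f :: "real \<Rightarrow> complex"
  assumes "bounded (range f)"
  shows "bounded (range (\<lambda>x. a * f x))"
proof -
  from assms obtain B where "\<And>x. norm (f x) \<le> B" by (auto simp: bounded_iff)
  then show ?thesis unfolding bounded_iff
    by (intro exI[of _ "norm a * B"]) (auto simp: norm_mult mult_left_mono)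
qed

lemma vderiv_lincomb_pow:
  assumes "f \<in> schwartz" "g \<in> schwartz"
  shows "(vderiv ^^ n) (\<lambda>x. a * f x + b * g x) = (\<lambda>x. a * (vderiv ^^ n) f x + b * (vderiv ^^ n) g x)"
proof (induction n)
  case (Suc n)
  show ?case unfolding funpow.simps(2) o_def Suc
    by (rule vderiv_eqI) (auto intro!: derivative_eq_intros schwartz_has_vderiv[THEN has_vector_derivative_eq_rhs] assms)
qed simp

lemma schwartz_lincomb:
  assumes "f \<in> schwartz" "g \<in> schwartz"
  shows "(\<lambda>x. a * f x + b * g x) \<in> schwartz"
  unfolding schwartz_def mem_Collect_eq vderiv_lincomb_pow[OF assms]
proof (intro conjI allI)
  fix n x
  have "((\<lambda>x. a * (vderiv ^^ n) f x + b * (vderiv ^^ n) g x) has_vector_derivative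
     a * (vderiv ^^ Suc n) f x + b * (vderiv ^^ Suc n) g x) (at x)"
    by (auto intro!: derivative_eq_intros schwartz_has_vderiv[THEN has_vector_derivative_eq_rhs] assms)
  then show "(\<lambda>x. a * (vderiv ^^ n) f x + b * (vderiv ^^ n) g x) differentiable at x"
    by (rule differentiableI_vector)
next
  fix k n
  have "bounded (range (\<lambda>x. a * (x ^ k *\<^sub>R (vderiv ^^ n) f x) + b * (x ^ k *\<^sub>R (vderiv ^^ n) g x)))"
    using assms by (intro bounded_range_add bounded_range_cmult) (auto simp: schwartz_def)
  then show "bounded (range (\<lambda>x. x ^ k *\<^sub>R (a * (vderiv ^^ n) f x + b * (vderiv ^^ n) g x)))"
    by (simp add: scaleR_conv_of_real algebra_simps)
qed

lemma schwartz_cmult: "f \<in> schwartz \<Longrightarrow> (\<lambda>x. a * f x) \<in> schwartz"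
  using schwartz_lincomb[of f f a 0] by simp

lemma vderiv_xmult_pow:
  assumes "f \<in> schwartz"
  shows "(vderiv ^^ n) (\<lambda>x. x *\<^sub>R f x) = (\<lambda>x. x *\<^sub>R (vderiv ^^ n) f x + real n *\<^sub>R (vderiv ^^ (n - 1)) f x)"
proof (induction n)
  case (Suc n)
  show ?case unfolding funpow.simps(2) o_def Suc
  proof (rule vderiv_eqI)
    fix x
    show "((\<lambda>x. x *\<^sub>R (vderiv ^^ n) f x + real n *\<^sub>R (vderiv ^^ (n - 1)) f x) has_vector_derivative
         x *\<^sub>R vderiv ((vderiv ^^ n) f) x + real (Suc n) *\<^sub>R (vderiv ^^ (Suc n - 1)) f x) (at x)"
    proof (cases n)
      case 0
      then show ?thesis
        by (auto intro!: derivative_eq_intros schwartz_has_vderiv0[OF assms, THEN has_vector_derivative_eq_rhs])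
    next
      case (Suc m)
      show ?thesis unfolding Suc
        by (auto intro!: derivative_eq_intros schwartz_has_vderiv[OF assms, THEN has_vector_derivative_eq_rhs]
            simp del: funpow.simps) (auto simp: algebra_simps scaleR_2)
    qed
  qed
qed simp

lemma schwartz_xmult:
  assumes "f \<in> schwartz"
  shows "(\<lambda>x. x *\<^sub>R f x) \<in> schwartz"
  unfolding schwartz_def mem_Collect_eq vderiv_xmult_pow[OF assms]
proof (intro conjI allI)
  fix n x
  have "((\<lambda>x. x *\<^sub>R (vderiv ^^ n) f x + real n *\<^sub>R (vderiv ^^ (n - 1)) f x) has_vector_derivative
     (x *\<^sub>R (vderiv ^^ Suc n) f x + (vderiv ^^ n) f x) + real n *\<^sub>R (vderiv ^^ Suc (n - 1)) f x) (at x)"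
    by (auto intro!: derivative_eq_intros schwartz_has_vderiv[OF assms, THEN has_vector_derivative_eq_rhs])
  then show "(\<lambda>x. x *\<^sub>R (vderiv ^^ n) f x + real n *\<^sub>R (vderiv ^^ (n - 1)) f x) differentiable at x"
    by (rule differentiableI_vector)
next
  fix k n
  have "bounded (range (\<lambda>x. 1 * (x ^ Suc k *\<^sub>R (vderiv ^^ n) f x) + of_nat n * (x ^ k *\<^sub>R (vderiv ^^ (n-1)) f x)))"
    using assms by (intro bounded_range_add bounded_range_cmult) (auto simp: schwartz_def simp del: power_Suc)
  then show "bounded (range (\<lambda>x. x ^ k *\<^sub>R (x *\<^sub>R (vderiv ^^ n) f x + real n *\<^sub>R (vderiv ^^ (n-1)) f x)))"
    by (simp add: scaleR_conv_of_real algebra_simps)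
qed

text \<open>
  Reflection relates the Fourier transform and its inverse.
\<close>

lemma schwartz_reflect:
  assumes "f \<in> schwartz"
  shows "(\<lambda>x. f (- x)) \<in> schwartz"
proof (rule schwartz_coinduct[where S = "{\<lambda>x. f (- x) | f. f \<in> schwartz}"])
  show "(\<lambda>x. f (- x)) \<in> {\<lambda>x. f (- x) | f. f \<in> schwartz}" using assms by blast
next
  fix g assume "g \<in> {\<lambda>x. f (- x) | f. f \<in> schwartz}"
  then obtain f where f: "f \<in> schwartz" and g: "g = (\<lambda>x. f (- x))" by blast
  have d: "(g has_vector_derivative (- 1) * vderiv f (- x)) (at x)" for x
    unfolding g using vector_diff_chain_at[of uminus "-1" x f "vderiv f (- x)"] schwartz_has_vderiv0[OF f]
    by (simp add: o_def has_vector_derivative_minus)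
  show "g differentiable at x" for x using d by (rule differentiableI_vector)
  show "bounded (range g)"
  proof -
    have "bounded (range f)" using f unfolding schwartz_def
      by (auto dest!: spec[of _ 0] spec[of "\<lambda>n. bounded (range (\<lambda>x. (vderiv ^^ n) f x))" 0])
    then show ?thesis unfolding g by (rule bounded_subset) auto
  qed
  have "vderiv g = (\<lambda>x. (- 1) * vderiv f (- x))" using d by (rule vderiv_eqI)
  moreover have "(\<lambda>x. (- 1) * vderiv f x) \<in> schwartz" by (intro schwartz_cmult schwartz_vderiv f)
  ultimately show "vderiv g \<in> {\<lambda>x. f (- x) | f. f \<in> schwartz}" by auto
  have "(\<lambda>x. x *\<^sub>R g x) = (\<lambda>x. (\<lambda>y. (- 1) * (y *\<^sub>R f y)) (- x))" by (simp add: g)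
  moreover have "(\<lambda>y. (- 1) * (y *\<^sub>R f y)) \<in> schwartz" by (intro schwartz_cmult schwartz_xmult f)
  ultimately show "(\<lambda>x. x *\<^sub>R g x) \<in> {\<lambda>x. f (- x) | f. f \<in> schwartz}"
    unfolding mem_Collect_eq by (intro exI[of _ "\<lambda>y. (- 1) * (y *\<^sub>R f y)"]) simp
qed

lemma schwartz_continuous: "f \<in> schwartz \<Longrightarrow> continuous_on UNIV f"
  using has_vector_derivative_continuous[OF schwartz_has_vderiv0]
  by (intro continuous_at_imp_continuous_on) auto

lemma schwartz_borel [measurable_dest]: "f \<in> schwartz \<Longrightarrow> f \<in> borel_measurable borel"
  using schwartz_continuous borel_measurable_continuous_onI by blast

lemma schwartz_seminorm_bound:
  assumes "f \<in> schwartz"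
  shows "norm ((x ^ k) *\<^sub>R (vderiv ^^ n) f x) \<le> schwartz_seminorm k n f"
proof -
  have "bounded (range (\<lambda>x. (x ^ k) *\<^sub>R (vderiv ^^ n) f x))" using assms by (auto simp: schwartz_def)
  then have "bdd_above (range (\<lambda>x. norm ((x ^ k) *\<^sub>R (vderiv ^^ n) f x)))"
    by (auto simp: bounded_iff bdd_above_def)
  then show ?thesis unfolding schwartz_seminorm_def by (rule cSUP_upper[rotated]) simp
qed

lemma schwartz_seminorm_nonneg: "f \<in> schwartz \<Longrightarrow> 0 \<le> schwartz_seminorm k n f"
  using schwartz_seminorm_bound[of f 0 k n] norm_ge_zero order_trans by blast

lemma schwartz_bounded:
  assumes "f \<in> schwartz" shows "norm (f x) \<le> schwartz_seminorm 0 0 f"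
  using schwartz_seminorm_bound[OF assms, where k = 0 and n = 0] by simp

lemma schwartz_decay:
  assumes "f \<in> schwartz"
  shows "norm (f x) \<le> (schwartz_seminorm 0 0 f + schwartz_seminorm 2 0 f) * inverse (1 + x\<^sup>2)"
proof -
  have "norm (f x) \<le> schwartz_seminorm 0 0 f" by (rule schwartz_bounded[OF assms])
  moreover have "x\<^sup>2 * norm (f x) \<le> schwartz_seminorm 2 0 f"
    using schwartz_seminorm_bound[OF assms, of x 2 0] by simp
  ultimately have "norm (f x) * (1 + x\<^sup>2) \<le> schwartz_seminorm 0 0 f + schwartz_seminorm 2 0 f"
    by (simp add: algebra_simps)
  moreover have "0 < 1 + x\<^sup>2" by (simp add: add_pos_nonneg)
  ultimately show ?thesis by (simp add: field_simps)
qed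

lemma integrable_inverse_1_plus_square_lborel: "integrable lborel (\<lambda>x::real. inverse (1 + x\<^sup>2))"
  using integrable_inverse_1_plus_square by (simp add: set_integrable_def)

lemma integral_inverse_1_plus_square_lborel: "(LBINT x. inverse (1 + (x::real)\<^sup>2)) = pi"
  using LBINT_inverse_1_plus_square by (simp add: set_lebesgue_integral_def interval_lebesgue_integral_def)

lemma schwartz_integrable:
  assumes "f \<in> schwartz" shows "integrable lborel f"
proof (rule Bochner_Integration.integrable_bound[where
    f = "\<lambda>x. (schwartz_seminorm 0 0 f + schwartz_seminorm 2 0 f) * inverse (1 + x\<^sup>2)"])
  show "integrable lborel (\<lambda>x. (schwartz_seminorm 0 0 f + schwartz_seminorm 2 0 f) * inverse (1 + x\<^sup>2))"
    by (intro integrable_mult_right integrable_inverse_1_plus_square_lborel)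
  show "f \<in> borel_measurable lborel" using schwartz_borel[OF assms] by simp
  show "AE x in lborel. norm (f x) \<le> norm ((schwartz_seminorm 0 0 f + schwartz_seminorm 2 0 f) * inverse (1 + x\<^sup>2))"
    using schwartz_decay[OF assms] by (intro AE_I2) (smt (verit) real_norm_def)
qed

lemma schwartz_integral_norm_le:
  assumes "f \<in> schwartz"
  shows "(LBINT x. norm (f x)) \<le> (schwartz_seminorm 0 0 f + schwartz_seminorm 2 0 f) * pi"
proof -
  have "(LBINT x. norm (f x)) \<le> (LBINT x. (schwartz_seminorm 0 0 f + schwartz_seminorm 2 0 f) * inverse (1 + x\<^sup>2))"
    by (intro integral_mono integrable_norm schwartz_integrable[OF assms] integrable_mult_right
        integrable_inverse_1_plus_square_lborel schwartz_decay[OF assms])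
  then show ?thesis by (simp only: integral_mult_right_zero integral_inverse_1_plus_square_lborel)
qed

section \<open>Modulated Gaussians\<close>

text \<open>
  This follows from \<open>\<bar>x\<bar>\<^sup>k \<le> k! exp \<bar>x\<bar>\<close> and \<open>\<bar>x\<bar> - x\<^sup>2 / 2 \<le> 1\<close>.
\<close>

lemma poly_gaussian_bounded: "bounded (range (\<lambda>x::real. (x ^ k) * exp (- (x\<^sup>2 / 2))))"
proof -
  have *: "\<bar>x\<bar> ^ k * exp (- (x\<^sup>2 / 2)) \<le> fact k * exp 1" for x :: real
  proof -
    have "\<bar>x\<bar> ^ k / fact k = (\<Sum>n\<in>{k}. \<bar>x\<bar> ^ n /\<^sub>R fact n)"
      by (simp add: divide_inverse mult.commute)
    also have "\<dots> \<le> exp \<bar>x\<bar>"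
      unfolding exp_def by (rule sum_le_suminf[OF summable_exp_generic]) auto
    finally have "\<bar>x\<bar> ^ k / fact k \<le> exp \<bar>x\<bar>" .
    then have "\<bar>x\<bar> ^ k \<le> fact k * exp \<bar>x\<bar>" by (simp add: field_simps)
    then have "\<bar>x\<bar> ^ k * exp (- (x\<^sup>2 / 2)) \<le> fact k * exp \<bar>x\<bar> * exp (- (x\<^sup>2 / 2))"
      by (intro mult_right_mono) auto
    also have "\<dots> = fact k * exp (\<bar>x\<bar> - x\<^sup>2 / 2)" by (simp add: exp_add[symmetric] exp_diff exp_minus field_simps)
    also have "\<dots> \<le> fact k * exp 1"
    proof -
      have "0 \<le> (\<bar>x\<bar> - 1)\<^sup>2" by simp
      then have "\<bar>x\<bar> - x\<^sup>2 / 2 \<le> 1" by (simp add: power2_eq_square algebra_simps)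
      then show ?thesis by (intro mult_left_mono) auto
    qed
    finally show ?thesis .
  qed
  show ?thesis unfolding bounded_iff
    by (rule exI[of _ "fact k * exp 1"]) (use * in \<open>auto simp: abs_mult power_abs\<close>)
qed

lemma poly_gaussian_poly_bounded:
  "bounded (range (\<lambda>x::real. of_real (x ^ k * exp (- (x\<^sup>2 / 2))) * poly P (complex_of_real x)))"
proof (induction P arbitrary: k)
  case 0
  then show ?case by simp
next
  case (pCons a P)
  have "bounded (range (\<lambda>x::real. complex_of_real (x ^ k * exp (- (x\<^sup>2 / 2)))))"
    using poly_gaussian_bounded[of k] unfolding bounded_iff by (auto simp del: of_real_mult of_real_power)
  from bounded_range_add[OF bounded_range_cmult[OF this, of a] pCons.IH[of "Suc k"]]
  show ?case by (simp add: algebra_simps)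
qed

text \<open>
  The polynomial multiples of a modulated Gaussian form a class that is stable under
  differentiation and multiplication by \<open>x\<close>. They are restrictions of entire functions, so their
  derivatives come from complex differentiation. Pairing with these test functions is enough to separate
  functions.
\<close>

lemma schwartz_gaussian:
  "(\<lambda>x. cis (- (x * \<xi>)) * of_real (exp (- (x\<^sup>2 / 2)))) \<in> schwartz"
proof -
  define G where "G = (\<lambda>P z. poly P z * exp (- (z\<^sup>2 / 2) - \<i> * of_real \<xi> * z) :: complex)"
  let ?S = "{\<lambda>x. G P (of_real x) | P. True}"
  have G': "DERIV (G P) z :> G (pderiv P + P * [:- \<i> * of_real \<xi>, -1:]) z" for P z
    unfolding G_def by (auto intro!: derivative_eq_intros simp: algebra_simps)
  have V: "((\<lambda>x. G P (of_real x)) has_vector_derivative G (pderiv P + P * [:- \<i> * of_real \<xi>, -1:]) (of_real x)) (at x)" for P x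
    by (rule has_vector_derivative_real_field[OF G'])
  have Gx: "G P (of_real x) = cis (- (x * \<xi>)) * (of_real (exp (- (x\<^sup>2 / 2))) * poly P (of_real x))" for P x
  proof -
    have "exp (- ((complex_of_real x)\<^sup>2 / 2) - \<i> * of_real \<xi> * of_real x) = cis (- (x * \<xi>)) * of_real (exp (- (x\<^sup>2 / 2)))"
      unfolding cis_conv_exp exp_of_real[symmetric] exp_add[symmetric] by (rule arg_cong[of _ _ exp]) simp
    then show ?thesis unfolding G_def by (simp only: mult_ac)
  qed
  show ?thesis
  proof (rule schwartz_coinduct[where S = ?S])
    show "(\<lambda>x. cis (- (x * \<xi>)) * of_real (exp (- (x\<^sup>2 / 2)))) \<in> ?S"
      by (auto intro!: exI[of _ 1] simp: Gx fun_eq_iff)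
  next
    fix f x assume "f \<in> ?S"
    then show "f differentiable at x" using V by (auto intro: differentiableI_vector)
  next
    fix f assume "f \<in> ?S"
    then obtain P where f: "f = (\<lambda>x. G P (of_real x))" by auto
    show "bounded (range f)"
      using poly_gaussian_poly_bounded[of 0 P] unfolding f Gx bounded_iff by (simp add: norm_mult)
    show "vderiv f \<in> ?S" unfolding f using vderiv_eqI[OF V, of P] by auto
    show "(\<lambda>x. x *\<^sub>R f x) \<in> ?S" unfolding f
      by (auto intro!: exI[of _ "[:0, 1:] * P"] simp: G_def scaleR_conv_of_real)
  qed
qed

section \<open>The Fourier transform of Schwartz functions\<close>

lemma continuous_on_cis_comp [continuous_intros]:
  "continuous_on A u \<Longrightarrow> continuous_on A (\<lambda>x. cis (u x))"
  unfolding cis_conv_exp by (intro continuous_intros)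

lemma borel_measurable_cis [measurable]:
  "u \<in> borel_measurable M \<Longrightarrow> (\<lambda>x. cis (u x)) \<in> borel_measurable M"
  by (rule measurable_compose[of u M borel cis]) (auto intro!: borel_measurable_continuous_onI continuous_intros)

lemma integrable_cis_mult:
  fixes f :: "'a \<Rightarrow> complex"
  assumes "integrable M f" and [measurable]: "u \<in> borel_measurable M"
  shows "integrable M (\<lambda>x. cis (u x) * f x)"
  by (rule Bochner_Integration.integrable_bound[OF assms(1)])
    (use borel_measurable_integrable[OF assms(1)] in \<open>auto simp: norm_mult\<close>)

lemma norm_integral_cis_le:
  fixes f :: "'a \<Rightarrow> complex"
  shows "norm (LINT x|M. cis (u x) * f x) \<le> (LINT x|M. norm (f x))"
  using integral_norm_bound[of M "\<lambda>x. cis (u x) * f x"] by (simp add: norm_mult)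

lemma fourier_lborel:
  assumes "f \<in> borel_measurable borel"
  shows "fourier f \<xi> = (LBINT x. cis (- (x * \<xi>)) * f x)"
proof -
  note [measurable] = assms
  have "fourier f \<xi> = (LINT x|lebesgue. cis (- (x * \<xi>)) * f x)"
    by (simp add: fourier_def cis_conv_exp)
  also have "\<dots> = (LBINT x. cis (- (x * \<xi>)) * f x)"
    by (rule integral_completion) simp
  finally show ?thesis .
qed

text \<open>
  Reads a derivative off a Taylor estimate; it replaces a passage to the limit in
  difference quotients under the integral sign.
\<close>

lemma has_vector_derivative_quadratic:
  fixes F :: "real \<Rightarrow> complex"
  assumes "\<And>y. norm (F y - F x - (y - x) *\<^sub>R F') \<le> M * (y - x)\<^sup>2"
  shows "(F has_vector_derivative F') (at x)"
  unfolding has_vector_derivative_def has_derivative_within_alt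
proof (intro conjI allI impI)
  show "bounded_linear (\<lambda>h. h *\<^sub>R F')" by (intro bounded_linear_intros)
  fix e :: real assume e: "0 < e"
  show "\<exists>d>0. \<forall>y\<in>UNIV. norm (y - x) < d \<longrightarrow> norm (F y - F x - (y - x) *\<^sub>R F') \<le> e * norm (y - x)"
  proof (intro exI[of _ "e / (\<bar>M\<bar> + 1)"] conjI ballI impI)
    show "0 < e / (\<bar>M\<bar> + 1)" using e by simp
    fix y assume y: "norm (y - x) < e / (\<bar>M\<bar> + 1)"
    have "M * (y - x)\<^sup>2 \<le> (\<bar>M\<bar> + 1) * (\<bar>y - x\<bar> * \<bar>y - x\<bar>)"
      by (simp add: power2_eq_square abs_mult[symmetric] mult_right_mono)
    also have "\<dots> \<le> (\<bar>M\<bar> + 1) * (e / (\<bar>M\<bar> + 1) * \<bar>y - x\<bar>)"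
      using y by (intro mult_left_mono mult_right_mono) auto
    also have "\<dots> = e * \<bar>y - x\<bar>" by simp
    finally show "norm (F y - F x - (y - x) *\<^sub>R F') \<le> e * norm (y - x)"
      using assms[of y] by simp
  qed
qed

text \<open>
  The bound \<open>\<bar>exp (i t) - 1 - i t\<bar> \<le> t\<^sup>2 / 2\<close> and the integrability of
  \<open>x\<^sup>2 f x\<close> give a quadratic remainder.
\<close>

lemma fourier_has_vderiv:
  assumes f: "f \<in> schwartz"
  shows "(fourier f has_vector_derivative fourier (\<lambda>x. (- \<i>) * (x *\<^sub>R f x)) \<xi>) (at \<xi>)"
proof (rule has_vector_derivative_quadratic)
  define M where "M = (LBINT x. norm (x *\<^sub>R x *\<^sub>R f x)) / 2"
  fix y
  note f1 = schwartz_xmult[OF f] note f2 = schwartz_xmult[OF f1]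
  note [measurable] = schwartz_borel[OF f]
  have i0: "integrable lborel (\<lambda>x. cis (- (x * y)) * f x)" for y
    by (intro integrable_cis_mult schwartz_integrable f) simp
  have i1: "integrable lborel (\<lambda>x. cis (- (x * y)) * ((- \<i>) * (x *\<^sub>R f x)))" for y
    by (intro integrable_cis_mult integrable_mult_right schwartz_integrable f1) simp
  have "fourier f y - fourier f \<xi> - (y - \<xi>) *\<^sub>R fourier (\<lambda>x. (- \<i>) * (x *\<^sub>R f x)) \<xi>
     = (LBINT x. cis (- (x * y)) * f x - cis (- (x * \<xi>)) * f x - (y - \<xi>) *\<^sub>R (cis (- (x * \<xi>)) * ((- \<i>) * (x *\<^sub>R f x))))"
    using i0 i1[of \<xi>]
    by (simp only: fourier_lborel schwartz_borel[OF f] schwartz_borel[OF schwartz_cmult[OF f1]]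
        Bochner_Integration.integral_diff integral_scaleR_right Bochner_Integration.integrable_diff integrable_scaleR_right)
  also have "norm \<dots> \<le> (LBINT x. ((y - \<xi>)\<^sup>2 / 2) * norm (x *\<^sub>R x *\<^sub>R f x))"
  proof (rule order_trans[OF integral_norm_bound], rule integral_mono)
    show "integrable lborel (\<lambda>x. norm (cis (- (x * y)) * f x - cis (- (x * \<xi>)) * f x - (y - \<xi>) *\<^sub>R (cis (- (x * \<xi>)) * ((- \<i>) * (x *\<^sub>R f x)))))"
      by (intro integrable_norm Bochner_Integration.integrable_diff integrable_scaleR_right i0 i1)
    show "integrable lborel (\<lambda>x. (y - \<xi>)\<^sup>2 / 2 * norm (x *\<^sub>R x *\<^sub>R f x))"
      by (intro integrable_mult_right integrable_norm schwartz_integrable f2)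
    fix x
    have c: "cis (- (x * y)) = cis (- (x * \<xi>)) * cis (- (x * (y - \<xi>)))"
      by (simp add: cis_mult algebra_simps)
    have "cis (- (x * y)) * f x - cis (- (x * \<xi>)) * f x - (y - \<xi>) *\<^sub>R (cis (- (x * \<xi>)) * ((- \<i>) * (x *\<^sub>R f x)))
      = cis (- (x * \<xi>)) * (cis (- (x * (y - \<xi>))) - (1 + \<i> * (- (x * (y - \<xi>))))) * f x"
      unfolding c by (simp add: scaleR_conv_of_real algebra_simps)
    moreover have "norm (cis (- (x * (y - \<xi>))) - (1 + \<i> * (- (x * (y - \<xi>))))) \<le> (x * (y - \<xi>))\<^sup>2 / 2"
      using iexp_approx1[of "- (x * (y - \<xi>))" 1] by (simp add: cis_conv_exp power2_eq_square abs_mult ac_simps)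
    ultimately show "norm (cis (- (x * y)) * f x - cis (- (x * \<xi>)) * f x - (y - \<xi>) *\<^sub>R (cis (- (x * \<xi>)) * ((- \<i>) * (x *\<^sub>R f x))))
        \<le> (y - \<xi>)\<^sup>2 / 2 * norm (x *\<^sub>R x *\<^sub>R f x)"
      using mult_right_mono[of "norm (cis (- (x * (y - \<xi>))) - (1 + \<i> * (- (x * (y - \<xi>)))))" "(x * (y - \<xi>))\<^sup>2 / 2" "norm (f x)"]
      by (simp only: norm_mult norm_cis mult_1_left) (simp add: power_mult_distrib power2_eq_square abs_mult ac_simps)
  qed
  also have "\<dots> = M * (y - \<xi>)\<^sup>2" by (simp add: M_def)
  finally show "norm (fourier f y - fourier f \<xi> - (y - \<xi>) *\<^sub>R fourier (\<lambda>x. (- \<i>) * (x *\<^sub>R f x)) \<xi>) \<le> M * (y - \<xi>)\<^sup>2" .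
qed

lemma schwartz_tendsto_0:
  assumes f: "f \<in> schwartz" shows "(f \<longlongrightarrow> 0) at_top" "(f \<longlongrightarrow> 0) at_bot"
proof -
  define C where "C = schwartz_seminorm 0 0 f + schwartz_seminorm 2 0 f"
  have b: "norm (f x) \<le> C * inverse (1 + x\<^sup>2)" for x unfolding C_def by (rule schwartz_decay[OF f])
  have t: "((\<lambda>x::real. C * inverse (1 + x\<^sup>2)) \<longlongrightarrow> 0) at_top"
    by real_asymp
  have u: "((\<lambda>x::real. C * inverse (1 + x\<^sup>2)) \<longlongrightarrow> 0) at_bot"
    by real_asymp
  show "(f \<longlongrightarrow> 0) at_top" by (rule Lim_null_comparison[OF _ t]) (use b in auto)
  show "(f \<longlongrightarrow> 0) at_bot" by (rule Lim_null_comparison[OF _ u]) (use b in auto)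
qed

lemma integral_vderiv_eq_0:
  fixes g :: "real \<Rightarrow> complex"
  assumes d: "\<And>x. (g has_vector_derivative g' x) (at x)"
    and c: "\<And>x. isCont g' x" and i: "integrable lborel g'"
    and l: "(g \<longlongrightarrow> 0) at_top" "(g \<longlongrightarrow> 0) at_bot"
  shows "(LBINT x. g' x) = 0"
proof -
  have "(LBINT x=-\<infinity>..\<infinity>. g' x) = 0 - 0"
    by (rule interval_integral_FTC_integrable[where F = g])
      (use assms in \<open>auto simp: set_integrable_def ereal_tendsto_simps\<close>)
  then show ?thesis by (simp add: interval_lebesgue_integral_def set_lebesgue_integral_def)
qed

text \<open>
  Integration by parts: the derivative of \<open>exp (- i x \<xi>) f x\<close> has integral \<open>0\<close>,
  because this function vanishes at infinity.
\<close>

lemma fourier_vderiv: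
  assumes f: "f \<in> schwartz"
  shows "fourier (vderiv f) \<xi> = \<i> * \<xi> * fourier f \<xi>"
proof -
  define g where "g = (\<lambda>x. cis (- (x * \<xi>)) * f x)"
  define g' where "g' = (\<lambda>x. cis (- (x * \<xi>)) * vderiv f x - \<i> * \<xi> * (cis (- (x * \<xi>)) * f x))"
  note f' = schwartz_vderiv[OF f]
  have cd: "((\<lambda>x. cis (- (x * \<xi>))) has_vector_derivative (- \<i> * \<xi> * cis (- (x * \<xi>)))) (at x)" for x
  proof -
    have "((\<lambda>z. exp (- \<i> * of_real \<xi> * z)) has_field_derivative (- \<i> * \<xi> * exp (- \<i> * of_real \<xi> * of_real x))) (at (of_real x))"
      by (auto intro!: derivative_eq_intros)
    from has_vector_derivative_real_field[OF this] show ?thesis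
      by (simp add: cis_conv_exp algebra_simps)
  qed
  have i: "integrable lborel (\<lambda>x. cis (- (x * \<xi>)) * f x)" "integrable lborel (\<lambda>x. cis (- (x * \<xi>)) * vderiv f x)"
    by (intro integrable_cis_mult schwartz_integrable f f'; simp)+
  have "(LBINT x. g' x) = 0"
  proof (rule integral_vderiv_eq_0[of g])
    show "(g has_vector_derivative g' x) (at x)" for x
      unfolding g_def g'_def
      using has_vector_derivative_mult[OF cd schwartz_has_vderiv0[OF f], of x]
      by (simp add: algebra_simps)
    show "isCont g' x" for x
    proof -
      have "continuous_on UNIV g'" unfolding g'_def
        by (intro continuous_intros schwartz_continuous f f')
      then show ?thesis by (simp add: continuous_on_eq_continuous_at)
    qed
    show "integrable lborel g'" unfolding g'_def by (intro Bochner_Integration.integrable_diff integrable_mult_right i)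
    show "(g \<longlongrightarrow> 0) at_top" "(g \<longlongrightarrow> 0) at_bot"
      unfolding tendsto_norm_zero_iff[of g, symmetric]
      using schwartz_tendsto_0[OF f, THEN tendsto_norm_zero] by (auto simp: g_def norm_mult)
  qed
  also have "(LBINT x. g' x) = fourier (vderiv f) \<xi> - \<i> * \<xi> * fourier f \<xi>"
    unfolding g'_def using i by (simp add: fourier_lborel schwartz_borel f f')
  finally show ?thesis by simp
qed

lemma norm_fourier_le:
  assumes "f \<in> borel_measurable borel" shows "norm (fourier f \<xi>) \<le> (LBINT x. norm (f x))"
  unfolding fourier_lborel[OF assms] by (rule norm_integral_cis_le)

lemma fourier_cmult: "fourier (\<lambda>x. a * f x) \<xi> = a * fourier f \<xi>"
  unfolding fourier_def by (subst integral_mult_right_zero[symmetric]) (simp add: algebra_simps)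

text \<open>
  The image of the Schwartz space is a stable class, since the Fourier transform exchanges
  differentiation and multiplication by the variable.
\<close>

lemma schwartz_fourier:
  assumes "f \<in> schwartz" shows "fourier f \<in> schwartz"
proof (rule schwartz_coinduct[where S = "fourier ` schwartz"])
  fix g assume "g \<in> fourier ` schwartz"
  then obtain f where f: "f \<in> schwartz" and g: "g = fourier f" by blast
  show "g differentiable at x" for x unfolding g using fourier_has_vderiv[OF f] by (rule differentiableI_vector)
  show "bounded (range g)" unfolding g bounded_iff using norm_fourier_le[OF schwartz_borel[OF f]] by blast
  have "vderiv g = fourier (\<lambda>x. (- \<i>) * (x *\<^sub>R f x))" unfolding g by (rule vderiv_eqI[OF fourier_has_vderiv[OF f]])
  then show "vderiv g \<in> fourier ` schwartz" using schwartz_cmult[OF schwartz_xmult[OF f], of "- \<i>"] by blast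
  have "(\<lambda>x. x *\<^sub>R g x) = fourier (\<lambda>x. (- \<i>) * vderiv f x)"
    unfolding fourier_cmult fourier_vderiv[OF f] g by (simp add: fun_eq_iff scaleR_conv_of_real mult.assoc[symmetric])
  then show "(\<lambda>x. x *\<^sub>R g x) \<in> fourier ` schwartz" using schwartz_cmult[OF schwartz_vderiv[OF f], of "- \<i>"] by blast
qed (use assms in auto)

section \<open>Gaussian averages and Fourier inversion\<close>

lemma integrable_std_normal_cis: "integrable lborel (\<lambda>z. cis (t * z) * of_real (std_normal_density z))"
  by (intro integrable_cis_mult integrable_of_real integrable_normal_density) auto

lemma integral_std_normal_cis:
  "(LBINT z. cis (t * z) * of_real (std_normal_density z)) = of_real (exp (- (t\<^sup>2 / 2)))"
proof -
  have "char std_normal_distribution t = (LBINT z. std_normal_density z *\<^sub>R iexp (t * z))"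
    unfolding char_def by (intro integral_density) auto
  also have "\<dots> = (LBINT z. cis (t * z) * of_real (std_normal_density z))"
    by (simp add: cis_conv_exp scaleR_conv_of_real mult.commute)
  finally show ?thesis unfolding char_std_normal_distribution by simp
qed

lemma gaussian_eq_density: "exp (- (x\<^sup>2 / 2)) = sqrt (2 * pi) * std_normal_density x"
  by (simp add: std_normal_density_def)

lemma integral_gaussian_cis:
  assumes n: "0 < n"
  shows "integrable lborel (\<lambda>x. cis (x * y) * of_real (exp (- ((x / n)\<^sup>2 / 2))))" (is ?I)
    and "(LBINT x. cis (x * y) * of_real (exp (- ((x / n)\<^sup>2 / 2)))) = of_real (n * (2 * pi) * std_normal_density (n * y))" (is ?E)
proof -
  have e: "(\<lambda>x. cis ((0 + n * x) * y) * of_real (exp (- (((0 + n * x) / n)\<^sup>2 / 2)))) =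
      (\<lambda>x. of_real (sqrt (2 * pi)) * (cis ((n * y) * x) * of_real (std_normal_density x)))"
    using n by (simp add: gaussian_eq_density mult_ac)
  show ?I
    using n by (subst lborel_integrable_real_affine_iff[symmetric, of n _ 0])
      (simp, unfold e, intro integrable_mult_right integrable_std_normal_cis)
  have "(LBINT x. cis (x * y) * of_real (exp (- ((x / n)\<^sup>2 / 2)))) =
     n *\<^sub>R (of_real (sqrt (2 * pi)) * of_real (exp (- ((n * y)\<^sup>2 / 2))))"
    using n by (subst lborel_integral_real_affine[where c = n and t = 0])
      (simp, unfold e, simp only: integral_mult_right_zero integral_std_normal_cis abs_of_pos)
  also have "\<dots> = of_real (n * (2 * pi) * std_normal_density (n * y))"
    unfolding gaussian_eq_density by (simp add: scaleR_conv_of_real of_real_mult[symmetric] del: of_real_mult)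
  finally show ?E .
qed

lemma integrable_lborel_pair_mult:
  fixes f g :: "real \<Rightarrow> 'a :: {real_normed_field, banach, second_countable_topology}"
  assumes f: "integrable lborel f" and g: "integrable lborel g"
  shows "integrable (lborel \<Otimes>\<^sub>M lborel) (\<lambda>(x, y). f x * g y)"
proof (rule lborel_pair.Fubini_integrable)
  note [measurable] = borel_measurable_integrable[OF f] borel_measurable_integrable[OF g]
  show "(\<lambda>(x, y). f x * g y) \<in> borel_measurable (lborel \<Otimes>\<^sub>M lborel)" by measurable
  show "integrable lborel (\<lambda>x. LBINT y. norm (case (x, y) of (x, y) \<Rightarrow> f x * g y))"
    using f g by (simp add: norm_mult)
  show "AE x in lborel. integrable lborel (\<lambda>y. case (x, y) of (x, y) \<Rightarrow> f x * g y)"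
    using g by simp
qed

text \<open>
  Fubini, with the Gaussian integrated first. The left-hand side is a regularised Fourier
  integral, the right-hand side an average of \<open>k\<close> at scale \<open>1 / n\<close>; letting \<open>n\<close> tend to infinity
  yields Fourier inversion, and bounding the average by the supremum of \<open>k\<close> yields the integrability
  statement of Plancherel's theorem.
\<close>

lemma gaussian_pairing:
  fixes k :: "real \<Rightarrow> complex"
  assumes n: "0 < n" and k: "integrable lborel k"
  shows "(LBINT x. of_real (exp (- ((x / n)\<^sup>2 / 2))) * (LBINT y. cis (x * y) * k y))
    = 2 * pi * (LBINT z. of_real (std_normal_density z) * k (z / n))"
proof -
  note [measurable] = borel_measurable_integrable[OF k]
  let ?e = "\<lambda>x. complex_of_real (exp (- ((x / n)\<^sup>2 / 2)))"
  have ie: "integrable lborel ?e" using integral_gaussian_cis(1)[OF n, of 0] by simp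
  have ip: "integrable (lborel \<Otimes>\<^sub>M lborel) (\<lambda>(x, y). ?e x * (cis (x * y) * k y))"
  proof (rule Bochner_Integration.integrable_bound)
    show "integrable (lborel \<Otimes>\<^sub>M lborel) (\<lambda>(x, y). ?e x * k y)"
      by (rule integrable_lborel_pair_mult[OF ie k])
  qed (auto simp: norm_mult)
  have "(LBINT x. ?e x * (LBINT y. cis (x * y) * k y)) = (LBINT x. LBINT y. ?e x * (cis (x * y) * k y))"
    by simp
  also have "\<dots> = (LBINT y. LBINT x. ?e x * (cis (x * y) * k y))"
    by (rule lborel_pair.Fubini_integral[OF ip, symmetric])
  also have "\<dots> = (LBINT y. k y * (LBINT x. cis (x * y) * ?e x))"
    by (intro Bochner_Integration.integral_cong refl, subst integral_mult_right_zero[symmetric]) (simp add: mult_ac)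
  also have "\<dots> = (LBINT y. k y * of_real (n * (2 * pi) * std_normal_density (n * y)))"
    unfolding integral_gaussian_cis(2)[OF n] ..
  also have "\<dots> = (LBINT z. (1 / n) *\<^sub>R (k (z / n) * of_real (n * (2 * pi) * std_normal_density z)))"
    using n by (subst lborel_integral_real_affine[where c = "1 / n" and t = 0]) auto
  also have "\<dots> = (LBINT z. (2 * pi) * (of_real (std_normal_density z) * k (z / n)))"
    using n by (intro Bochner_Integration.integral_cong refl) (simp add: scaleR_conv_of_real)
  finally show ?thesis by (simp only: integral_mult_right_zero)
qed

abbreviation gauss :: "nat \<Rightarrow> real \<Rightarrow> real" where "gauss n x \<equiv> exp (- ((x / real n)\<^sup>2 / 2))"

lemma fourier_inversion:
  fixes f :: "real \<Rightarrow> complex"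
  assumes f: "f \<in> schwartz"
  shows "fourier (fourier f) x = 2 * pi * f (- x)"
proof -
  note F = schwartz_fourier[OF f]
  note [measurable] = schwartz_borel[OF f] schwartz_borel[OF F]
  define k where "k u = f (- x - u)" for u :: real
  have k: "integrable lborel k" unfolding k_def[abs_def]
    using lborel_integrable_real_affine[OF schwartz_integrable[OF f], of "-1" "-x"] by simp
  have [measurable]: "k \<in> borel_measurable borel" using borel_measurable_integrable[OF k] by simp
  have kc: "continuous_on UNIV k" unfolding k_def[abs_def]
    by (intro continuous_on_compose2[OF schwartz_continuous[OF f]] continuous_intros) auto
  have Fk: "(LBINT u. cis (\<xi> * u) * k u) = cis (- (\<xi> * x)) * fourier f \<xi>" for \<xi>
  proof -
    have "fourier f \<xi> = (LBINT u. cis (- ((- x - u) * \<xi>)) * k u)"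
      unfolding fourier_lborel[OF schwartz_borel[OF f]] k_def
      by (subst lborel_integral_real_affine[where c = "-1" and t = "-x"]) auto
    also have "\<dots> = (LBINT u. cis (\<xi> * x) * (cis (\<xi> * u) * k u))"
      unfolding mult.assoc[symmetric] cis_mult
      by (intro Bochner_Integration.integral_cong arg_cong2[where f = "(*)"] arg_cong[where f = cis] refl) algebra
    also have "\<dots> = cis (\<xi> * x) * (LBINT u. cis (\<xi> * u) * k u)"
      by (rule integral_mult_right_zero)
    finally show ?thesis unfolding mult.assoc[symmetric] by (simp add: cis_mult)
  qed
  have *: "(LBINT \<xi>. of_real (gauss (Suc n) \<xi>) * (cis (- (\<xi> * x)) * fourier f \<xi>))
    = 2 * pi * (LBINT z. of_real (std_normal_density z) * k (z / real (Suc n)))" for n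
    using gaussian_pairing[OF _ k, of "real (Suc n)"] unfolding Fk by simp
  have "(\<lambda>n. LBINT \<xi>. of_real (gauss (Suc n) \<xi>) * (cis (- (\<xi> * x)) * fourier f \<xi>))
     \<longlonglongrightarrow> (LBINT \<xi>. cis (- (\<xi> * x)) * fourier f \<xi>)"
  proof (rule integral_dominated_convergence[where w = "\<lambda>\<xi>. norm (fourier f \<xi>)"])
    show "integrable lborel (\<lambda>\<xi>. norm (fourier f \<xi>))" by (intro integrable_norm schwartz_integrable F)
    show "AE \<xi> in lborel. (\<lambda>n. of_real (gauss (Suc n) \<xi>) * (cis (- (\<xi> * x)) * fourier f \<xi>))
        \<longlonglongrightarrow> cis (- (\<xi> * x)) * fourier f \<xi>"
    proof (rule AE_I2)
      fix \<xi> :: real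
      have "(\<lambda>n. \<xi> / real (Suc n)) \<longlonglongrightarrow> 0" by real_asymp
      then have "(\<lambda>n. complex_of_real (gauss (Suc n) \<xi>) * (cis (- (\<xi> * x)) * fourier f \<xi>))
         \<longlonglongrightarrow> complex_of_real (exp (- (0\<^sup>2 / 2))) * (cis (- (\<xi> * x)) * fourier f \<xi>)"
        by (intro tendsto_intros) simp_all
      then show "(\<lambda>n. of_real (gauss (Suc n) \<xi>) * (cis (- (\<xi> * x)) * fourier f \<xi>))
        \<longlonglongrightarrow> cis (- (\<xi> * x)) * fourier f \<xi>" by simp
    qed
    show "AE \<xi> in lborel. norm (of_real (gauss (Suc n) \<xi>) * (cis (- (\<xi> * x)) * fourier f \<xi>)) \<le> norm (fourier f \<xi>)" for n
      by (intro AE_I2) (simp add: norm_mult mult_left_le_one_le)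
  qed auto
  moreover have "(\<lambda>n. LBINT z. of_real (std_normal_density z) * k (z / real (Suc n)))
    \<longlonglongrightarrow> (LBINT z. of_real (std_normal_density z) * k 0)"
  proof (rule integral_dominated_convergence[where w = "\<lambda>z. schwartz_seminorm 0 0 f * std_normal_density z"])
    show "integrable lborel (\<lambda>z. schwartz_seminorm 0 0 f * std_normal_density z)" by (intro integrable_mult_right) simp
    show "AE z in lborel. (\<lambda>n. of_real (std_normal_density z) * k (z / real (Suc n))) \<longlonglongrightarrow> of_real (std_normal_density z) * k 0"
    proof (rule AE_I2)
      fix z :: real
      have "(\<lambda>n. z / real (Suc n)) \<longlonglongrightarrow> 0" by real_asymp
      then have "(\<lambda>n. k (z / real (Suc n))) \<longlonglongrightarrow> k 0"
        using kc by (intro isCont_tendsto_compose[of 0 k]) (auto simp: continuous_on_eq_continuous_at)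
      then show "(\<lambda>n. of_real (std_normal_density z) * k (z / real (Suc n))) \<longlonglongrightarrow> of_real (std_normal_density z) * k 0"
        by (intro tendsto_intros)
    qed
    show "AE z in lborel. norm (of_real (std_normal_density z) * k (z / real (Suc n))) \<le> schwartz_seminorm 0 0 f * std_normal_density z" for n
      unfolding k_def norm_mult mult.commute[of "schwartz_seminorm 0 0 f"]
      using schwartz_bounded[OF f] by (intro AE_I2 mult_mono) auto
  qed auto
  then have "(\<lambda>n. 2 * pi * (LBINT z. of_real (std_normal_density z) * k (z / real (Suc n))))
    \<longlonglongrightarrow> 2 * pi * (LBINT z. of_real (std_normal_density z) * k 0)" by (intro tendsto_intros)
  ultimately have "(LBINT \<xi>. cis (- (\<xi> * x)) * fourier f \<xi>) = 2 * pi * (LBINT z. of_real (std_normal_density z) * k 0)"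
    unfolding * by (rule LIMSEQ_unique)
  also have "(LBINT z. of_real (std_normal_density z) * k 0) = k 0"
    using integral_std_normal_cis[of 0] by simp
  finally show ?thesis by (simp add: fourier_lborel k_def)
qed

section \<open>Uniqueness of representing functions\<close>

text \<open>
  The positive and the negative part of \<open>h\<close> have the same Fourier transform, in particular the
  same mass. After normalisation they are probability densities with the same characteristic function,
  and Levy's uniqueness theorem applies.
\<close>

lemma Fourier_L1_uniqueness_real:
  fixes h :: "real \<Rightarrow> real"
  assumes h: "integrable lborel h"
    and z: "\<And>t. (LBINT x. cis (t * x) * of_real (h x)) = 0"
  shows "AE x in lborel. h x = 0"
proof -
  note [measurable] = borel_measurable_integrable[OF h]
  define p q where "p = (\<lambda>x. max (h x) 0)" and "q = (\<lambda>x. max (- h x) 0)"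
  have [measurable]: "p \<in> borel_measurable borel" "q \<in> borel_measurable borel" unfolding p_def q_def by simp_all
  have ip: "integrable lborel p" and iq: "integrable lborel q" unfolding p_def q_def
    by (intro integrable_max h Bochner_Integration.integrable_minus integrable_zero)+
  have pq: "h x = p x - q x" for x by (simp add: p_def q_def)
  have nn: "0 \<le> p x" "0 \<le> q x" for x by (simp_all add: p_def q_def)
  have ic: "integrable lborel (\<lambda>x. cis (t * x) * of_real (p x))" "integrable lborel (\<lambda>x. cis (t * x) * of_real (q x))" for t
    by (intro integrable_cis_mult integrable_of_real ip iq; simp)+
  have eq: "(LBINT x. cis (t * x) * of_real (p x)) = (LBINT x. cis (t * x) * of_real (q x))" for t
    using z[of t] ic[of t] unfolding pq by (simp add: algebra_simps)
  define c where "c = (LBINT x. p x)"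
  have c': "c = (LBINT x. q x)" using eq[of 0] unfolding c_def by simp
  show ?thesis
  proof (cases "c = 0")
    case True
    have "AE x in lborel. p x = 0" "AE x in lborel. q x = 0"
      using integral_nonneg_eq_0_iff_AE[OF ip] integral_nonneg_eq_0_iff_AE[OF iq] nn True c' c_def by auto
    then show ?thesis by eventually_elim (simp add: pq)
  next
    case False
    then have cpos: "c > 0" unfolding c_def using Bochner_Integration.integral_nonneg[of lborel p] nn by (simp add: less_le)
    have rd: "real_distribution (density lborel (\<lambda>x. ennreal (r x / c)))"
      if [measurable]: "r \<in> borel_measurable borel" and r: "\<And>x. 0 \<le> r x" "integrable lborel r" "(LBINT x. r x) = c" for r
    proof -
      have "(\<integral>\<^sup>+ x. ennreal (r x / c) \<partial>lborel) = ennreal (LBINT x. r x / c)"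
        using r cpos by (intro nn_integral_eq_integral) (auto intro!: integrable_divide)
      also have "\<dots> = 1" using r cpos by simp
      finally have "prob_space (density lborel (\<lambda>x. ennreal (r x / c)))"
        by (intro prob_spaceI) (simp add: emeasure_density)
      then show ?thesis unfolding real_distribution_def real_distribution_axioms_def by simp
    qed
    have ch: "char (density lborel (\<lambda>x. ennreal (r x / c))) t = (LBINT x. cis (t * x) * of_real (r x)) / c"
      if [measurable]: "r \<in> borel_measurable borel" and r: "\<And>x. 0 \<le> r x" for r t
    proof -
      have "char (density lborel (\<lambda>x. ennreal (r x / c))) t = (LBINT x. (r x / c) *\<^sub>R iexp (t * x))"
        unfolding char_def using r cpos by (intro integral_density) auto
      also have "\<dots> = (LBINT x. (cis (t * x) * of_real (r x)) / c)"
        by (simp add: cis_conv_exp scaleR_conv_of_real mult.commute)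
      finally show ?thesis by simp
    qed
    have "density lborel (\<lambda>x. ennreal (p x / c)) = density lborel (\<lambda>x. ennreal (q x / c))"
      by (rule Levy_uniqueness) (use rd ch eq nn ip iq c_def c' in \<open>auto simp: fun_eq_iff\<close>)
    then have "AE x in lborel. ennreal (p x / c) = ennreal (q x / c)"
      by (intro sigma_finite_measure.density_unique[OF sigma_finite_lborel]) auto
    then show ?thesis
      by eventually_elim (use cpos nn in \<open>simp add: pq\<close>)
  qed
qed

lemma Fourier_L1_uniqueness:
  fixes h :: "real \<Rightarrow> complex"
  assumes h: "integrable lborel h"
    and z: "\<And>t. (LBINT x. cis (t * x) * h x) = 0"
  shows "AE x in lborel. h x = 0"
proof -
  have zc: "(LBINT x. cis (t * x) * cnj (h x)) = 0" for t
  proof -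
    have "cnj (LBINT x. cis (- t * x) * h x) = (LBINT x. cnj (cis (- t * x) * h x))"
      by (rule Bochner_Integration.integral_cnj[symmetric])
    then show ?thesis unfolding z by (simp add: cis_cnj)
  qed
  have ic: "integrable lborel (\<lambda>x. cis (t * x) * h x)" "integrable lborel (\<lambda>x. cis (t * x) * cnj (h x))" for t
    using h by (intro integrable_cis_mult integrable_cnj; simp)+
  have "AE x in lborel. Re (h x) = 0"
  proof (rule Fourier_L1_uniqueness_real)
    show "integrable lborel (\<lambda>x. Re (h x))" using h by simp
    fix t
    have "(LBINT x. cis (t * x) * of_real (Re (h x))) = (LBINT x. (cis (t * x) * h x + cis (t * x) * cnj (h x)) / 2)"
      by (intro Bochner_Integration.integral_cong refl) (simp add: distrib_left[symmetric] complex_add_cnj)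
    also have "\<dots> = 0" using ic[of t] by (simp add: z zc)
    finally show "(LBINT x. cis (t * x) * of_real (Re (h x))) = 0" .
  qed
  moreover have "AE x in lborel. Im (h x) = 0"
  proof (rule Fourier_L1_uniqueness_real)
    show "integrable lborel (\<lambda>x. Im (h x))" using h by simp
    fix t
    have "(LBINT x. cis (t * x) * of_real (Im (h x))) = (LBINT x. (cis (t * x) * h x - cis (t * x) * cnj (h x)) / (2 * \<i>))"
    proof (intro Bochner_Integration.integral_cong refl)
      fix x
      have *: "cis (t * x) * h x - cis (t * x) * cnj (h x) = cis (t * x) * of_real (Im (h x)) * (2 * \<i>)"
        unfolding right_diff_distrib[symmetric] complex_diff_cnj by simp
      show "cis (t * x) * of_real (Im (h x)) = (cis (t * x) * h x - cis (t * x) * cnj (h x)) / (2 * \<i>)"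
        unfolding * by (rule nonzero_mult_div_cancel_right[symmetric]) simp
    qed
    also have "\<dots> = 0" using ic[of t] by (simp add: z zc)
    finally show "(LBINT x. cis (t * x) * of_real (Im (h x))) = 0" .
  qed
  ultimately show ?thesis by eventually_elim (simp add: complex_eq_iff)
qed

lemma completion_ex_borel_measurable_complex:
  fixes g :: "'a \<Rightarrow> complex"
  assumes g: "g \<in> borel_measurable (completion M)"
  shows "\<exists>g'\<in>borel_measurable M. (AE x in M. g x = g' x)"
proof -
  have "(\<lambda>x. Re (g x)) \<in> borel_measurable (completion M)" "(\<lambda>x. Im (g x)) \<in> borel_measurable (completion M)"
    using g by measurable
  from this[THEN completion_ex_borel_measurable_real]
  obtain a b where [measurable]: "a \<in> borel_measurable M" "b \<in> borel_measurable M"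
    and "AE x in M. Re (g x) = a x" "AE x in M. Im (g x) = b x"
    by blast
  then show ?thesis
    by (intro bexI[of _ "\<lambda>x. Complex (a x) (b x)"])
      (auto elim!: eventually_elim2 simp: complex_eq_iff Complex_eq)
qed

text \<open>
  The difference of the two functions becomes integrable after multiplication by a Gaussian,
  and the values of its Fourier transform are then pairings with modulated Gaussians.
\<close>

lemma represents_unique:
  assumes "represents u h" "represents u h'"
  shows "AE x in lebesgue. h x = h' x"
proof -
  define d where "d = (\<lambda>x. h x - h' x)"
  have dm: "d \<in> borel_measurable lebesgue" and d0: "\<And>\<phi>. \<phi> \<in> schwartz \<Longrightarrow> integrable lebesgue (\<lambda>x. d x * \<phi> x)"
      "\<And>\<phi>. \<phi> \<in> schwartz \<Longrightarrow> (LINT x|lebesgue. d x * \<phi> x) = 0"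
    using assms unfolding represents_def d_def by (auto simp: left_diff_distrib)
  from completion_ex_borel_measurable_complex[OF dm] obtain d' where
    d'm: "d' \<in> borel_measurable lborel" and ae: "AE x in lborel. d x = d' x" by blast
  note [measurable] = d'm dm
  have aeL: "AE x in lebesgue. d x = d' x" using ae by (rule AE_completion)
  let ?e = "\<lambda>x. complex_of_real (exp (- (x\<^sup>2 / 2)))"
  have tr: "integrable lborel (\<lambda>x. d' x * \<phi> x)" "(LBINT x. d' x * \<phi> x) = 0" if p: "\<phi> \<in> schwartz" for \<phi>
  proof -
    have [measurable]: "\<phi> \<in> borel_measurable borel" by (rule schwartz_borel[OF p])
    have [measurable]: "\<phi> \<in> borel_measurable lebesgue" by (rule measurable_completion) simp
    have dd: "d' \<in> borel_measurable lebesgue" by (rule measurable_completion) (rule d'm)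
    note [measurable] = dd
    have "integrable lebesgue (\<lambda>x. d' x * \<phi> x)"
      using d0(1)[OF p] by (rule integrable_cong_AE_imp) (use aeL in \<open>auto elim!: eventually_mono\<close>)
    then show "integrable lborel (\<lambda>x. d' x * \<phi> x)" by (subst (asm) integrable_completion) auto
    have "(LBINT x. d' x * \<phi> x) = (LINT x|lebesgue. d' x * \<phi> x)"
      by (rule integral_completion[symmetric]) simp
    also have "\<dots> = (LINT x|lebesgue. d x * \<phi> x)"
      by (rule integral_cong_AE) (use aeL in \<open>auto elim!: eventually_mono\<close>)
    finally show "(LBINT x. d' x * \<phi> x) = 0" using d0(2)[OF p] by simp
  qed
  \<comment> \<open>The second factor is the Schwartz function that makes \<open>d'\<close> integrable.\<close>
  have "AE x in lborel. d' x * ?e x = 0"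
  proof (rule Fourier_L1_uniqueness)
    show "integrable lborel (\<lambda>x. d' x * ?e x)" using tr(1)[OF schwartz_gaussian[of 0]] by simp
    show "(LBINT x. cis (t * x) * (d' x * ?e x)) = 0" for t
      using tr(2)[OF schwartz_gaussian[of "- t"]] by (simp add: mult_ac)
  qed
  then have "AE x in lborel. d x = 0" using ae by eventually_elim simp
  then show ?thesis unfolding d_def by (intro AE_completion) simp
qed

section \<open>Inverse Fourier transforms and convolutions\<close>

definition inv_fourier :: "(real \<Rightarrow> complex) \<Rightarrow> real \<Rightarrow> complex"
  where "inv_fourier h x = (LBINT \<xi>. cis (x * \<xi>) * h \<xi>) / of_real (2 * pi)"

text \<open>
  The tempered distribution whose Fourier transform is the integrable function \<open>h\<close>; all
  distributions that are constructed below have this form.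
\<close>

definition freq_dist :: "(real \<Rightarrow> complex) \<Rightarrow> functional"
  where "freq_dist h = dist_of (inv_fourier h)"

definition conv :: "(real \<Rightarrow> complex) \<Rightarrow> (real \<Rightarrow> complex) \<Rightarrow> real \<Rightarrow> complex"
  where "conv h k \<xi> = (LBINT \<zeta>. h \<zeta> * k (\<xi> - \<zeta>))"

lemma borel_measurable_inv_fourier [measurable]:
  assumes [measurable]: "h \<in> borel_measurable borel"
  shows "inv_fourier h \<in> borel_measurable borel"
  unfolding inv_fourier_def[abs_def] by measurable

lemma borel_measurable_conv [measurable]:
  assumes [measurable]: "h \<in> borel_measurable borel" "k \<in> borel_measurable borel"
  shows "conv h k \<in> borel_measurable borel"
  unfolding conv_def[abs_def] by measurable

lemma norm_inv_fourier_le: "norm (inv_fourier h x) \<le> (LBINT \<xi>. norm (h \<xi>)) / (2 * pi)"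
  unfolding inv_fourier_def norm_divide
  using norm_integral_cis_le[of lborel "\<lambda>\<xi>. x * \<xi>" h] by (simp add: divide_right_mono)

lemma inv_fourier_eq_fourier:
  assumes "f \<in> borel_measurable borel" shows "inv_fourier f x = fourier f (- x) / of_real (2 * pi)"
  unfolding inv_fourier_def fourier_lborel[OF assms] by (simp add: mult.commute)

lemma inv_fourier_schwartz:
  assumes "f \<in> schwartz" shows "inv_fourier f \<in> schwartz"
  using schwartz_cmult[OF schwartz_reflect[OF schwartz_fourier[OF assms]], of "1 / of_real (2 * pi)"]
  by (simp add: inv_fourier_eq_fourier[OF schwartz_borel[OF assms], abs_def])

lemma inv_fourier_fourier: "f \<in> schwartz \<Longrightarrow> inv_fourier (fourier f) x = f x"
  by (simp add: inv_fourier_eq_fourier schwartz_borel schwartz_fourier fourier_inversion)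

lemma fourier_inv_fourier:
  assumes "f \<in> schwartz" shows "fourier (inv_fourier f) x = f x"
proof -
  have "inv_fourier (fourier f) x = f x" by (rule inv_fourier_fourier[OF assms])
  moreover have "fourier (inv_fourier f) x = inv_fourier (fourier f) x"
  proof -
    have "fourier (inv_fourier f) x = (LBINT y. cis (- (y * x)) * inv_fourier f y)"
      by (rule fourier_lborel[OF schwartz_borel[OF inv_fourier_schwartz[OF assms]]])
    also have "\<dots> = (LBINT y. cis (y * x) * inv_fourier f (- y))"
      by (subst lborel_integral_real_affine[where c = "-1" and t = 0]) auto
    also have "\<dots> = (LBINT y. cis (x * y) * fourier f y / of_real (2 * pi))"
      by (simp add: inv_fourier_eq_fourier[OF schwartz_borel[OF assms]] mult.commute)
    finally show ?thesis unfolding inv_fourier_def[of "fourier f"] by simp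
  qed
  ultimately show ?thesis by simp
qed

text \<open>
  With this identity the operations on \<open>freq_dist h\<close> reduce to operations on \<open>h\<close>.
\<close>

lemma inv_fourier_symmetric:
  assumes h: "integrable lborel h" and g: "integrable lborel g"
  shows "(LBINT x. inv_fourier h x * g x) = (LBINT \<xi>. h \<xi> * inv_fourier g \<xi>)"
proof -
  note [measurable] = borel_measurable_integrable[OF h] borel_measurable_integrable[OF g]
  have ip: "integrable (lborel \<Otimes>\<^sub>M lborel) (\<lambda>(x, y). cis (x * y) * (g x * h y))"
    using integrable_cis_mult[OF integrable_lborel_pair_mult[OF g h], of "\<lambda>(x, y). x * y"]
    by (simp add: case_prod_beta')
  have "(LBINT x. inv_fourier h x * g x) = (LBINT x. LBINT y. cis (x * y) * (g x * h y)) / of_real (2 * pi)"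
    unfolding inv_fourier_def integral_divide_zero[symmetric] integral_mult_left_zero[symmetric]
    by (simp add: mult_ac)
  also have "(LBINT x. LBINT y. cis (x * y) * (g x * h y)) = (LBINT y. LBINT x. cis (x * y) * (g x * h y))"
    by (rule lborel_pair.Fubini_integral[OF ip, symmetric])
  also have "\<dots> / of_real (2 * pi) = (LBINT \<xi>. h \<xi> * inv_fourier g \<xi>)"
    unfolding inv_fourier_def integral_divide_zero[symmetric] integral_mult_right_zero[symmetric] times_divide_eq_right
    by (simp add: mult_ac)
  finally show ?thesis .
qed

lemma borel_lebesgue: "f \<in> borel_measurable borel \<Longrightarrow> f \<in> borel_measurable lebesgue"
  by (intro measurable_completion) simp

lemma integrable_bounded_times:
  fixes f g :: "real \<Rightarrow> complex"
  assumes [measurable]: "f \<in> borel_measurable borel" and f: "\<And>x. norm (f x) \<le> B" and g: "integrable lborel g"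
  shows "integrable lborel (\<lambda>x. f x * g x)" "integrable lborel (\<lambda>x. g x * f x)"
proof -
  note [measurable] = borel_measurable_integrable[OF g]
  have "0 \<le> B" using f[of 0] norm_ge_zero order_trans by blast
  then show "integrable lborel (\<lambda>x. f x * g x)"
    by (intro Bochner_Integration.integrable_bound[OF integrable_mult_right[OF integrable_norm[OF g], of B]])
      (auto simp: norm_mult intro!: mult_right_mono f)
  then show "integrable lborel (\<lambda>x. g x * f x)" by (simp add: mult.commute)
qed

lemma dist_of_lborel:
  assumes [measurable]: "u \<in> borel_measurable borel" and "\<phi> \<in> schwartz"
  shows "dist_of u \<phi> = (LBINT x. u x * \<phi> x)"
proof -
  note [measurable] = schwartz_borel[OF assms(2)]
  show ?thesis using assms(2) unfolding dist_of_def by (simp add: integral_completion)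
qed

lemma represents_dist_of:
  assumes [measurable]: "u \<in> borel_measurable borel" and b: "\<And>x. norm (u x) \<le> B"
  shows "represents (dist_of u) u"
  unfolding represents_def
proof (intro conjI ballI)
  fix \<phi> assume p: "\<phi> \<in> schwartz"
  note [measurable] = schwartz_borel[OF p]
  show "integrable lebesgue (\<lambda>x. u x * \<phi> x)"
    using integrable_bounded_times(1)[OF _ b schwartz_integrable[OF p]] by (subst integrable_completion) auto
qed (auto simp: dist_of_def intro: borel_lebesgue)

lemma tempered_dist_of:
  assumes [measurable]: "u \<in> borel_measurable borel" and b: "\<And>x. norm (u x) \<le> B"
  shows "dist_of u \<in> tempered"
  unfolding tempered_def mem_Collect_eq
proof (intro conjI ballI allI impI)
  show "dist_of u f = 0" if "f \<notin> schwartz" for f using that by (simp add: dist_of_def)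
next
  fix f g a b' assume fg: "f \<in> schwartz" "g \<in> schwartz"
  have "integrable lborel (\<lambda>x. u x * f x)" "integrable lborel (\<lambda>x. u x * g x)"
    using integrable_bounded_times(1)[OF _ b] schwartz_integrable fg by auto
  then show "dist_of u (\<lambda>x. a * f x + b' * g x) = a * dist_of u f + b' * dist_of u g"
    using fg schwartz_lincomb[OF fg, of a b']
    by (simp add: dist_of_lborel distrib_left mult.left_commute[of "u _"])
next
  have B: "0 \<le> B" using b[of 0] norm_ge_zero order_trans by blast
  show "\<exists>C m. \<forall>f\<in>schwartz. norm (dist_of u f) \<le> C * (\<Sum>k\<le>m. \<Sum>n\<le>m. schwartz_seminorm k n f)"
  proof (intro exI[of _ "B * pi"] exI[of _ 2] ballI)
    fix f assume f: "f \<in> schwartz"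
    have s: "schwartz_seminorm 0 0 f + schwartz_seminorm 2 0 f \<le> (\<Sum>k\<le>2. \<Sum>n\<le>2. schwartz_seminorm k n f)"
      using schwartz_seminorm_nonneg[OF f] by (simp add: numeral_2_eq_2 add_nonneg_nonneg)
    have "norm (dist_of u f) \<le> (LBINT x. norm (u x * f x))"
      unfolding dist_of_lborel[OF assms(1) f] by (rule integral_norm_bound)
    also have "\<dots> \<le> (LBINT x. B * norm (f x))"
      using integrable_bounded_times(1)[OF assms(1) b schwartz_integrable[OF f]] schwartz_integrable[OF f]
      by (intro integral_mono integrable_norm integrable_mult_right) (auto simp: norm_mult intro!: mult_right_mono b)
    also have "\<dots> = B * (LBINT x. norm (f x))" by (rule integral_mult_right_zero)
    also have "\<dots> \<le> B * ((schwartz_seminorm 0 0 f + schwartz_seminorm 2 0 f) * pi)"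
      by (intro mult_left_mono schwartz_integral_norm_le f B)
    also have "\<dots> \<le> B * ((\<Sum>k\<le>2. \<Sum>n\<le>2. schwartz_seminorm k n f) * pi)"
      by (intro mult_left_mono mult_right_mono s B) simp
    finally show "norm (dist_of u f) \<le> B * pi * (\<Sum>k\<le>2. \<Sum>n\<le>2. schwartz_seminorm k n f)" by (simp add: mult_ac)
  qed
qed

text \<open>
  Every Schwartz function is the Fourier transform of a Schwartz function, so \<open>w\<close> is determined
  by its Fourier transform.
\<close>

lemma tempered_fourier_inject:
  assumes "w \<in> tempered" "w' \<in> tempered" "represents (fourier_dist w) h" "represents (fourier_dist w') h"
  shows "w = w'"
proof
  fix \<phi>
  show "w \<phi> = w' \<phi>"
  proof (cases "\<phi> \<in> schwartz")
    case True
    note i = inv_fourier_schwartz[OF True]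
    have e: "fourier (inv_fourier \<phi>) = \<phi>" using fourier_inv_fourier[OF True] by (simp add: fun_eq_iff)
    have "fourier_dist w (inv_fourier \<phi>) = fourier_dist w' (inv_fourier \<phi>)"
      using assms(3,4) i unfolding represents_def by metis
    then show ?thesis using i e by (simp add: fourier_dist_def)
  qed (use assms in \<open>simp add: tempered_def\<close>)
qed

lemma represents_dist_fun: "represents u h \<Longrightarrow> represents u (dist_fun u)"
  unfolding dist_fun_def by (rule someI[of "represents u"])

lemma dist_fun_AE: "represents u h \<Longrightarrow> AE x in lebesgue. dist_fun u x = h x"
  using represents_unique represents_dist_fun by blast

lemma represents_cong_AE:
  assumes u: "represents u h" and ae: "AE x in lebesgue. h x = h' x"
  shows "represents u h'"
  unfolding represents_def
proof (intro conjI ballI)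
  have m: "h \<in> borel_measurable lebesgue" using u by (simp add: represents_def)
  show m': "h' \<in> borel_measurable lebesgue"
    by (rule borel_measurable_AE[OF m]) (use ae in \<open>auto elim!: eventually_mono\<close>)
  fix \<phi> assume p: "\<phi> \<in> schwartz"
  note [measurable] = m m' borel_lebesgue[OF schwartz_borel[OF p]]
  have i: "integrable lebesgue (\<lambda>x. h x * \<phi> x)" and e: "u \<phi> = (LINT x|lebesgue. h x * \<phi> x)"
    using u p by (auto simp: represents_def)
  show "integrable lebesgue (\<lambda>x. h' x * \<phi> x)"
    using i by (rule integrable_cong_AE_imp) (use ae in \<open>auto elim!: eventually_mono\<close>)
  show "u \<phi> = (LINT x|lebesgue. h' x * \<phi> x)"
    unfolding e by (rule integral_cong_AE) (use ae in \<open>auto elim!: eventually_mono\<close>)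
qed

text \<open>
  Allows a Lebesgue measurable symbol to be replaced by a Borel measurable one.
\<close>

lemma fourier_mult_cong_AE:
  assumes "AE \<xi> in lebesgue. m \<xi> = m' \<xi>"
  shows "fourier_mult m u = fourier_mult m' u"
proof -
  have "represents v (\<lambda>\<xi>. m \<xi> * fourier_fun u \<xi>) \<longleftrightarrow> represents v (\<lambda>\<xi>. m' \<xi> * fourier_fun u \<xi>)" for v
    by (auto elim!: represents_cong_AE) (use assms in \<open>auto elim!: eventually_mono\<close>)
  then show ?thesis unfolding fourier_mult_def by simp
qed

section \<open>Distributions with integrable Fourier transform\<close>

context
  fixes h :: "real \<Rightarrow> complex" assumes h: "integrable lborel h"
begin

lemma borel_of_integrable: "h \<in> borel_measurable borel"
  using borel_measurable_integrable[OF h] by simp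

lemma tempered_freq_dist: "freq_dist h \<in> tempered"
  unfolding freq_dist_def
  by (rule tempered_dist_of[OF _ norm_inv_fourier_le]) (rule borel_measurable_inv_fourier[OF borel_of_integrable])

lemma represents_freq_dist: "represents (freq_dist h) (inv_fourier h)"
  unfolding freq_dist_def
  by (rule represents_dist_of[OF _ norm_inv_fourier_le]) (rule borel_measurable_inv_fourier[OF borel_of_integrable])

lemma freq_dist_apply:
  assumes "\<phi> \<in> schwartz" shows "freq_dist h \<phi> = (LBINT \<xi>. h \<xi> * inv_fourier \<phi> \<xi>)"
  unfolding freq_dist_def dist_of_lborel[OF borel_measurable_inv_fourier[OF borel_of_integrable] assms]
  by (rule inv_fourier_symmetric[OF h schwartz_integrable[OF assms]])

lemma represents_fourier_freq_dist: "represents (fourier_dist (freq_dist h)) h"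
  unfolding represents_def
proof (intro conjI ballI)
  show "h \<in> borel_measurable lebesgue" by (intro borel_lebesgue borel_of_integrable)
  fix \<phi> assume p: "\<phi> \<in> schwartz"
  note [measurable] = schwartz_borel[OF p] borel_of_integrable
  have "integrable lborel (\<lambda>x. h x * \<phi> x)"
    by (rule integrable_bounded_times(2)[OF _ schwartz_bounded[OF p] h]) simp
  then show "integrable lebesgue (\<lambda>x. h x * \<phi> x)" by (subst integrable_completion) auto
  have "fourier_dist (freq_dist h) \<phi> = (LBINT \<xi>. h \<xi> * inv_fourier (fourier \<phi>) \<xi>)"
    using p by (simp add: fourier_dist_def freq_dist_apply schwartz_fourier)
  also have "\<dots> = (LINT x|lebesgue. h x * \<phi> x)"
    by (simp add: inv_fourier_fourier[OF p] integral_completion)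
  finally show "fourier_dist (freq_dist h) \<phi> = (LINT x|lebesgue. h x * \<phi> x)" .
qed

lemma dist_fun_freq_dist: "AE x in lebesgue. dist_fun (freq_dist h) x = inv_fourier h x"
  by (rule dist_fun_AE[OF represents_freq_dist])

lemma fourier_fun_freq_dist: "AE x in lebesgue. fourier_fun (freq_dist h) x = h x"
  unfolding fourier_fun_def by (rule dist_fun_AE[OF represents_fourier_freq_dist])

end

lemma fourier_mult_freq_dist:
  assumes h: "integrable lborel h" and mh: "integrable lborel (\<lambda>\<xi>. m \<xi> * h \<xi>)"
  shows "fourier_mult m (freq_dist h) = freq_dist (\<lambda>\<xi>. m \<xi> * h \<xi>)"
  unfolding fourier_mult_def
proof (rule the_equality)
  have ae: "AE \<xi> in lebesgue. m \<xi> * h \<xi> = m \<xi> * fourier_fun (freq_dist h) \<xi>"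
    using fourier_fun_freq_dist[OF h] by eventually_elim simp
  show *: "freq_dist (\<lambda>\<xi>. m \<xi> * h \<xi>) \<in> tempered \<and>
    represents (fourier_dist (freq_dist (\<lambda>\<xi>. m \<xi> * h \<xi>))) (\<lambda>\<xi>. m \<xi> * fourier_fun (freq_dist h) \<xi>)"
    using tempered_freq_dist[OF mh] represents_cong_AE[OF represents_fourier_freq_dist[OF mh] ae] by blast
  fix w assume "w \<in> tempered \<and> represents (fourier_dist w) (\<lambda>\<xi>. m \<xi> * fourier_fun (freq_dist h) \<xi>)"
  then show "w = freq_dist (\<lambda>\<xi>. m \<xi> * h \<xi>)" using * tempered_fourier_inject by blast
qed

lemma freq_dist_add:
  assumes "integrable lborel h" "integrable lborel k"
  shows "freq_dist h + freq_dist k = freq_dist (\<lambda>\<xi>. h \<xi> + k \<xi>)"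
proof
  fix \<phi>
  have "integrable lborel (\<lambda>\<xi>. h \<xi> * inv_fourier \<phi> \<xi>)" "integrable lborel (\<lambda>\<xi>. k \<xi> * inv_fourier \<phi> \<xi>)" if "\<phi> \<in> schwartz"
    using assms schwartz_bounded[OF inv_fourier_schwartz[OF that]] schwartz_borel[OF inv_fourier_schwartz[OF that]]
    by (auto intro!: integrable_bounded_times)
  then show "(freq_dist h + freq_dist k) \<phi> = freq_dist (\<lambda>\<xi>. h \<xi> + k \<xi>) \<phi>"
    using assms by (cases "\<phi> \<in> schwartz") (auto simp: freq_dist_apply distrib_right, simp add: freq_dist_def dist_of_def)
qed

lemma freq_dist_cmult:
  assumes "integrable lborel h"
  shows "freq_dist (\<lambda>\<xi>. a * h \<xi>) \<phi> = a * freq_dist h \<phi>"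
  using assms by (cases "\<phi> \<in> schwartz") (simp_all add: freq_dist_apply mult.assoc, simp add: freq_dist_def dist_of_def)

lemma freq_dist_scaleR:
  assumes "integrable lborel h"
  shows "c *\<^sub>R freq_dist h = freq_dist (\<lambda>\<xi>. of_real c * h \<xi>)"
  by (rule ext) (simp add: scaleR_fun_def freq_dist_cmult[OF assms] scaleR_conv_of_real)

lemma freq_dist_diff:
  assumes h: "integrable lborel h" and k: "integrable lborel k"
  shows "freq_dist h - freq_dist k = freq_dist (\<lambda>\<xi>. h \<xi> - k \<xi>)"
proof -
  have "freq_dist (\<lambda>\<xi>. h \<xi> - k \<xi>) + freq_dist k = freq_dist h"
    using freq_dist_add[of "\<lambda>\<xi>. h \<xi> - k \<xi>" k] h k by simp
  then show ?thesis by (metis add_diff_cancel_right')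
qed

lemma dist_deriv_freq_dist:
  fixes k :: "real \<Rightarrow> complex"
  assumes k: "integrable lborel k" and k': "integrable lborel (\<lambda>\<xi>. \<i> * \<xi> * k \<xi>)"
  shows "dist_deriv (freq_dist k) = freq_dist (\<lambda>\<xi>. \<i> * \<xi> * k \<xi>)"
proof
  fix \<psi>
  show "dist_deriv (freq_dist k) \<psi> = freq_dist (\<lambda>\<xi>. \<i> * \<xi> * k \<xi>) \<psi>"
  proof (cases "\<psi> \<in> schwartz")
    case True
    have "inv_fourier (vderiv \<psi>) \<xi> = - (\<i> * \<xi> * inv_fourier \<psi> \<xi>)" for \<xi>
      using True by (simp add: inv_fourier_eq_fourier schwartz_borel schwartz_vderiv fourier_vderiv)
    moreover have "dist_deriv (freq_dist k) \<psi> = - (LBINT \<xi>. k \<xi> * inv_fourier (vderiv \<psi>) \<xi>)"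
      using True by (simp add: dist_deriv_def freq_dist_apply[OF k] schwartz_vderiv)
    moreover have "freq_dist (\<lambda>\<xi>. \<i> * \<xi> * k \<xi>) \<psi> = (LBINT \<xi>. - (k \<xi> * (- (\<i> * \<xi> * inv_fourier \<psi> \<xi>))))"
      unfolding freq_dist_apply[OF k' True] by (simp add: mult_ac)
    ultimately show ?thesis by (simp only: Bochner_Integration.integral_minus)
  qed (simp add: dist_deriv_def freq_dist_def dist_of_def)
qed

lemma integrable_conv_pair:
  fixes h k :: "real \<Rightarrow> complex"
  assumes h: "integrable lborel h" and k: "integrable lborel k"
  shows "integrable (lborel \<Otimes>\<^sub>M lborel) (\<lambda>(\<zeta>, \<xi>). h \<zeta> * k (\<xi> - \<zeta>))"
proof (rule lborel_pair.Fubini_integrable)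
  note [measurable] = borel_measurable_integrable[OF h] borel_measurable_integrable[OF k]
  show "(\<lambda>(\<zeta>, \<xi>). h \<zeta> * k (\<xi> - \<zeta>)) \<in> borel_measurable (lborel \<Otimes>\<^sub>M lborel)" by measurable
  have sh: "(LBINT \<xi>. norm (k (\<xi> - \<zeta>))) = (LBINT \<xi>. norm (k \<xi>))" for \<zeta>
    by (subst lborel_integral_real_affine[where c = 1 and t = \<zeta>]) auto
  show "integrable lborel (\<lambda>x. LBINT y. norm (case (x, y) of (\<zeta>, \<xi>) \<Rightarrow> h \<zeta> * k (\<xi> - \<zeta>)))"
    using h by (simp add: norm_mult sh)
  show "AE x in lborel. integrable lborel (\<lambda>y. case (x, y) of (\<zeta>, \<xi>) \<Rightarrow> h \<zeta> * k (\<xi> - \<zeta>))"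
  proof (rule AE_I2)
    fix x
    show "integrable lborel (\<lambda>y. case (x, y) of (\<zeta>, \<xi>) \<Rightarrow> h \<zeta> * k (\<xi> - \<zeta>))"
      using lborel_integrable_real_affine[OF k, of 1 "- x"] by simp
  qed
qed

lemma integrable_conv:
  assumes h: "integrable lborel h" and k: "integrable lborel k"
  shows "integrable lborel (conv h k)"
  unfolding conv_def[abs_def] using lborel_pair.integrable_snd[OF integrable_conv_pair[OF assms]] by simp

lemma inv_fourier_conv:
  assumes h: "integrable lborel h" and k: "integrable lborel k"
  shows "inv_fourier (\<lambda>\<xi>. conv h k \<xi> / of_real (2 * pi)) x = inv_fourier h x * inv_fourier k x"
proof -
  note [measurable] = borel_measurable_integrable[OF h] borel_measurable_integrable[OF k]
  have ip: "integrable (lborel \<Otimes>\<^sub>M lborel) (\<lambda>(\<zeta>, \<xi>). cis (x * \<xi>) * (h \<zeta> * k (\<xi> - \<zeta>)))"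
    using integrable_cis_mult[OF integrable_conv_pair[OF h k], of "\<lambda>(\<zeta>, \<xi>). x * \<xi>"]
    by (simp add: case_prod_beta')
  have sh: "(LBINT \<xi>. cis (x * \<xi>) * k (\<xi> - \<zeta>)) = cis (x * \<zeta>) * (LBINT \<xi>. cis (x * \<xi>) * k \<xi>)" for \<zeta>
    by (subst lborel_integral_real_affine[where c = 1 and t = \<zeta>])
      (auto simp: distrib_left cis_mult[symmetric] mult.assoc)
  have "(LBINT \<xi>. cis (x * \<xi>) * conv h k \<xi>) = (LBINT \<xi>. LBINT \<zeta>. cis (x * \<xi>) * (h \<zeta> * k (\<xi> - \<zeta>)))"
    unfolding conv_def by simp
  also have "\<dots> = (LBINT \<zeta>. LBINT \<xi>. cis (x * \<xi>) * (h \<zeta> * k (\<xi> - \<zeta>)))"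
    by (rule lborel_pair.Fubini_integral[OF ip])
  also have "\<dots> = (LBINT \<zeta>. h \<zeta> * (LBINT \<xi>. cis (x * \<xi>) * k (\<xi> - \<zeta>)))"
    unfolding integral_mult_right_zero[symmetric] by (simp add: mult.left_commute)
  also have "\<dots> = (LBINT \<zeta>. cis (x * \<zeta>) * h \<zeta>) * (LBINT \<xi>. cis (x * \<xi>) * k \<xi>)"
    unfolding sh integral_mult_left_zero[symmetric] by (simp add: mult_ac)
  finally show ?thesis unfolding inv_fourier_def by simp
qed

lemma dist_square_freq_dist:
  assumes h: "integrable lborel h"
  shows "dist_square (freq_dist h) = freq_dist (\<lambda>\<xi>. conv h h \<xi> / of_real (2 * pi))"
proof -
  note [measurable] = borel_measurable_integrable[OF h]
  have ae: "AE x in lebesgue. (dist_fun (freq_dist h) x)\<^sup>2 = inv_fourier (\<lambda>\<xi>. conv h h \<xi> / of_real (2 * pi)) x"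
    using dist_fun_freq_dist[OF h] unfolding inv_fourier_conv[OF h h] by eventually_elim (simp add: power2_eq_square)
  have [measurable]: "dist_fun (freq_dist h) \<in> borel_measurable lebesgue"
    using represents_dist_fun[OF represents_freq_dist[OF h]] by (simp add: represents_def)
  have [measurable]: "inv_fourier (\<lambda>\<xi>. conv h h \<xi> / of_real (2 * pi)) \<in> borel_measurable lebesgue"
    by (rule borel_lebesgue) simp
  show ?thesis unfolding dist_square_def freq_dist_def[of "\<lambda>\<xi>. conv h h \<xi> / of_real (2 * pi)"] dist_of_def
  proof (intro ext if_cong refl integral_cong_AE)
    fix \<phi> assume "\<phi> \<in> schwartz"
    note [measurable] = borel_lebesgue[OF schwartz_borel[OF this]]
    show "(\<lambda>x. (dist_fun (freq_dist h) x)\<^sup>2 * \<phi> x) \<in> borel_measurable lebesgue"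
      "(\<lambda>x. inv_fourier (\<lambda>\<xi>. conv h h \<xi> / of_real (2 * pi)) x * \<phi> x) \<in> borel_measurable lebesgue"
      by measurable
    show "AE x in lebesgue. (dist_fun (freq_dist h) x)\<^sup>2 * \<phi> x = inv_fourier (\<lambda>\<xi>. conv h h \<xi> / of_real (2 * pi)) x * \<phi> x"
      using ae by eventually_elim simp
  qed
qed

text \<open>
  The square of the modulus of the inverse Fourier transform is the inverse Fourier transform of
  the autocorrelation \<open>k\<close> of \<open>h\<close>. Since \<open>k\<close> is bounded, so are the Gaussian averages of the square,
  and Fatou's lemma removes the Gaussian.
\<close>

lemma is_L2_freq_dist:
  assumes h: "integrable lborel h" and b: "\<And>\<xi>. norm (h \<xi>) \<le> B"
  shows "is_L2 (freq_dist h)"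
proof -
  note [measurable] = borel_measurable_integrable[OF h]
  define h' where "h' = (\<lambda>\<xi>. cnj (h (- \<xi>)))"
  have h': "integrable lborel h'" unfolding h'_def
    using lborel_integrable_real_affine[OF h, of "-1" 0] by (intro integrable_cnj) simp
  note [measurable] = borel_measurable_integrable[OF h']
  define k where "k = (\<lambda>\<xi>. conv h h' \<xi> / of_real (2 * pi))"
  have k: "integrable lborel k" unfolding k_def by (intro integrable_divide integrable_conv h h')
  have "inv_fourier h' x = cnj (inv_fourier h x)" for x
  proof -
    have "(LBINT \<xi>. cis (x * \<xi>) * h' \<xi>) = (LBINT \<xi>. cnj (cis (x * \<xi>) * h \<xi>))"
      unfolding h'_def by (subst lborel_integral_real_affine[where c = "-1" and t = 0]) (auto simp: cis_cnj)
    then show ?thesis unfolding inv_fourier_def by (simp only: Bochner_Integration.integral_cnj complex_cnj_divide complex_cnj_complex_of_real)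
  qed
  then have k_eq: "inv_fourier k x = of_real ((norm (inv_fourier h x))\<^sup>2)" for x
    unfolding k_def inv_fourier_conv[OF h h'] by (simp only: complex_norm_square)
  define K where "K = B * (LBINT \<xi>. norm (h \<xi>)) / (2 * pi)"
  have kb: "norm (k \<xi>) \<le> K" for \<xi>
  proof -
    have "norm (conv h h' \<xi>) \<le> (LBINT \<zeta>. norm (h \<zeta> * h' (\<xi> - \<zeta>)))"
      unfolding conv_def by (rule integral_norm_bound)
    also have "\<dots> \<le> (LBINT \<zeta>. B * norm (h \<zeta>))"
    proof (rule integral_mono)
      show "integrable lborel (\<lambda>\<zeta>. norm (h \<zeta> * h' (\<xi> - \<zeta>)))"
      proof (intro integrable_norm integrable_bounded_times(2)[OF _ _ h, of _ B])
        show "norm (h' (\<xi> - x)) \<le> B" for x by (simp add: h'_def b)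
      qed simp
      show "integrable lborel (\<lambda>\<zeta>. B * norm (h \<zeta>))" using h by simp
      show "norm (h \<zeta> * h' (\<xi> - \<zeta>)) \<le> B * norm (h \<zeta>)" for \<zeta>
        using b[of "- (\<xi> - \<zeta>)"] unfolding norm_mult h'_def complex_mod_cnj mult.commute[of B] by (intro mult_left_mono) auto
    qed
    finally show ?thesis unfolding k_def K_def norm_divide by (simp add: divide_right_mono)
  qed
  let ?g = "\<lambda>x. (norm (inv_fourier h x))\<^sup>2"
  let ?e = "\<lambda>n. gauss (Suc n)"
  have g_int: "integrable lborel (\<lambda>x. ?e n x * ?g x)" and g_bd: "(LBINT x. ?e n x * ?g x) \<le> K" for n
  proof -
    have ie: "integrable lborel (\<lambda>x. complex_of_real (?e n x))"
      using integral_gaussian_cis(1)[of "real (Suc n)" 0] by simp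
    have "norm (inv_fourier k x) \<le> (LBINT \<xi>. norm (k \<xi>)) / (2 * pi)" for x by (rule norm_inv_fourier_le)
    from integrable_bounded_times(2)[OF _ this ie]
    have i: "integrable lborel (\<lambda>x. complex_of_real (?e n x) * inv_fourier k x)" using k by simp
    then have i': "integrable lborel (\<lambda>x. complex_of_real (?e n x * ?g x))" unfolding k_eq by simp
    show gi: "integrable lborel (\<lambda>x. ?e n x * ?g x)" by (rule complex_of_real_integrable_eq[THEN iffD1, OF i'])
    have "complex_of_real (LBINT x. ?e n x * ?g x) = (LBINT x. complex_of_real (?e n x * ?g x))"
      by (rule integral_of_real[OF gi, symmetric])
    also have "\<dots> = (LBINT x. of_real (?e n x) * ((LBINT y. cis (x * y) * k y) / of_real (2 * pi)))"
      by (simp only: of_real_mult k_eq[symmetric] inv_fourier_def[of k])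
    also have "\<dots> = (LBINT z. of_real (std_normal_density z) * k (z / real (Suc n)))"
      using gaussian_pairing[OF _ k, of "real (Suc n)"] by (simp del: of_nat_Suc)
    finally have "norm (complex_of_real (LBINT x. ?e n x * ?g x)) \<le> (LBINT z. norm (of_real (std_normal_density z) * k (z / real (Suc n))))"
      by (simp only: integral_norm_bound)
    also have "\<dots> \<le> (LBINT z. K * std_normal_density z)"
    proof (rule integral_mono)
      have [measurable]: "k \<in> borel_measurable borel" using borel_measurable_integrable[OF k] by simp
      have kb': "norm (k (z / real (Suc n))) \<le> K" for z by (rule kb)
      show "integrable lborel (\<lambda>z. norm (complex_of_real (std_normal_density z) * k (z / real (Suc n))))"
        by (intro integrable_norm integrable_bounded_times(2)[OF _ kb'] integrable_of_real) simp_all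
    qed (auto simp: norm_mult mult.commute[of K] intro!: mult_left_mono kb)
    also have "\<dots> = K" by simp
    finally show "(LBINT x. ?e n x * ?g x) \<le> K" by (simp add: abs_le_iff)
  qed
  have "integrable lborel ?g"
  proof (rule integrableI_bounded)
    have "(\<integral>\<^sup>+x. ennreal (?g x) \<partial>lborel) = (\<integral>\<^sup>+x. liminf (\<lambda>n. ennreal (?e n x * ?g x)) \<partial>lborel)"
    proof (rule nn_integral_cong)
      fix x :: real
      have "(\<lambda>n. x / real (Suc n)) \<longlonglongrightarrow> 0" by real_asymp
      then have "(\<lambda>n. ennreal (?e n x * ?g x)) \<longlonglongrightarrow> ennreal (exp (- (0\<^sup>2 / 2)) * ?g x)"
        by (intro tendsto_intros tendsto_ennrealI) simp_all
      then have "liminf (\<lambda>n. ennreal (?e n x * ?g x)) = ennreal (exp (- (0\<^sup>2 / 2)) * ?g x)"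
        by (intro lim_imp_Liminf) simp_all
      then show "ennreal (?g x) = liminf (\<lambda>n. ennreal (?e n x * ?g x))" by simp
    qed
    also have "\<dots> \<le> liminf (\<lambda>n. \<integral>\<^sup>+x. ennreal (?e n x * ?g x) \<partial>lborel)"
      by (rule nn_integral_liminf) measurable
    also have "\<dots> \<le> liminf (\<lambda>n. ennreal K)"
    proof (intro Liminf_mono always_eventually allI)
      fix n
      have "(\<integral>\<^sup>+x. ennreal (?e n x * ?g x) \<partial>lborel) = ennreal (LBINT x. ?e n x * ?g x)"
        by (rule nn_integral_eq_integral[OF g_int]) simp
      also have "\<dots> \<le> ennreal K" by (rule ennreal_leI[OF g_bd])
      finally show "(\<integral>\<^sup>+x. ennreal (?e n x * ?g x) \<partial>lborel) \<le> ennreal K" .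
    qed
    also have "\<dots> = ennreal K" by (simp add: Liminf_const)
    also have "\<dots> < \<infinity>" by simp
    finally show "(\<integral>\<^sup>+x. ennreal (norm (?g x)) \<partial>lborel) < \<infinity>" by simp
  qed simp
  then have "integrable lebesgue ?g" by (subst integrable_completion) auto
  then show ?thesis unfolding is_L2_def using represents_freq_dist[OF h] by blast
qed

section \<open>Second differences of twice differentiable maps\<close>

text \<open>
  The supremum of an unbounded set of reals is an unspecified number, so the
  boundedness of \<open>A\<close> has to be known before its operator norm bounds anything.
\<close>

lemma op_apply_le:
  assumes "\<forall>x\<in>car X. nrm Y (A x) \<le> K * nrm X x" "\<And>x. x \<in> car X \<Longrightarrow> 0 \<le> nrm X x"
    and "x \<in> car X" "nrm X x \<le> 1"
  shows "nrm Y (A x) \<le> nrm (op_space X Y) A"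
proof -
  have "nrm Y (A z) \<le> \<bar>K\<bar>" if "z \<in> car X" "nrm X z \<le> 1" for z
  proof -
    have "nrm Y (A z) \<le> K * nrm X z" using assms that by blast
    also have "\<dots> \<le> \<bar>K\<bar> * nrm X z" using assms(2)[OF that(1)] by (intro mult_right_mono) auto
    also have "\<dots> \<le> \<bar>K\<bar> * 1" using that by (intro mult_left_mono) auto
    finally show ?thesis by simp
  qed
  then have "bdd_above {nrm Y (A x) | x. x \<in> car X \<and> nrm X x \<le> 1}" by (auto intro!: bdd_aboveI)
  then show ?thesis unfolding op_space_def using assms(3,4) by (auto intro!: cSup_upper)
qed

text \<open>
  The derivative \<open>D1\<close> is itself differentiable at \<open>0\<close>, with a bounded derivative, and therefore
  Lipschitz at \<open>0\<close> with a constant that does not depend on the direction \<open>\<phi>\<close>. The mean value inequality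
  for the scalar function \<open>\<theta> \<mapsto> L (F (\<theta> \<phi>))\<close> turns this into a quadratic bound; the linear terms
  for \<open>\<theta>\<close> and \<open>- \<theta>\<close> cancel. The functional \<open>L\<close> keeps all limits in the complex numbers, and the
  set \<open>W\<close> lets differences of values of \<open>F\<close> leave the carrier of \<open>Y\<close> as long as their norm makes sense.
\<close>

lemma C2_at_second_difference:
  fixes X :: "'a::real_vector nspace" and Y :: "'b::real_vector nspace" and L :: "'b \<Rightarrow> complex"
  assumes C2: "C2_at X Y F 0"
    and Xc: "\<And>c x. x \<in> car X \<Longrightarrow> c *\<^sub>R x \<in> car X"
    and Xn: "\<And>c x. x \<in> car X \<Longrightarrow> nrm X (c *\<^sub>R x) = \<bar>c\<bar> * nrm X x"
    and X0: "\<And>x. x \<in> car X \<Longrightarrow> 0 \<le> nrm X x"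
    and YW: "car Y \<subseteq> W"
    and Wd: "\<And>a b. a \<in> W \<Longrightarrow> b \<in> W \<Longrightarrow> a - b \<in> W"
    and Wn: "\<And>a b. a \<in> W \<Longrightarrow> b \<in> W \<Longrightarrow> nrm Y (a - b) \<le> 2 * (nrm Y a + nrm Y b)"
    and Ws: "\<And>c a. a \<in> W \<Longrightarrow> c *\<^sub>R a \<in> W"
    and Ld: "\<And>a b. a \<in> W \<Longrightarrow> b \<in> W \<Longrightarrow> L (a - b) = L a - L b"
    and Ls: "\<And>c a. a \<in> W \<Longrightarrow> L (c *\<^sub>R a) = c *\<^sub>R L a"
    and Lb: "\<And>a. a \<in> W \<Longrightarrow> norm (L a) \<le> M * nrm Y a" and M: "0 \<le> M"
  shows "\<exists>K. \<forall>\<phi>\<in>car X. nrm X \<phi> \<le> 1 \<longrightarrow> (\<exists>d>0. \<forall>\<theta>. 0 < \<theta> \<and> \<theta> < d \<longrightarrow>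
    norm (L (F (\<theta> *\<^sub>R \<phi>)) + L (F ((- \<theta>) *\<^sub>R \<phi>)) - 2 * L (F 0)) \<le> K * \<theta>\<^sup>2)"
proof -
  from C2 obtain r D1 D2 where r: "0 < r" and zero: "0 \<in> car X"
    and FY: "\<And>x. x \<in> car X \<Longrightarrow> nrm X x < r \<Longrightarrow> F x \<in> car Y"
    and F1: "\<And>x. x \<in> car X \<Longrightarrow> nrm X x < r \<Longrightarrow> has_frechet X Y F (D1 x) x"
    and F2: "\<And>x. x \<in> car X \<Longrightarrow> nrm X x < r \<Longrightarrow> has_frechet X (op_space X Y) D1 (D2 x) x"
    unfolding C2_at_def by auto
  have n0: "nrm X 0 = 0" using Xn[OF zero, of 0] by simp
  from F2[OF zero] n0 r have "has_frechet X (op_space X Y) D1 (D2 0) 0" by simp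
  then obtain d1 where D2: "D2 0 \<in> car (op_space X (op_space X Y))" and d1: "0 < d1"
    and D1d: "\<And>h. h \<in> car X \<Longrightarrow> nrm X h < d1 \<Longrightarrow> nrm (op_space X Y) (D1 (0 + h) - D1 0 - D2 0 h) \<le> 1 * nrm X h"
    unfolding has_frechet_def by (meson zero_less_one)
  from D2 have "\<exists>K. \<forall>x\<in>car X. nrm (op_space X Y) (D2 0 x) \<le> K * nrm X x"
    and D2c: "\<And>x. x \<in> car X \<Longrightarrow> D2 0 x \<in> car (op_space X Y)"
    by (simp_all add: op_space_def[of X "op_space X Y"])
  then obtain K2 where K2: "\<And>x. x \<in> car X \<Longrightarrow> nrm (op_space X Y) (D2 0 x) \<le> K2 * nrm X x"
    by blast
  have D1c: "D1 x \<in> car (op_space X Y)" if "x \<in> car X" "nrm X x < r" for x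
    using F1[OF that] by (simp add: has_frechet_def)
  have opY: "A x \<in> W" if "A \<in> car (op_space X Y)" "x \<in> car X" for A x
    using that YW by (auto simp: op_space_def)
  have opK: "\<exists>K. \<forall>x\<in>car X. nrm Y (A x) \<le> K * nrm X x" if "A \<in> car (op_space X Y)" for A
    using that by (auto simp: op_space_def)
  define K where "K = M * (1 + \<bar>K2\<bar>)"
  have K0: "0 \<le> K" using M by (simp add: K_def)
  show ?thesis
  proof (rule exI[of _ "2 * K"], intro ballI impI)
    fix \<phi> assume \<phi>: "\<phi> \<in> car X" and n1: "nrm X \<phi> \<le> 1"
    define d where "d = min r d1"
    have d: "0 < d" "d \<le> r" "d \<le> d1" using r d1 by (auto simp: d_def)
    have tc: "t *\<^sub>R \<phi> \<in> car X" for t by (rule Xc[OF \<phi>])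
    have tn: "nrm X (t *\<^sub>R \<phi>) \<le> \<bar>t\<bar>" for t
      unfolding Xn[OF \<phi>] using n1 by (simp add: mult_left_le)
    have tr: "nrm X (t *\<^sub>R \<phi>) < r" if "\<bar>t\<bar> < d" for t using tn[of t] that d by linarith
    define g where "g t = L (F (t *\<^sub>R \<phi>))" for t
    define g' where "g' t = L (D1 (t *\<^sub>R \<phi>) \<phi>)" for t
    have FW: "F (t *\<^sub>R \<phi>) \<in> W" if "\<bar>t\<bar> < d" for t using FY[OF tc tr[OF that]] YW by blast
    \<comment> \<open>The difference of \<open>D1\<close> at \<open>t \<phi>\<close> and at \<open>0\<close> is \<open>A\<close>, the error of the linearisation of \<open>D1\<close>,
      plus a value of the bounded operator \<open>D2 0\<close>.\<close>
    have g'_lip: "norm (g' t - g' 0) \<le> K * \<bar>t\<bar>" if t: "\<bar>t\<bar> < d" for t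
    proof -
      define x where "x = t *\<^sub>R \<phi>"
      have x: "x \<in> car X" "nrm X x < r" "nrm X x < d1" "nrm X x \<le> \<bar>t\<bar>"
        using tc tr[OF t] tn[of t] t d by (auto simp: x_def)
      define A where "A = D1 x - D1 0 - D2 0 x"
      have c: "D1 x \<in> car (op_space X Y)" "D1 0 \<in> car (op_space X Y)" "D2 0 x \<in> car (op_space X Y)"
        using D1c[of x] D1c[of 0] D2c[of x] x zero n0 r by auto
      from opK[OF c(1)] opK[OF c(2)] opK[OF c(3)] obtain k1 k2 k3 where
        k: "\<And>z. z \<in> car X \<Longrightarrow> nrm Y (D1 x z) \<le> k1 * nrm X z" "\<And>z. z \<in> car X \<Longrightarrow> nrm Y (D1 0 z) \<le> k2 * nrm X z"
          "\<And>z. z \<in> car X \<Longrightarrow> nrm Y (D2 0 x z) \<le> k3 * nrm X z" by blast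
      have AW: "A z \<in> W" if "z \<in> car X" for z
        unfolding A_def minus_apply using c that by (intro Wd opY)
      have "\<forall>z\<in>car X. nrm Y (A z) \<le> (4 * k1 + 4 * k2 + 2 * k3) * nrm X z"
      proof
        fix z assume z: "z \<in> car X"
        have "nrm Y (A z) \<le> 2 * (nrm Y (D1 x z - D1 0 z) + nrm Y (D2 0 x z))"
          unfolding A_def minus_apply using c z by (intro Wn Wd opY)
        moreover have "nrm Y (D1 x z - D1 0 z) \<le> 2 * (nrm Y (D1 x z) + nrm Y (D1 0 z))"
          using c z by (intro Wn opY)
        ultimately show "nrm Y (A z) \<le> (4 * k1 + 4 * k2 + 2 * k3) * nrm X z"
          using k[OF z] by (simp add: algebra_simps)
      qed
      from op_apply_le[OF this X0 \<phi> n1] have "nrm Y (A \<phi>) \<le> nrm (op_space X Y) A" by simp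
      also have "\<dots> \<le> nrm X x" using D1d[OF x(1,3)] by (simp add: A_def)
      finally have 1: "nrm Y (A \<phi>) \<le> \<bar>t\<bar>" using x by simp
      from opK[OF c(3)] obtain k4 where "\<forall>z\<in>car X. nrm Y (D2 0 x z) \<le> k4 * nrm X z" by blast
      from op_apply_le[OF this X0 \<phi> n1] have "nrm Y (D2 0 x \<phi>) \<le> nrm (op_space X Y) (D2 0 x)" by simp
      also have "\<dots> \<le> K2 * nrm X x" by (rule K2[OF x(1)])
      also have "\<dots> \<le> \<bar>K2\<bar> * \<bar>t\<bar>" using X0[OF x(1)] x(4) by (intro mult_mono) auto
      finally have 2: "nrm Y (D2 0 x \<phi>) \<le> \<bar>K2\<bar> * \<bar>t\<bar>" .
      have W3: "D1 x \<phi> \<in> W" "D1 0 \<phi> \<in> W" "D2 0 x \<phi> \<in> W" using opY[OF _ \<phi>] c by auto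
      have "L (A \<phi>) = L (D1 x \<phi>) - L (D1 0 \<phi>) - L (D2 0 x \<phi>)"
        unfolding A_def minus_apply using W3 by (simp add: Ld Wd)
      then have "g' t - g' 0 = L (A \<phi>) + L (D2 0 x \<phi>)" by (simp add: g'_def x_def)
      also have "norm \<dots> \<le> M * nrm Y (A \<phi>) + M * nrm Y (D2 0 x \<phi>)"
        using norm_triangle_ineq Lb[OF AW[OF \<phi>]] Lb[OF W3(3)] by (rule order_trans[OF _ add_mono])
      also have "\<dots> \<le> M * \<bar>t\<bar> + M * (\<bar>K2\<bar> * \<bar>t\<bar>)"
        using 1 2 M by (intro add_mono mult_left_mono)
      also have "\<dots> = K * \<bar>t\<bar>" by (simp add: K_def algebra_simps)
      finally show ?thesis .
    qed
    have g_der: "(g has_vector_derivative g' t) (at t)" if t: "\<bar>t\<bar> < d" for t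
      unfolding has_vector_derivative_def has_derivative_within_alt
    proof (intro conjI allI impI)
      show "bounded_linear (\<lambda>h. h *\<^sub>R g' t)" by (intro bounded_linear_intros)
      fix e :: real assume e: "0 < e"
      note f1 = F1[OF tc tr[OF t]]
      have "0 < e / (M + 1)" using e M by simp
      then obtain \<delta> where \<delta>: "0 < \<delta>" and fd: "\<And>h. h \<in> car X \<Longrightarrow> nrm X h < \<delta> \<Longrightarrow>
          nrm Y (F (t *\<^sub>R \<phi> + h) - F (t *\<^sub>R \<phi>) - D1 (t *\<^sub>R \<phi>) h) \<le> e / (M + 1) * nrm X h"
        using f1 unfolding has_frechet_def by meson
      have dc: "D1 (t *\<^sub>R \<phi>) \<in> car (op_space X Y)" by (rule D1c[OF tc tr[OF t]])
      show "\<exists>d>0. \<forall>y\<in>UNIV. norm (y - t) < d \<longrightarrow> norm (g y - g t - (y - t) *\<^sub>R g' t) \<le> e * norm (y - t)"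
      proof (intro exI[of _ "min \<delta> (d - \<bar>t\<bar>)"] conjI ballI impI)
        show "0 < min \<delta> (d - \<bar>t\<bar>)" using \<delta> t by simp
        fix y assume y: "norm (y - t) < min \<delta> (d - \<bar>t\<bar>)"
        then have yd: "\<bar>y\<bar> < d" by auto
        define h where "h = (y - t) *\<^sub>R \<phi>"
        have h: "h \<in> car X" "nrm X h \<le> \<bar>y - t\<bar>" "nrm X h < \<delta>"
          unfolding h_def using tc tn[of "y - t"] y by auto
        have th: "t *\<^sub>R \<phi> + h = y *\<^sub>R \<phi>" by (simp add: h_def algebra_simps)
        have Dh: "D1 (t *\<^sub>R \<phi>) h = (y - t) *\<^sub>R D1 (t *\<^sub>R \<phi>) \<phi>"
          using dc \<phi> by (simp add: h_def op_space_def)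
        have W3: "D1 (t *\<^sub>R \<phi>) \<phi> \<in> W" "F (y *\<^sub>R \<phi>) \<in> W" "F (t *\<^sub>R \<phi>) \<in> W"
          using opY[OF dc \<phi>] FW yd t by auto
        have "g y - g t - (y - t) *\<^sub>R g' t = L (F (y *\<^sub>R \<phi>) - F (t *\<^sub>R \<phi>) - (y - t) *\<^sub>R D1 (t *\<^sub>R \<phi>) \<phi>)"
          unfolding g_def g'_def using W3 by (simp add: Ld Ls Wd Ws)
        also have "norm \<dots> \<le> M * nrm Y (F (y *\<^sub>R \<phi>) - F (t *\<^sub>R \<phi>) - (y - t) *\<^sub>R D1 (t *\<^sub>R \<phi>) \<phi>)"
          using W3 by (intro Lb Wd Ws)
        also have "\<dots> \<le> M * (e / (M + 1) * nrm X h)"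
          using fd[OF h(1,3)] M unfolding th Dh by (intro mult_left_mono)
        also have "\<dots> \<le> M * (e / (M + 1) * \<bar>y - t\<bar>)"
          using h(2) M e by (intro mult_left_mono) auto
        also have "\<dots> \<le> (M + 1) * (e / (M + 1) * \<bar>y - t\<bar>)"
          using M e by (intro mult_right_mono) auto
        also have "\<dots> = e * norm (y - t)" using M by simp
        finally show "norm (g y - g t - (y - t) *\<^sub>R g' t) \<le> e * norm (y - t)" .
      qed
    qed
    show "\<exists>d>0. \<forall>\<theta>. 0 < \<theta> \<and> \<theta> < d \<longrightarrow>
       norm (L (F (\<theta> *\<^sub>R \<phi>)) + L (F ((- \<theta>) *\<^sub>R \<phi>)) - 2 * L (F 0)) \<le> 2 * K * \<theta>\<^sup>2"
    proof (intro exI[of _ d] conjI allI impI d)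
      fix \<theta> assume \<theta>: "0 < \<theta> \<and> \<theta> < d"
      have lin: "norm (g b - g 0 - (b - 0) *\<^sub>R g' 0) \<le> norm (b - 0) * (K * \<theta>)" if b: "\<bar>b\<bar> \<le> \<theta>" for b
      proof (rule vector_differentiable_bound_linearization[where S = "{-\<theta>..\<theta>}"])
        fix t assume t: "t \<in> {-\<theta>..\<theta>}"
        then have t': "\<bar>t\<bar> < d" "\<bar>t\<bar> \<le> \<theta>" using \<theta> by auto
        show "(g has_vector_derivative g' t) (at t within {-\<theta>..\<theta>})"
          by (rule has_vector_derivative_at_within[OF g_der[OF t'(1)]])
        have "norm (g' t - g' 0) \<le> K * \<bar>t\<bar>" by (rule g'_lip[OF t'(1)])
        also have "\<dots> \<le> K * \<theta>" using t' K0 by (intro mult_left_mono)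
        finally show "norm (g' t - g' 0) \<le> K * \<theta>" .
      qed (use \<theta> b in \<open>auto simp: closed_segment_eq_real_ivl\<close>)
      have "g \<theta> + g (- \<theta>) - 2 * g 0 = (g \<theta> - g 0 - (\<theta> - 0) *\<^sub>R g' 0) + (g (- \<theta>) - g 0 - (- \<theta> - 0) *\<^sub>R g' 0)"
        by simp
      also have "norm \<dots> \<le> norm (\<theta> - 0) * (K * \<theta>) + norm (- \<theta> - 0) * (K * \<theta>)"
        using lin[of \<theta>] lin[of "- \<theta>"] \<theta> by (intro order_trans[OF norm_triangle_ineq add_mono]) auto
      finally show "norm (L (F (\<theta> *\<^sub>R \<phi>)) + L (F ((- \<theta>) *\<^sub>R \<phi>)) - 2 * L (F 0)) \<le> 2 * K * \<theta>\<^sup>2"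
        using \<theta> by (simp add: g_def power2_eq_square mult.assoc)
    qed
  qed
qed

section \<open>Sobolev spaces\<close>

lemma represents_lincomb:
  assumes "represents u h" "represents v k"
  shows "represents (a *\<^sub>R u + b *\<^sub>R v) (\<lambda>x. a *\<^sub>R h x + b *\<^sub>R k x)"
  unfolding represents_def
proof (intro conjI ballI)
  have [measurable]: "h \<in> borel_measurable lebesgue" "k \<in> borel_measurable lebesgue"
    using assms by (auto simp: represents_def)
  show "(\<lambda>x. a *\<^sub>R h x + b *\<^sub>R k x) \<in> borel_measurable lebesgue" by measurable
  fix \<phi> assume p: "\<phi> \<in> schwartz"
  have e: "(\<lambda>x. (a *\<^sub>R h x + b *\<^sub>R k x) * \<phi> x) = (\<lambda>x. a *\<^sub>R (h x * \<phi> x) + b *\<^sub>R (k x * \<phi> x))"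
    by (simp add: distrib_right)
  have i: "integrable lebesgue (\<lambda>x. a *\<^sub>R (h x * \<phi> x))" "integrable lebesgue (\<lambda>x. b *\<^sub>R (k x * \<phi> x))"
    using assms p by (auto simp: represents_def intro!: integrable_scaleR_right)
  show "integrable lebesgue (\<lambda>x. (a *\<^sub>R h x + b *\<^sub>R k x) * \<phi> x)" unfolding e by (intro Bochner_Integration.integrable_add i)
  show "(a *\<^sub>R u + b *\<^sub>R v) \<phi> = (LINT x|lebesgue. (a *\<^sub>R h x + b *\<^sub>R k x) * \<phi> x)"
    unfolding e Bochner_Integration.integral_add[OF i] integral_scaleR_right
    using assms p by (simp add: represents_def scaleR_fun_def)
qed

lemma fourier_dist_lincomb: "fourier_dist (a *\<^sub>R u + b *\<^sub>R v) = a *\<^sub>R fourier_dist u + b *\<^sub>R fourier_dist v"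
  by (auto simp: fourier_dist_def scaleR_fun_def fun_eq_iff)

lemma tempered_lincomb:
  assumes "u \<in> tempered" "v \<in> tempered"
  shows "a *\<^sub>R u + b *\<^sub>R v \<in> tempered"
proof -
  let ?S = "\<lambda>m f. \<Sum>k\<le>m. \<Sum>n\<le>m. schwartz_seminorm k n f"
  have "\<exists>C m. \<forall>f\<in>schwartz. norm (u f) \<le> C * ?S m f" "\<exists>C m. \<forall>f\<in>schwartz. norm (v f) \<le> C * ?S m f"
    using assms by (simp_all add: tempered_def)
  then obtain C1 m1 C2 m2 where b1: "\<And>f. f \<in> schwartz \<Longrightarrow> norm (u f) \<le> C1 * ?S m1 f"
    and b2: "\<And>f. f \<in> schwartz \<Longrightarrow> norm (v f) \<le> C2 * ?S m2 f"
    by metis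
  define m where "m = max m1 m2"
  have S0: "0 \<le> ?S n f" if "f \<in> schwartz" for n f
    by (intro sum_nonneg schwartz_seminorm_nonneg that)
  have Sm: "?S n f \<le> ?S m f" if "f \<in> schwartz" "n \<le> m" for n f
  proof -
    have "?S n f \<le> (\<Sum>k\<le>n. \<Sum>n\<le>m. schwartz_seminorm k n f)"
      using that by (intro sum_mono sum_mono2 schwartz_seminorm_nonneg) auto
    also have "\<dots> \<le> ?S m f"
      using that by (intro sum_mono2 sum_nonneg schwartz_seminorm_nonneg) auto
    finally show ?thesis .
  qed
  have c: "norm (w f) \<le> \<bar>C\<bar> * ?S m f" if "norm (w f) \<le> C * ?S n f" "n \<le> m" "f \<in> schwartz" for w :: functional and C n f
  proof -
    have "C * ?S n f \<le> \<bar>C\<bar> * ?S n f" using S0[OF that(3)] by (intro mult_right_mono) auto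
    also have "\<dots> \<le> \<bar>C\<bar> * ?S m f" using Sm that by (intro mult_left_mono) auto
    finally show ?thesis using that by linarith
  qed
  have "norm ((a *\<^sub>R u + b *\<^sub>R v) f) \<le> (\<bar>a\<bar> * \<bar>C1\<bar> + \<bar>b\<bar> * \<bar>C2\<bar>) * ?S m f" if f: "f \<in> schwartz" for f
  proof -
    have "norm ((a *\<^sub>R u + b *\<^sub>R v) f) \<le> \<bar>a\<bar> * norm (u f) + \<bar>b\<bar> * norm (v f)"
      using norm_triangle_ineq[of "a *\<^sub>R u f" "b *\<^sub>R v f"] by (simp add: scaleR_fun_def)
    also have "\<dots> \<le> \<bar>a\<bar> * (\<bar>C1\<bar> * ?S m f) + \<bar>b\<bar> * (\<bar>C2\<bar> * ?S m f)"
      by (intro add_mono mult_left_mono c[OF b1] c[OF b2] f) (auto simp: m_def)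
    finally show ?thesis by (simp add: algebra_simps)
  qed
  then have "\<exists>C m. \<forall>f\<in>schwartz. norm ((a *\<^sub>R u + b *\<^sub>R v) f) \<le> C * ?S m f" by blast
  moreover have "\<forall>f. f \<notin> schwartz \<longrightarrow> (a *\<^sub>R u + b *\<^sub>R v) f = 0"
    using assms by (simp add: tempered_def scaleR_fun_def)
  moreover have "\<forall>f\<in>schwartz. \<forall>g\<in>schwartz. \<forall>c d. (a *\<^sub>R u + b *\<^sub>R v) (\<lambda>x. c * f x + d * g x)
      = c * (a *\<^sub>R u + b *\<^sub>R v) f + d * (a *\<^sub>R u + b *\<^sub>R v) g"
    using assms by (simp add: tempered_def scaleR_fun_def algebra_simps)
  ultimately show ?thesis by (simp add: tempered_def)
qed

definition weight :: "real \<Rightarrow> real \<Rightarrow> real"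
  where "weight s \<xi> = (1 + \<bar>\<xi>\<bar>\<^sup>2) powr s"

lemma weight_pos: "0 < weight s \<xi>"
  by (simp add: weight_def) (metis add_pos_nonneg less_numeral_extra(3) zero_le_power2 zero_less_one)

lemma weight_nonneg [simp]: "0 \<le> weight s \<xi>"
  using weight_pos[of s \<xi>] by simp

lemma weight_borel [measurable]: "weight s \<in> borel_measurable borel"
  unfolding weight_def[abs_def] by measurable

lemma sobolev_nrm: "nrm (sobolev s) u = sqrt (LINT \<xi>|lebesgue. weight s \<xi> * (norm (fourier_fun u \<xi>))\<^sup>2)"
  by (simp add: sobolev_def weight_def)

lemma sobolev_nrm_nonneg: "0 \<le> nrm (sobolev s) u"
  unfolding sobolev_nrm by (intro real_sqrt_ge_zero Bochner_Integration.integral_nonneg) simp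

lemma sobolev_nrm_square: "(nrm (sobolev s) u)\<^sup>2 = (LINT \<xi>|lebesgue. weight s \<xi> * (norm (fourier_fun u \<xi>))\<^sup>2)"
  unfolding sobolev_nrm by (intro real_sqrt_pow2 Bochner_Integration.integral_nonneg) simp

lemma sobolev_carD:
  assumes "u \<in> car (sobolev s)"
  shows "u \<in> tempered" "represents (fourier_dist u) (fourier_fun u)"
    "fourier_fun u \<in> borel_measurable lebesgue"
    "integrable lebesgue (\<lambda>\<xi>. weight s \<xi> * (norm (fourier_fun u \<xi>))\<^sup>2)"
proof -
  show "u \<in> tempered" "integrable lebesgue (\<lambda>\<xi>. weight s \<xi> * (norm (fourier_fun u \<xi>))\<^sup>2)"
    using assms by (auto simp: sobolev_def weight_def)
  show r: "represents (fourier_dist u) (fourier_fun u)"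
    using assms represents_dist_fun by (auto simp: sobolev_def fourier_fun_def)
  then show "fourier_fun u \<in> borel_measurable lebesgue" by (simp add: represents_def)
qed

lemma sobolev_carI:
  assumes u: "u \<in> tempered" and r: "represents (fourier_dist u) h"
    and i: "integrable lebesgue (\<lambda>\<xi>. weight s \<xi> * (norm (h \<xi>))\<^sup>2)"
  shows "u \<in> car (sobolev s)" "AE \<xi> in lebesgue. fourier_fun u \<xi> = h \<xi>"
    "nrm (sobolev s) u = sqrt (LINT \<xi>|lebesgue. weight s \<xi> * (norm (h \<xi>))\<^sup>2)"
proof -
  show ae: "AE \<xi> in lebesgue. fourier_fun u \<xi> = h \<xi>"
    unfolding fourier_fun_def by (rule dist_fun_AE[OF r])
  have [measurable]: "fourier_fun u \<in> borel_measurable lebesgue" "h \<in> borel_measurable lebesgue"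
    using r represents_dist_fun[OF r] by (auto simp: represents_def fourier_fun_def)
  have [measurable]: "weight s \<in> borel_measurable lebesgue"
    using weight_borel by (intro measurable_completion) simp
  have "integrable lebesgue (\<lambda>\<xi>. weight s \<xi> * (norm (fourier_fun u \<xi>))\<^sup>2)"
    using i by (rule integrable_cong_AE_imp) (use ae in \<open>auto elim!: eventually_mono\<close>)
  then show "u \<in> car (sobolev s)"
    using u r by (auto simp: sobolev_def weight_def)
  show "nrm (sobolev s) u = sqrt (LINT \<xi>|lebesgue. weight s \<xi> * (norm (h \<xi>))\<^sup>2)"
    unfolding sobolev_nrm by (intro arg_cong[of _ _ sqrt] integral_cong_AE) (use ae in \<open>auto elim!: eventually_mono\<close>)
qed

lemma norm_lincomb_square_le:
  fixes x y :: complex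
  shows "(norm (a *\<^sub>R x + b *\<^sub>R y))\<^sup>2 \<le> 2 * a\<^sup>2 * (norm x)\<^sup>2 + 2 * b\<^sup>2 * (norm y)\<^sup>2"
proof -
  have "(norm (a *\<^sub>R x + b *\<^sub>R y))\<^sup>2 \<le> (\<bar>a\<bar> * norm x + \<bar>b\<bar> * norm y)\<^sup>2"
    using norm_triangle_ineq[of "a *\<^sub>R x" "b *\<^sub>R y"] by (intro power_mono) auto
  also have "\<dots> \<le> 2 * (\<bar>a\<bar> * norm x)\<^sup>2 + 2 * (\<bar>b\<bar> * norm y)\<^sup>2"
    using sum_squares_bound[of "\<bar>a\<bar> * norm x" "\<bar>b\<bar> * norm y"] by (simp add: power2_sum)
  finally show ?thesis by (simp add: power_mult_distrib)
qed

text \<open>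
  The bound is a triangle inequality up to a factor, from
  \<open>\<bar>x + y\<bar>\<^sup>2 \<le> 2 \<bar>x\<bar>\<^sup>2 + 2 \<bar>y\<bar>\<^sup>2\<close>. The factor is harmless, because only the finiteness of constants
  matters in what follows.
\<close>

lemma sobolev_lincomb:
  assumes u: "u \<in> car (sobolev s)" and v: "v \<in> car (sobolev s)"
  shows "a *\<^sub>R u + b *\<^sub>R v \<in> car (sobolev s)"
    and "AE \<xi> in lebesgue. fourier_fun (a *\<^sub>R u + b *\<^sub>R v) \<xi> = a *\<^sub>R fourier_fun u \<xi> + b *\<^sub>R fourier_fun v \<xi>"
    and "(nrm (sobolev s) (a *\<^sub>R u + b *\<^sub>R v))\<^sup>2 \<le> 2 * a\<^sup>2 * (nrm (sobolev s) u)\<^sup>2 + 2 * b\<^sup>2 * (nrm (sobolev s) v)\<^sup>2"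
proof -
  note [measurable] = sobolev_carD(3)[OF u] sobolev_carD(3)[OF v]
  have [measurable]: "weight s \<in> borel_measurable lebesgue"
    using weight_borel by (intro measurable_completion) simp
  let ?w = "a *\<^sub>R u + b *\<^sub>R v"
  let ?h = "\<lambda>\<xi>. a *\<^sub>R fourier_fun u \<xi> + b *\<^sub>R fourier_fun v \<xi>"
  let ?B = "\<lambda>\<xi>. 2 * a\<^sup>2 * (weight s \<xi> * (norm (fourier_fun u \<xi>))\<^sup>2) + 2 * b\<^sup>2 * (weight s \<xi> * (norm (fourier_fun v \<xi>))\<^sup>2)"
  have ub: "weight s \<xi> * (norm (?h \<xi>))\<^sup>2 \<le> ?B \<xi>" for \<xi>
    using mult_left_mono[OF norm_lincomb_square_le[of a "fourier_fun u \<xi>" b "fourier_fun v \<xi>"], of "weight s \<xi>"]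
    by (simp add: algebra_simps)
  have iB: "integrable lebesgue ?B"
    by (intro Bochner_Integration.integrable_add integrable_mult_right sobolev_carD[OF u] sobolev_carD[OF v])
  have i: "integrable lebesgue (\<lambda>\<xi>. weight s \<xi> * (norm (?h \<xi>))\<^sup>2)"
  proof (rule Bochner_Integration.integrable_bound[OF iB])
    show "(\<lambda>\<xi>. weight s \<xi> * (norm (?h \<xi>))\<^sup>2) \<in> borel_measurable lebesgue" by measurable
    show "AE \<xi> in lebesgue. norm (weight s \<xi> * (norm (?h \<xi>))\<^sup>2) \<le> norm (?B \<xi>)"
    proof (rule AE_I2)
      fix \<xi>
      have "0 \<le> weight s \<xi> * (norm (?h \<xi>))\<^sup>2" by simp
      with ub[of \<xi>] show "norm (weight s \<xi> * (norm (?h \<xi>))\<^sup>2) \<le> norm (?B \<xi>)"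
        unfolding real_norm_def by linarith
    qed
  qed
  have t: "?w \<in> tempered" by (intro tempered_lincomb sobolev_carD[OF u] sobolev_carD[OF v])
  have r: "represents (fourier_dist ?w) ?h" unfolding fourier_dist_lincomb
    by (intro represents_lincomb sobolev_carD[OF u] sobolev_carD[OF v])
  note c = sobolev_carI[OF t r i]
  show "?w \<in> car (sobolev s)" "AE \<xi> in lebesgue. fourier_fun ?w \<xi> = ?h \<xi>" by (fact c)+
  have "(nrm (sobolev s) ?w)\<^sup>2 = (LINT \<xi>|lebesgue. weight s \<xi> * (norm (?h \<xi>))\<^sup>2)"
    unfolding c(3) by (intro real_sqrt_pow2 Bochner_Integration.integral_nonneg) simp
  also have "\<dots> \<le> (LINT \<xi>|lebesgue. ?B \<xi>)" by (intro integral_mono i iB ub)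
  also have "\<dots> = 2 * a\<^sup>2 * (nrm (sobolev s) u)\<^sup>2 + 2 * b\<^sup>2 * (nrm (sobolev s) v)\<^sup>2"
    unfolding sobolev_nrm_square using sobolev_carD(4)[OF u] sobolev_carD(4)[OF v] by simp
  finally show "(nrm (sobolev s) ?w)\<^sup>2 \<le> 2 * a\<^sup>2 * (nrm (sobolev s) u)\<^sup>2 + 2 * b\<^sup>2 * (nrm (sobolev s) v)\<^sup>2" .
qed

lemma sobolev_diff:
  assumes u: "u \<in> car (sobolev s)" and v: "v \<in> car (sobolev s)"
  shows "u - v \<in> car (sobolev s)"
    and "AE \<xi> in lebesgue. fourier_fun (u - v) \<xi> = fourier_fun u \<xi> - fourier_fun v \<xi>"
    and "nrm (sobolev s) (u - v) \<le> 2 * (nrm (sobolev s) u + nrm (sobolev s) v)"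
proof -
  have e: "u - v = 1 *\<^sub>R u + (- 1) *\<^sub>R v" by simp
  show "u - v \<in> car (sobolev s)" unfolding e by (rule sobolev_lincomb[OF assms])
  show "AE \<xi> in lebesgue. fourier_fun (u - v) \<xi> = fourier_fun u \<xi> - fourier_fun v \<xi>"
    unfolding e using sobolev_lincomb(2)[OF assms, of 1 "- 1"] by simp
  have "(nrm (sobolev s) (u - v))\<^sup>2 \<le> 2 * (nrm (sobolev s) u)\<^sup>2 + 2 * (nrm (sobolev s) v)\<^sup>2"
    unfolding e using sobolev_lincomb(3)[OF assms, of 1 "- 1"] by simp
  also have "\<dots> \<le> (2 * (nrm (sobolev s) u + nrm (sobolev s) v))\<^sup>2"
    using sobolev_nrm_nonneg[of s u] sobolev_nrm_nonneg[of s v] by (simp add: power2_eq_square algebra_simps)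
  finally show "nrm (sobolev s) (u - v) \<le> 2 * (nrm (sobolev s) u + nrm (sobolev s) v)"
    by (rule power2_le_imp_le) (use sobolev_nrm_nonneg in \<open>auto intro!: add_nonneg_nonneg\<close>)
qed

lemma sobolev_scaleR:
  assumes u: "u \<in> car (sobolev s)"
  shows "c *\<^sub>R u \<in> car (sobolev s)"
    and "AE \<xi> in lebesgue. fourier_fun (c *\<^sub>R u) \<xi> = c *\<^sub>R fourier_fun u \<xi>"
    and "nrm (sobolev s) (c *\<^sub>R u) = \<bar>c\<bar> * nrm (sobolev s) u"
proof -
  have e: "c *\<^sub>R u = c *\<^sub>R u + 0 *\<^sub>R u" by simp
  show c: "c *\<^sub>R u \<in> car (sobolev s)" by (subst e) (rule sobolev_lincomb[OF u u])
  show ae: "AE \<xi> in lebesgue. fourier_fun (c *\<^sub>R u) \<xi> = c *\<^sub>R fourier_fun u \<xi>"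
    using sobolev_lincomb(2)[OF u u, of c 0] by simp
  note [measurable] = sobolev_carD(3)[OF u] sobolev_carD(3)[OF c]
  have [measurable]: "weight s \<in> borel_measurable lebesgue"
    using weight_borel by (intro measurable_completion) simp
  have "(LINT \<xi>|lebesgue. weight s \<xi> * (norm (fourier_fun (c *\<^sub>R u) \<xi>))\<^sup>2) = (LINT \<xi>|lebesgue. c\<^sup>2 * (weight s \<xi> * (norm (fourier_fun u \<xi>))\<^sup>2))"
    by (rule integral_cong_AE) (use ae in \<open>auto elim!: eventually_mono simp: power_mult_distrib\<close>)
  then show "nrm (sobolev s) (c *\<^sub>R u) = \<bar>c\<bar> * nrm (sobolev s) u"
    unfolding sobolev_nrm by (simp add: real_sqrt_mult)
qed

lemma freq_dist_sobolev:
  assumes h: "integrable lborel h" and i: "integrable lborel (\<lambda>\<xi>. weight s \<xi> * (norm (h \<xi>))\<^sup>2)"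
  shows "freq_dist h \<in> car (sobolev s)"
    and "nrm (sobolev s) (freq_dist h) = sqrt (LBINT \<xi>. weight s \<xi> * (norm (h \<xi>))\<^sup>2)"
proof -
  note [measurable] = borel_measurable_integrable[OF h]
  have i': "integrable lebesgue (\<lambda>\<xi>. weight s \<xi> * (norm (h \<xi>))\<^sup>2)" using i by (subst integrable_completion) auto
  note c = sobolev_carI[OF tempered_freq_dist[OF h] represents_fourier_freq_dist[OF h] i']
  show "freq_dist h \<in> car (sobolev s)" by (fact c)
  show "nrm (sobolev s) (freq_dist h) = sqrt (LBINT \<xi>. weight s \<xi> * (norm (h \<xi>))\<^sup>2)"
    unfolding c(3) by (simp add: integral_completion)
qed

section \<open>Bounded curves in Sobolev spaces\<close>

text \<open>
  A space of curves on which the supremum norm is meaningful and that is evidently closed under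
  differences.
\<close>

definition bounded_curves :: "real \<Rightarrow> real \<Rightarrow> (real \<Rightarrow> functional) set"
  where "bounded_curves T s = {v. (\<forall>t\<in>{0..T}. v t \<in> car (sobolev s)) \<and>
    bdd_above ((\<lambda>t. nrm (sobolev s) (v t)) ` {0..T})}"

text \<open>
  A continuous curve is locally bounded, and bisection of \<open>[0, T]\<close> makes the bound global.
\<close>

lemma C_sobolev_bounded:
  assumes T: "0 \<le> T" and v: "v \<in> car (C_sobolev T s)"
  shows "v \<in> bounded_curves T s"
proof -
  have c: "v t \<in> car (sobolev s)" if "t \<in> {0..T}" for t using v that by (simp add: C_sobolev_def)
  have "\<exists>B. \<forall>t\<in>{0..T}. nrm (sobolev s) (v t) \<le> B"
  proof -
    define P where "P a b \<longleftrightarrow> (\<exists>B. \<forall>t\<in>{0..T} \<inter> {a..b}. nrm (sobolev s) (v t) \<le> B)" for a b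
    have "P 0 T" using T
    proof (induction rule: Bolzano)
      case (trans a b c)
      then obtain B B' where "\<forall>t\<in>{0..T} \<inter> {a..b}. nrm (sobolev s) (v t) \<le> B"
        "\<forall>t\<in>{0..T} \<inter> {b..c}. nrm (sobolev s) (v t) \<le> B'" by (auto simp: P_def)
      then show ?case unfolding P_def
        by (intro exI[of _ "max B B'"]) (auto simp: le_max_iff_disj)
    next
      case (local x)
      then have x: "x \<in> {0..T}" by simp
      have "\<forall>e>0. \<exists>d>0. \<forall>t\<in>{0..T}. \<bar>t - x\<bar> < d \<longrightarrow> nrm (sobolev s) (v t - v x) < e"
        using v x unfolding C_sobolev_def by simp
      from this[rule_format, OF zero_less_one]
      obtain d where d: "0 < d" "\<And>t. t \<in> {0..T} \<Longrightarrow> \<bar>t - x\<bar> < d \<Longrightarrow> nrm (sobolev s) (v t - v x) < 1"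
        by blast
      have m: "(- 1) *\<^sub>R v x \<in> car (sobolev s)" by (rule sobolev_scaleR(1)[OF c[OF x]])
      have "nrm (sobolev s) (v t) \<le> 2 * (1 + nrm (sobolev s) (v x))" if t: "t \<in> {0..T}" "\<bar>t - x\<bar> < d" for t
      proof -
        have "v t = (v t - v x) - ((- 1) *\<^sub>R v x)" by simp
        then have "nrm (sobolev s) (v t) \<le> 2 * (nrm (sobolev s) (v t - v x) + nrm (sobolev s) ((- 1) *\<^sub>R v x))"
          using sobolev_diff(3)[OF sobolev_diff(1)[OF c[OF t(1)] c[OF x]] m] by simp
        then show ?thesis unfolding sobolev_scaleR(3)[OF c[OF x]] using d(2)[OF t] by simp
      qed
      then have "P a b" if "a \<le> x" "x \<le> b" "b - a < d" for a b
        unfolding P_def using that by (intro exI[of _ "2 * (1 + nrm (sobolev s) (v x))"]) auto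
      then show ?case using d(1) by blast
    qed
    then show ?thesis by (auto simp: P_def)
  qed
  then show ?thesis using c unfolding bounded_curves_def by (auto simp: bdd_above_def)
qed

lemma C_sobolev_nrm: "nrm (C_sobolev T s) v = (SUP t\<in>{0..T}. nrm (sobolev s) (v t))"
  by (simp add: C_sobolev_def)

lemma bounded_curves_nrm_ge:
  assumes "v \<in> bounded_curves T s" "t \<in> {0..T}"
  shows "nrm (sobolev s) (v t) \<le> nrm (C_sobolev T s) v"
  unfolding C_sobolev_nrm using assms by (intro cSUP_upper) (auto simp: bounded_curves_def)

lemma bounded_curves_scaleR:
  assumes v: "v \<in> bounded_curves T s" shows "c *\<^sub>R v \<in> bounded_curves T s"
proof -
  have "nrm (sobolev s) (c *\<^sub>R v t) \<le> \<bar>c\<bar> * nrm (C_sobolev T s) v" if t: "t \<in> {0..T}" for t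
    using bounded_curves_nrm_ge[OF v t] v t sobolev_scaleR(3)[of "v t" s c]
    by (simp add: bounded_curves_def mult_left_mono)
  moreover have "c *\<^sub>R v t \<in> car (sobolev s)" if "t \<in> {0..T}" for t
    using v that by (intro sobolev_scaleR(1)) (simp add: bounded_curves_def)
  ultimately show ?thesis unfolding bounded_curves_def scaleR_fun_def[of c v]
    by (auto intro!: bdd_aboveI2[where M = "\<bar>c\<bar> * nrm (C_sobolev T s) v"])
qed

lemma bounded_curves_diff:
  assumes T: "0 \<le> T" and u: "u \<in> bounded_curves T s" and v: "v \<in> bounded_curves T s"
  shows "u - v \<in> bounded_curves T s"
    and "nrm (C_sobolev T s) (u - v) \<le> 2 * (nrm (C_sobolev T s) u + nrm (C_sobolev T s) v)"
proof -
  have c: "u t \<in> car (sobolev s)" "v t \<in> car (sobolev s)" if "t \<in> {0..T}" for t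
    using u v that by (auto simp: bounded_curves_def)
  have b: "nrm (sobolev s) ((u - v) t) \<le> 2 * (nrm (C_sobolev T s) u + nrm (C_sobolev T s) v)" if t: "t \<in> {0..T}" for t
    using sobolev_diff(3)[OF c[OF t]] bounded_curves_nrm_ge[OF u t] bounded_curves_nrm_ge[OF v t] by simp
  show "u - v \<in> bounded_curves T s"
    unfolding bounded_curves_def using b sobolev_diff(1)[OF c]
    by (intro CollectI conjI ballI bdd_aboveI2[where M = "2 * (nrm (C_sobolev T s) u + nrm (C_sobolev T s) v)"]) auto
  show "nrm (C_sobolev T s) (u - v) \<le> 2 * (nrm (C_sobolev T s) u + nrm (C_sobolev T s) v)"
    unfolding C_sobolev_nrm[of T s "u - v"] using b T by (intro cSUP_least) auto
qed

section \<open>Pairing with a window of low frequencies\<close>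

text \<open>
  The window \<open>\<kappa>\<close> is bounded with compact support, which makes this functional bounded
  on \<open>H\<^sup>s\<close>. It need not be smooth, so it can carry the phase that aligns the contributions of the
  second iterate.
\<close>

definition freq_pairing :: "(real \<Rightarrow> complex) \<Rightarrow> functional \<Rightarrow> complex"
  where "freq_pairing \<kappa> u = (LINT \<xi>|lebesgue. \<kappa> \<xi> * fourier_fun u \<xi>)"

abbreviation pairing_difference where
  "pairing_difference \<kappa> F T \<phi> \<theta> \<equiv> freq_pairing \<kappa> (F (\<theta> *\<^sub>R \<phi>) T) + freq_pairing \<kappa> (F ((- \<theta>) *\<^sub>R \<phi>) T) - 2 * freq_pairing \<kappa> (F 0 T)"

context
  fixes \<kappa> :: "real \<Rightarrow> complex" and M s :: real
  assumes kappa: "\<kappa> \<in> borel_measurable borel" and kappa_le: "\<And>\<xi>. norm (\<kappa> \<xi>) \<le> M * indicator {0..1} \<xi>"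
    and s: "s \<le> 0"
begin

lemma M_nonneg: "0 \<le> M"
  using order_trans[OF norm_ge_zero kappa_le[of 0]] by simp

lemma kappa_le_M: "norm (\<kappa> \<xi>) \<le> M"
  by (rule order_trans[OF kappa_le[of \<xi>] mult_left_le[OF indicator_le_1 M_nonneg]])

lemma kappa_lebesgue: "\<kappa> \<in> borel_measurable lebesgue"
  by (rule borel_lebesgue[OF kappa])

text \<open>
  On \<open>[0, 1]\<close> the weight is bounded below by \<open>2 powr s\<close>. The free parameter \<open>r\<close> is
  set to the norm of the distribution later, which makes the bound linear in that norm.
\<close>

lemma freq_pairing_young:
  assumes r: "0 < r"
  shows "norm (\<kappa> \<xi> * z) \<le> (M * r / 2) * indicator {0..1} \<xi> + (M / (2 * r * 2 powr s)) * (weight s \<xi> * (norm z)\<^sup>2)"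
proof (cases "\<xi> \<in> {0..1}")
  case True
  have w: "2 powr s \<le> weight s \<xi>"
  proof -
    have "1 + \<bar>\<xi>\<bar>\<^sup>2 \<le> 2" using True by (auto intro!: power_le_one)
    then show ?thesis unfolding weight_def using s by (intro powr_mono2') (auto simp: add_pos_nonneg)
  qed
  have "norm z \<le> r / 2 + (norm z)\<^sup>2 / (2 * r)"
    using sum_squares_bound[of "norm z" r] r by (simp add: field_simps power2_eq_square)
  also have "(norm z)\<^sup>2 / (2 * r) \<le> (weight s \<xi> * (norm z)\<^sup>2) / (2 * r * 2 powr s)"
    using mult_right_mono[OF w, of "(norm z)\<^sup>2"] r by (simp add: field_simps)
  finally have z: "norm z \<le> r / 2 + weight s \<xi> * (norm z)\<^sup>2 / (2 * r * 2 powr s)" by simp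
  have "norm (\<kappa> \<xi> * z) \<le> M * norm z"
    using kappa_le[of \<xi>] True unfolding norm_mult by (intro mult_right_mono) auto
  also have "\<dots> \<le> M * (r / 2 + weight s \<xi> * (norm z)\<^sup>2 / (2 * r * 2 powr s))"
    by (intro mult_left_mono z M_nonneg)
  finally show ?thesis using True by (simp add: distrib_left)
next
  case False
  then have "\<kappa> \<xi> = 0" using kappa_le[of \<xi>] by simp
  then show ?thesis using False M_nonneg r by simp
qed

lemma freq_pairing_integrable:
  assumes u: "u \<in> car (sobolev s)"
  shows "integrable lebesgue (\<lambda>\<xi>. \<kappa> \<xi> * fourier_fun u \<xi>)"
    and "0 < r \<Longrightarrow> norm (freq_pairing \<kappa> u) \<le> M * r / 2 + (M / (2 * r * 2 powr s)) * (nrm (sobolev s) u)\<^sup>2"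
proof -
  note [measurable] = sobolev_carD(3)[OF u] kappa_lebesgue
  let ?B = "\<lambda>r \<xi>. (M * r / 2) * indicator {0..1} \<xi> + (M / (2 * r * 2 powr s)) * (weight s \<xi> * (norm (fourier_fun u \<xi>))\<^sup>2)"
  have iB: "integrable lebesgue (?B r)" for r
    by (intro Bochner_Integration.integrable_add integrable_mult_right sobolev_carD[OF u] integrable_real_indicator) auto
  show i: "integrable lebesgue (\<lambda>\<xi>. \<kappa> \<xi> * fourier_fun u \<xi>)"
    by (rule Bochner_Integration.integrable_bound[OF iB[of 1]])
      (auto intro!: AE_I2 order_trans[OF freq_pairing_young[of 1]])
  assume r: "0 < r"
  have "norm (freq_pairing \<kappa> u) \<le> (LINT \<xi>|lebesgue. norm (\<kappa> \<xi> * fourier_fun u \<xi>))"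
    unfolding freq_pairing_def by (rule integral_norm_bound)
  also have "\<dots> \<le> (LINT \<xi>|lebesgue. ?B r \<xi>)"
    by (intro integral_mono integrable_norm i iB freq_pairing_young r)
  also have "\<dots> = M * r / 2 + (M / (2 * r * 2 powr s)) * (nrm (sobolev s) u)\<^sup>2"
    unfolding sobolev_nrm_square using sobolev_carD(4)[OF u] by simp
  finally show "norm (freq_pairing \<kappa> u) \<le> M * r / 2 + (M / (2 * r * 2 powr s)) * (nrm (sobolev s) u)\<^sup>2" .
qed

lemma freq_pairing_le:
  assumes u: "u \<in> car (sobolev s)"
  shows "norm (freq_pairing \<kappa> u) \<le> (M * (1 + 1 / 2 powr s)) * nrm (sobolev s) u"
proof (cases "nrm (sobolev s) u = 0")
  case True
  have "norm (freq_pairing \<kappa> u) \<le> 0 + e" if e: "0 < e" for e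
  proof -
    have "norm (freq_pairing \<kappa> u) \<le> M * (e / (M + 1)) / 2"
      using freq_pairing_integrable(2)[OF u, of "e / (M + 1)"] e M_nonneg True by simp
    also have "\<dots> \<le> e" using e M_nonneg by (simp add: field_simps)
    finally show ?thesis by simp
  qed
  then have "norm (freq_pairing \<kappa> u) \<le> 0" by (rule field_le_epsilon)
  then show ?thesis using True by simp
next
  case False
  define n where "n = nrm (sobolev s) u"
  have n: "0 < n" using False sobolev_nrm_nonneg[of s u] by (simp add: n_def)
  have "norm (freq_pairing \<kappa> u) \<le> M * n / 2 + (M / (2 * n * 2 powr s)) * n\<^sup>2"
    using freq_pairing_integrable(2)[OF u n] by (simp add: n_def)
  also have "\<dots> = (M * (1 + 1 / 2 powr s)) * n / 2" using n by (simp add: field_simps power2_eq_square)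
  also have "\<dots> \<le> (M * (1 + 1 / 2 powr s)) * n" using n M_nonneg by simp
  finally show ?thesis by (simp add: n_def)
qed

lemma freq_pairing_diff:
  assumes u: "u \<in> car (sobolev s)" and v: "v \<in> car (sobolev s)"
  shows "freq_pairing \<kappa> (u - v) = freq_pairing \<kappa> u - freq_pairing \<kappa> v"
proof -
  note [measurable] = sobolev_carD(3)[OF u] sobolev_carD(3)[OF v] sobolev_carD(3)[OF sobolev_diff(1)[OF u v]] kappa_lebesgue
  have "freq_pairing \<kappa> (u - v) = (LINT \<xi>|lebesgue. \<kappa> \<xi> * fourier_fun u \<xi> - \<kappa> \<xi> * fourier_fun v \<xi>)"
    unfolding freq_pairing_def by (rule integral_cong_AE)
      (use sobolev_diff(2)[OF u v] in \<open>auto elim!: eventually_mono simp: right_diff_distrib\<close>)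
  then show ?thesis using freq_pairing_integrable(1)[OF u] freq_pairing_integrable(1)[OF v]
    by (simp add: freq_pairing_def)
qed

lemma freq_pairing_scaleR:
  assumes u: "u \<in> car (sobolev s)"
  shows "freq_pairing \<kappa> (c *\<^sub>R u) = c *\<^sub>R freq_pairing \<kappa> u"
proof -
  note [measurable] = sobolev_carD(3)[OF u] sobolev_carD(3)[OF sobolev_scaleR(1)[OF u]] kappa_lebesgue
  have "freq_pairing \<kappa> (c *\<^sub>R u) = (LINT \<xi>|lebesgue. c *\<^sub>R (\<kappa> \<xi> * fourier_fun u \<xi>))"
    unfolding freq_pairing_def by (rule integral_cong_AE)
      (use sobolev_scaleR(2)[OF u, of c] in \<open>auto elim!: eventually_mono\<close>)
  then show ?thesis by (simp add: freq_pairing_def)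
qed

lemma freq_pairing_freq_dist:
  assumes h: "integrable lborel h"
  shows "freq_pairing \<kappa> (freq_dist h) = (LBINT \<xi>. \<kappa> \<xi> * h \<xi>)"
proof -
  note [measurable] = borel_lebesgue[OF borel_of_integrable[OF h]] borel_of_integrable[OF h] kappa kappa_lebesgue
  have [measurable]: "fourier_fun (freq_dist h) \<in> borel_measurable lebesgue"
    using represents_dist_fun[OF represents_fourier_freq_dist[OF h]] by (simp add: represents_def fourier_fun_def)
  have "freq_pairing \<kappa> (freq_dist h) = (LINT \<xi>|lebesgue. \<kappa> \<xi> * h \<xi>)"
    unfolding freq_pairing_def by (rule integral_cong_AE)
      (use fourier_fun_freq_dist[OF h] in \<open>auto elim!: eventually_mono\<close>)
  then show ?thesis by (simp add: integral_completion)
qed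

lemma C2_flow_second_difference:
  assumes T: "0 \<le> T" and C2: "C2_at (sobolev s) (C_sobolev T s) F 0"
  shows "\<exists>K. \<forall>\<phi>\<in>car (sobolev s). nrm (sobolev s) \<phi> \<le> 1 \<longrightarrow> (\<exists>d>0. \<forall>\<theta>. 0 < \<theta> \<and> \<theta> < d \<longrightarrow>
    norm (pairing_difference \<kappa> F T \<phi> \<theta>) \<le> K * \<theta>\<^sup>2)"
proof (rule C2_at_second_difference[OF C2, where W = "bounded_curves T s" and M = "M * (1 + 1 / 2 powr s)"
      and L = "\<lambda>v. freq_pairing \<kappa> (v T)"])
  have TT: "T \<in> {0..T}" using T by simp
  have car: "a T \<in> car (sobolev s)" if "a \<in> bounded_curves T s" for a
    using that TT by (simp add: bounded_curves_def)
  show M: "0 \<le> M * (1 + 1 / 2 powr s)" using M_nonneg by simp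
  fix a assume a: "a \<in> bounded_curves T s"
  show "freq_pairing \<kappa> ((c *\<^sub>R a) T) = c *\<^sub>R freq_pairing \<kappa> (a T)" for c
    using freq_pairing_scaleR[OF car[OF a]] by (simp add: scaleR_fun_def[of c a])
  have "norm (freq_pairing \<kappa> (a T)) \<le> M * (1 + 1 / 2 powr s) * nrm (sobolev s) (a T)"
    by (rule freq_pairing_le[OF car[OF a]])
  also have "\<dots> \<le> M * (1 + 1 / 2 powr s) * nrm (C_sobolev T s) a"
    by (intro mult_left_mono bounded_curves_nrm_ge a TT M)
  finally show "norm (freq_pairing \<kappa> (a T)) \<le> M * (1 + 1 / 2 powr s) * nrm (C_sobolev T s) a" .
  fix b assume b: "b \<in> bounded_curves T s"
  show "freq_pairing \<kappa> ((a - b) T) = freq_pairing \<kappa> (a T) - freq_pairing \<kappa> (b T)"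
    using freq_pairing_diff[OF car[OF a] car[OF b]] by simp
qed (use T sobolev_scaleR sobolev_nrm_nonneg C_sobolev_bounded bounded_curves_diff bounded_curves_scaleR in auto)

end

section \<open>A decay rate that is stable under convolution\<close>

text \<open>
  This rate stays integrable after multiplication by \<open>\<bar>\<xi>\<bar>\<close>, so the derivative of
  the nonlinearity has an integrable Fourier transform too, and its convolution with itself is bounded by a
  multiple of it.
\<close>

definition decay :: "real \<Rightarrow> real"
  where "decay \<xi> = inverse ((1 + \<xi>\<^sup>2)\<^sup>2)"

lemma decay_borel [measurable]: "decay \<in> borel_measurable borel"
  unfolding decay_def[abs_def] by measurable

lemma one_plus_square_ge_1: "1 \<le> 1 + (\<xi>::real)\<^sup>2" by simp

lemma decay_pos: "0 < decay \<xi>"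
  unfolding decay_def by (intro positive_imp_inverse_positive zero_less_power add_pos_nonneg) auto

lemma decay_nonneg [simp]: "0 \<le> decay \<xi>"
  using decay_pos[of \<xi>] by simp

lemma abs_decay_le: "\<bar>\<xi>\<bar> * decay \<xi> \<le> inverse (1 + \<xi>\<^sup>2)" and decay_le: "decay \<xi> \<le> inverse (1 + \<xi>\<^sup>2)"
  and decay_le_1: "decay \<xi> \<le> 1"
proof -
  have p: "0 < inverse (1 + \<xi>\<^sup>2)" "inverse (1 + \<xi>\<^sup>2) \<le> 1"
    using one_plus_square_ge_1[of \<xi>] by (auto simp: inverse_le_1_iff intro!: positive_imp_inverse_positive add_pos_nonneg)
  have d: "decay \<xi> = inverse (1 + \<xi>\<^sup>2) * inverse (1 + \<xi>\<^sup>2)" by (simp add: decay_def power2_eq_square)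
  show l: "decay \<xi> \<le> inverse (1 + \<xi>\<^sup>2)" unfolding d using p by (simp add: mult_left_le)
  then show "decay \<xi> \<le> 1" using p by linarith
  have "\<bar>\<xi>\<bar> \<le> 1 + \<xi>\<^sup>2" using sum_squares_bound[of "\<bar>\<xi>\<bar>" 1] by simp
  then have "\<bar>\<xi>\<bar> * inverse (1 + \<xi>\<^sup>2) \<le> (1 + \<xi>\<^sup>2) * inverse (1 + \<xi>\<^sup>2)" using p by (intro mult_right_mono) auto
  also have "\<dots> = 1" using p by (intro right_inverse) auto
  finally have "(\<bar>\<xi>\<bar> * inverse (1 + \<xi>\<^sup>2)) * inverse (1 + \<xi>\<^sup>2) \<le> 1 * inverse (1 + \<xi>\<^sup>2)"
    using p by (intro mult_right_mono) auto
  then show "\<bar>\<xi>\<bar> * decay \<xi> \<le> inverse (1 + \<xi>\<^sup>2)" unfolding d by simp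
qed

lemma integrable_decay: "integrable lborel decay"
  by (rule Bochner_Integration.integrable_bound[OF integrable_inverse_1_plus_square_lborel])
    (auto intro!: AE_I2 order_trans[OF decay_le])

lemma integrable_abs_decay: "integrable lborel (\<lambda>\<xi>. \<bar>\<xi>\<bar> * decay \<xi>)"
  by (rule Bochner_Integration.integrable_bound[OF integrable_inverse_1_plus_square_lborel])
    (auto intro!: AE_I2 order_trans[OF abs_decay_le])

text \<open>
  One of \<open>\<bar>\<zeta>\<bar>\<close> and \<open>\<bar>\<xi> - \<zeta>\<bar>\<close> is at least \<open>\<bar>\<xi>\<bar> / 2\<close>, which gives
  the factor \<open>decay \<xi>\<close>.
\<close>

lemma decay_mult_le: "decay \<zeta> * decay (\<xi> - \<zeta>) \<le> 8 * decay \<xi> * (decay \<zeta> + decay (\<xi> - \<zeta>))"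
proof -
  define a b c where "a = 1 + \<zeta>\<^sup>2" and "b = 1 + (\<xi> - \<zeta>)\<^sup>2" and "c = 1 + \<xi>\<^sup>2"
  have pos: "0 < a" "0 < b" "0 < c" by (auto simp: a_def b_def c_def intro!: add_pos_nonneg)
  have "\<xi>\<^sup>2 \<le> 2 * \<zeta>\<^sup>2 + 2 * (\<xi> - \<zeta>)\<^sup>2"
    using zero_le_power2[of "\<zeta> - (\<xi> - \<zeta>)"] by (simp add: power2_eq_square algebra_simps)
  then have "c \<le> 2 * (a + b)" by (simp add: a_def b_def c_def)
  then have "c\<^sup>2 \<le> (2 * (a + b))\<^sup>2" using pos by (intro power_mono) auto
  also have "\<dots> \<le> 8 * (a\<^sup>2 + b\<^sup>2)" using sum_squares_bound[of a b] by (simp add: power2_eq_square algebra_simps)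
  finally have "c\<^sup>2 \<le> 8 * (a\<^sup>2 + b\<^sup>2)" .
  then have "inverse (a\<^sup>2) * inverse (b\<^sup>2) \<le> 8 * inverse (c\<^sup>2) * (inverse (a\<^sup>2) + inverse (b\<^sup>2))"
    using pos by (simp add: field_simps)
  then show ?thesis by (simp add: decay_def a_def b_def c_def)
qed

definition decay_mass :: real
  where "decay_mass = (LBINT \<xi>. decay \<xi>)"

lemma decay_mass_nonneg: "0 \<le> decay_mass"
  unfolding decay_mass_def by (intro Bochner_Integration.integral_nonneg) simp

lemma integrable_decay_shift: "integrable lborel (\<lambda>\<zeta>. decay (\<xi> - \<zeta>))"
  using lborel_integrable_real_affine[OF integrable_decay, of "-1" \<xi>] by simp

lemma decay_mass_shift: "(LBINT \<zeta>. decay (\<xi> - \<zeta>)) = decay_mass"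
  unfolding decay_mass_def by (subst (2) lborel_integral_real_affine[where c = "-1" and t = \<xi>]) auto

lemma integrable_of_decay:
  fixes h :: "real \<Rightarrow> complex"
  assumes [measurable]: "h \<in> borel_measurable borel" and b: "\<And>\<xi>. norm (h \<xi>) \<le> a * decay \<xi>"
  shows "integrable lborel h" "integrable lborel (\<lambda>\<xi>. \<i> * of_real \<xi> * h \<xi>)"
proof -
  show "integrable lborel h"
  proof (rule Bochner_Integration.integrable_bound[OF integrable_mult_right[OF integrable_decay, of a]])
    show "AE \<xi> in lborel. norm (h \<xi>) \<le> norm (a * decay \<xi>)"
      unfolding real_norm_def by (intro AE_I2) (rule order_trans[OF b abs_ge_self])
  qed simp
  show "integrable lborel (\<lambda>\<xi>. \<i> * of_real \<xi> * h \<xi>)"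
  proof (rule Bochner_Integration.integrable_bound[OF integrable_mult_right[OF integrable_abs_decay, of a]])
    have "norm (\<i> * of_real \<xi> * h \<xi>) \<le> norm (a * (\<bar>\<xi>\<bar> * decay \<xi>))" for \<xi>
    proof -
      have "norm (\<i> * of_real \<xi> * h \<xi>) = \<bar>\<xi>\<bar> * norm (h \<xi>)" by (simp add: norm_mult)
      also have "\<dots> \<le> \<bar>\<xi>\<bar> * (a * decay \<xi>)" by (intro mult_left_mono b) simp
      also have "\<dots> = a * (\<bar>\<xi>\<bar> * decay \<xi>)" by simp
      also have "\<dots> \<le> norm (a * (\<bar>\<xi>\<bar> * decay \<xi>))" unfolding real_norm_def by (rule abs_ge_self)
      finally show ?thesis .
    qed
    then show "AE \<xi> in lborel. norm (\<i> * of_real \<xi> * h \<xi>) \<le> norm (a * (\<bar>\<xi>\<bar> * decay \<xi>))" by simp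
  qed simp
qed

lemma conv_integrand_integrable:
  fixes f k :: "real \<Rightarrow> complex"
  assumes [measurable]: "f \<in> borel_measurable borel" "k \<in> borel_measurable borel"
    and f: "\<And>\<xi>. norm (f \<xi>) \<le> a * decay \<xi>" and k: "\<And>\<xi>. norm (k \<xi>) \<le> b * decay \<xi>"
  shows "integrable lborel (\<lambda>\<zeta>. f \<zeta> * k (\<xi> - \<zeta>))"
proof (rule integrable_bounded_times(2)[OF _ _ integrable_of_decay(1)[OF _ f]])
  show "norm (k (\<xi> - x)) \<le> \<bar>b\<bar>" for x
  proof -
    have "norm (k (\<xi> - x)) \<le> \<bar>b\<bar> * decay (\<xi> - x)" 
      by (rule order_trans[OF k mult_right_mono[OF abs_ge_self decay_nonneg]])
    also have "\<dots> \<le> \<bar>b\<bar>" using decay_le_1[of "\<xi> - x"] by (simp add: mult_left_le)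
    finally show ?thesis .
  qed
  show "(\<lambda>x. k (\<xi> - x)) \<in> borel_measurable borel" by measurable
  show "f \<in> borel_measurable borel" by fact
qed

lemma conv_le:
  fixes f k :: "real \<Rightarrow> complex"
  assumes [measurable]: "f \<in> borel_measurable borel" "k \<in> borel_measurable borel"
    and f: "\<And>\<xi>. norm (f \<xi>) \<le> a * decay \<xi>" and k: "\<And>\<xi>. norm (k \<xi>) \<le> b * decay \<xi>"
    and a: "0 \<le> a" and b: "0 \<le> b"
  shows "norm (conv f k \<xi>) \<le> 16 * decay_mass * a * b * decay \<xi>"
proof -
  have "norm (conv f k \<xi>) \<le> (LBINT \<zeta>. norm (f \<zeta> * k (\<xi> - \<zeta>)))"
    unfolding conv_def by (rule integral_norm_bound)
  also have "\<dots> \<le> (LBINT \<zeta>. (8 * a * b * decay \<xi>) * (decay \<zeta> + decay (\<xi> - \<zeta>)))"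
  proof (rule integral_mono)
    show "integrable lborel (\<lambda>\<zeta>. norm (f \<zeta> * k (\<xi> - \<zeta>)))"
      by (intro integrable_norm conv_integrand_integrable[OF _ _ f k]) auto
    show "integrable lborel (\<lambda>\<zeta>. (8 * a * b * decay \<xi>) * (decay \<zeta> + decay (\<xi> - \<zeta>)))"
      by (intro integrable_mult_right Bochner_Integration.integrable_add integrable_decay integrable_decay_shift)
    fix \<zeta>
    have "norm (f \<zeta> * k (\<xi> - \<zeta>)) \<le> (a * decay \<zeta>) * (b * decay (\<xi> - \<zeta>))"
      unfolding norm_mult using a by (intro mult_mono f k) auto
    also have "\<dots> = (a * b) * (decay \<zeta> * decay (\<xi> - \<zeta>))" by simp
    also have "\<dots> \<le> (a * b) * (8 * decay \<xi> * (decay \<zeta> + decay (\<xi> - \<zeta>)))"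
      using a b by (intro mult_left_mono decay_mult_le) auto
    finally show "norm (f \<zeta> * k (\<xi> - \<zeta>)) \<le> (8 * a * b * decay \<xi>) * (decay \<zeta> + decay (\<xi> - \<zeta>))" by (simp add: mult_ac)
  qed
  also have "\<dots> = 16 * decay_mass * a * b * decay \<xi>"
    using integrable_decay integrable_decay_shift[of \<xi>] by (simp add: decay_mass_shift decay_mass_def[symmetric])
  finally show ?thesis .
qed

lemma integrable_slab:
  fixes G :: "real \<Rightarrow> real \<Rightarrow> complex" and r :: "real \<Rightarrow> real"
  assumes t: "0 \<le> t" and r: "integrable lborel r"
    and Gm: "(\<lambda>(\<tau>, \<xi>). G \<tau> \<xi>) \<in> borel_measurable (lborel \<Otimes>\<^sub>M lborel)"
    and Gb: "\<And>\<tau> \<xi>. norm (G \<tau> \<xi>) \<le> indicator {0..t} \<tau> * r \<xi>"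
  shows "integrable (lborel \<Otimes>\<^sub>M lborel) (\<lambda>(\<tau>, \<xi>). G \<tau> \<xi>)"
proof (rule Bochner_Integration.integrable_bound[OF integrable_lborel_pair_mult[OF _ r, of "indicator {0..t}"] Gm])
  show "integrable lborel (indicator {0..t} :: real \<Rightarrow> real)"
    using t by (intro integrable_real_indicator) simp_all
  show "AE p in lborel \<Otimes>\<^sub>M lborel. norm ((\<lambda>(\<tau>, \<xi>). G \<tau> \<xi>) p) \<le> norm ((\<lambda>(\<tau>, \<xi>). indicator {0..t} \<tau> * r \<xi>) p)"
    unfolding case_prod_beta' real_norm_def by (intro AE_I2 order_trans[OF Gb abs_ge_self])
qed

section \<open>The linear and the nonlinear evolution on the Fourier side\<close>

text \<open>
  The upper bound \<open>A - \<bar>\<xi>\<bar>\<close> on the symbol is what the solution theory for decaying data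
  rests on: the damping \<open>exp (- \<eta> t \<bar>\<xi>\<bar>)\<close> pays for the derivative in the nonlinearity.
\<close>

locale dissipative_symbol =
  fixes \<eta> T A :: real and \<Phi> :: "real \<Rightarrow> real"
  assumes eta: "0 < \<eta>" and T: "0 < T"
    and Phi_borel [measurable]: "\<Phi> \<in> borel_measurable borel"
    and Phi_le: "\<And>\<xi>. \<Phi> \<xi> \<le> A - \<bar>\<xi>\<bar>"
begin

text \<open>
  The Fourier multiplier of the propagator at time \<open>t\<close>.
\<close>

definition E :: "real \<Rightarrow> real \<Rightarrow> complex"
  where "E t \<xi> = cis (t * \<xi> ^ 3) * of_real (exp (\<eta> * t * \<Phi> \<xi>))"

lemma E_borel:
  assumes [measurable]: "u \<in> borel_measurable M" "v \<in> borel_measurable M"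
  shows "(\<lambda>x. E (u x) (v x)) \<in> borel_measurable M"
  unfolding E_def by measurable

lemma E_add: "E (t + t') \<xi> = E t \<xi> * E t' \<xi>"
proof -
  have "cis ((t + t') * \<xi> ^ 3) = cis (t * \<xi> ^ 3) * cis (t' * \<xi> ^ 3)"
    unfolding cis_mult distrib_right ..
  moreover have "exp (\<eta> * (t + t') * \<Phi> \<xi>) = exp (\<eta> * t * \<Phi> \<xi>) * exp (\<eta> * t' * \<Phi> \<xi>)"
    unfolding exp_add[symmetric] distrib_left distrib_right ..
  ultimately show ?thesis unfolding E_def by (simp only: of_real_mult mult_ac)
qed

lemma E_diff: "E (t - t') \<xi> = E t \<xi> * E (- t') \<xi>"
  using E_add[of t "- t'"] by simp

lemma norm_E: "norm (E t \<xi>) = exp (\<eta> * t * \<Phi> \<xi>)"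
  by (simp add: E_def norm_mult)

lemma E_multiplier: "exp (\<i> * complex_of_real (t * \<xi> ^ 3) + complex_of_real (\<eta> * t * \<Phi> \<xi>)) = E t \<xi>"
  unfolding E_def exp_add cis_conv_exp exp_of_real ..

definition M0 :: real where "M0 = exp (\<eta> * T * \<bar>A\<bar>)"

lemma M0_pos: "0 < M0" by (simp add: M0_def)

lemma E_le:
  assumes "0 \<le> t" "t \<le> T" shows "norm (E t \<xi>) \<le> M0 * exp (- \<eta> * t * \<bar>\<xi>\<bar>)"
proof -
  have "\<eta> * t * \<Phi> \<xi> \<le> \<eta> * t * (\<bar>A\<bar> - \<bar>\<xi>\<bar>)"
    using assms eta Phi_le[of \<xi>] by (intro mult_left_mono) auto
  also have "\<dots> \<le> \<eta> * T * \<bar>A\<bar> + - \<eta> * t * \<bar>\<xi>\<bar>"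
    using mult_right_mono[OF mult_left_mono[OF assms(2), of \<eta>], of "\<bar>A\<bar>"] eta by (simp add: algebra_simps)
  finally show ?thesis unfolding norm_E M0_def exp_add[symmetric] by simp
qed

lemma E_le_M0: "0 \<le> t \<Longrightarrow> t \<le> T \<Longrightarrow> norm (E t \<xi>) \<le> M0"
  by (rule order_trans[OF E_le mult_left_le]) (use eta M0_pos in auto)

lemma E_backward_le:
  assumes "0 \<le> \<tau>" "\<tau> \<le> T" shows "norm (E (- \<tau>) \<xi>) \<le> exp (\<eta> * T * \<bar>\<Phi> \<xi>\<bar>)"
proof -
  have "\<eta> * (- \<tau>) * \<Phi> \<xi> \<le> \<bar>\<eta> * (- \<tau>) * \<Phi> \<xi>\<bar>" by (rule abs_ge_self)
  also have "\<dots> = \<eta> * \<tau> * \<bar>\<Phi> \<xi>\<bar>" using eta assms by (simp add: abs_mult)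
  also have "\<dots> \<le> \<eta> * T * \<bar>\<Phi> \<xi>\<bar>" using eta assms by (intro mult_right_mono mult_left_mono) auto
  finally show ?thesis unfolding norm_E by simp
qed

text \<open>
  Curves of Fourier transforms with a pointwise bound. Pointwise bounds make
  the contraction argument elementary: the iterates converge at each time and frequency, and
  measurability passes to the limit.
\<close>

definition traj :: "real \<Rightarrow> (real \<Rightarrow> real \<Rightarrow> complex) \<Rightarrow> bool"
  where "traj a w \<longleftrightarrow> (\<lambda>(t, \<xi>). w t \<xi>) \<in> borel_measurable (borel \<Otimes>\<^sub>M borel) \<and>
    (\<forall>t\<in>{0..T}. \<forall>\<xi>. norm (w t \<xi>) \<le> a * decay \<xi>)"

lemma traj_borel:
  assumes "traj a w" and [measurable]: "u \<in> borel_measurable M" "v \<in> borel_measurable M"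
  shows "(\<lambda>x. w (u x) (v x)) \<in> borel_measurable M"
proof -
  have [measurable]: "(\<lambda>(t, \<xi>). w t \<xi>) \<in> borel_measurable (borel \<Otimes>\<^sub>M borel)" using assms(1) by (simp add: traj_def)
  have "(\<lambda>x. (\<lambda>(t, \<xi>). w t \<xi>) (u x, v x)) \<in> borel_measurable M" by measurable
  then show ?thesis by simp
qed

lemma traj_le: "traj a w \<Longrightarrow> 0 \<le> t \<Longrightarrow> t \<le> T \<Longrightarrow> norm (w t \<xi>) \<le> a * decay \<xi>"
  by (simp add: traj_def)

lemma traj_slice_borel:
  assumes "traj a w" shows "w t \<in> borel_measurable borel"
proof -
  have "(\<lambda>x. w t x) \<in> borel_measurable borel" by (rule traj_borel[OF assms]) measurable
  then show ?thesis .
qed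

lemma traj_diff:
  assumes "traj a w" "traj b w'" shows "traj (a + b) (\<lambda>t \<xi>. w t \<xi> - w' t \<xi>)"
  unfolding traj_def
proof (intro conjI ballI allI)
  have [measurable]: "(\<lambda>(t, \<xi>). w t \<xi>) \<in> borel_measurable (borel \<Otimes>\<^sub>M borel)"
    "(\<lambda>(t, \<xi>). w' t \<xi>) \<in> borel_measurable (borel \<Otimes>\<^sub>M borel)" using assms by (auto simp: traj_def)
  show "(\<lambda>(t, \<xi>). w t \<xi> - w' t \<xi>) \<in> borel_measurable (borel \<Otimes>\<^sub>M borel)"
    using borel_measurable_diff[of "\<lambda>(t, \<xi>). w t \<xi>" "borel \<Otimes>\<^sub>M borel" "\<lambda>(t, \<xi>). w' t \<xi>"] by (simp add: case_prod_beta')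
  show "norm (w t \<xi> - w' t \<xi>) \<le> (a + b) * decay \<xi>" if "t \<in> {0..T}" for t \<xi>
    using norm_triangle_ineq4[of "w t \<xi>" "w' t \<xi>"] traj_le[OF assms(1), of t \<xi>] traj_le[OF assms(2), of t \<xi>] that
    by (simp add: distrib_right)
qed

abbreviation integrand where
  "integrand w w' t \<xi> \<tau> \<equiv> indicator {0..t} \<tau> *\<^sub>R (E (t - \<tau>) \<xi> * conv (w \<tau>) (w' \<tau>) \<xi>)"

text \<open>
  The Fourier transform of \<open>\<integral>\<^sub>0\<^sup>t V(t - \<tau>) (v v')\<^sub>x(\<tau>) d\<tau>\<close> for curves \<open>v\<close> and \<open>v'\<close>
  with Fourier transforms \<open>w\<close> and \<open>w'\<close>; the factor \<open>1 / (2 \<pi>)\<close> comes from the convention for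
  the Fourier transform.
\<close>

definition duhamel :: "(real \<Rightarrow> real \<Rightarrow> complex) \<Rightarrow> (real \<Rightarrow> real \<Rightarrow> complex) \<Rightarrow> real \<Rightarrow> real \<Rightarrow> complex"
  where "duhamel w w' t \<xi> = (\<i> * of_real \<xi> / of_real (2 * pi)) *
    (LBINT \<tau>. integrand w w' t \<xi> \<tau>)"

lemma conv_traj_borel:
  assumes w: "traj a w" and w': "traj b w'"
  shows "(\<lambda>(\<tau>, \<xi>). conv (w \<tau>) (w' \<tau>) \<xi>) \<in> borel_measurable (borel \<Otimes>\<^sub>M borel)"
  unfolding conv_def case_prod_beta'
proof (rule lborel.borel_measurable_lebesgue_integral)
  have [measurable]: "(\<lambda>x. w (fst (fst x)) (snd x)) \<in> borel_measurable ((borel \<Otimes>\<^sub>M borel) \<Otimes>\<^sub>M lborel)"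
    by (rule traj_borel[OF w]) measurable
  have [measurable]: "(\<lambda>x. w' (fst (fst x)) (snd (fst x) - snd x)) \<in> borel_measurable ((borel \<Otimes>\<^sub>M borel) \<Otimes>\<^sub>M lborel)"
    by (rule traj_borel[OF w']) measurable
  show "(\<lambda>(p, \<zeta>). w (fst p) \<zeta> * w' (fst p) (snd p - \<zeta>)) \<in> borel_measurable ((borel \<Otimes>\<^sub>M borel) \<Otimes>\<^sub>M lborel)"
    unfolding case_prod_beta' by measurable
qed

lemma conv_traj_borel':
  assumes "traj a w" "traj b w'" and [measurable]: "u \<in> borel_measurable M" "v \<in> borel_measurable M"
  shows "(\<lambda>x. conv (w (u x)) (w' (u x)) (v x)) \<in> borel_measurable M"
proof -
  note [measurable] = conv_traj_borel[OF assms(1,2)]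
  have "(\<lambda>x. (\<lambda>(t, \<xi>). conv (w t) (w' t) \<xi>) (u x, v x)) \<in> borel_measurable M" by measurable
  then show ?thesis by simp
qed

lemma indicator_Icc_borel:
  assumes [measurable]: "u \<in> borel_measurable M" "v \<in> borel_measurable M"
  shows "(\<lambda>x. indicator {0..u x} (v x :: real) :: real) \<in> borel_measurable M"
proof -
  have "(\<lambda>x. indicator {0..u x} (v x :: real) :: real) = (\<lambda>x. if 0 \<le> v x \<and> v x \<le> u x then 1 else 0)"
    by (auto simp: indicator_def)
  moreover have "(\<lambda>x. if 0 \<le> v x \<and> v x \<le> u x then 1 else 0 :: real) \<in> borel_measurable M"
    by measurable
  ultimately show ?thesis by (simp only:)
qed

lemma conv_traj_le:
  assumes w: "traj a w" and w': "traj b w'" and ab: "0 \<le> a" "0 \<le> b" and t: "0 \<le> \<tau>" "\<tau> \<le> T"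
  shows "norm (conv (w \<tau>) (w' \<tau>) \<xi>) \<le> 16 * decay_mass * a * b * decay \<xi>"
  by (rule conv_le[OF traj_slice_borel[OF w] traj_slice_borel[OF w'] traj_le[OF w t] traj_le[OF w' t] ab])

lemma duhamel_borel:
  assumes w: "traj a w" and w': "traj b w'"
  shows "(\<lambda>(t, \<xi>). duhamel w w' t \<xi>) \<in> borel_measurable (borel \<Otimes>\<^sub>M borel)"
proof -
  let ?N = "(borel \<Otimes>\<^sub>M borel) \<Otimes>\<^sub>M lborel :: ((real \<times> real) \<times> real) measure"
  have 1: "(\<lambda>x. indicator {0..fst (fst x)} (snd x) :: real) \<in> borel_measurable ?N"
    by (rule indicator_Icc_borel) measurable
  have 2: "(\<lambda>x. E (fst (fst x) - snd x) (snd (fst x))) \<in> borel_measurable ?N"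
    by (rule E_borel) measurable
  have 3: "(\<lambda>x. conv (w (snd x)) (w' (snd x)) (snd (fst x))) \<in> borel_measurable ?N"
    by (rule conv_traj_borel'[OF w w']) measurable
  have "(\<lambda>p. LBINT \<tau>. indicator {0..fst p} \<tau> *\<^sub>R (E (fst p - \<tau>) (snd p) * conv (w \<tau>) (w' \<tau>) (snd p)))
      \<in> borel_measurable (borel \<Otimes>\<^sub>M borel)"
    using borel_measurable_scaleR[OF 1 borel_measurable_times[OF 2 3]]
    by (intro lborel.borel_measurable_lebesgue_integral) (simp only: case_prod_beta')
  from borel_measurable_times[OF _ this, of "\<lambda>p. \<i> * of_real (snd p) / of_real (2 * pi)"]
  show ?thesis unfolding duhamel_def case_prod_beta' by simp
qed

lemma duhamel_integrand:
  assumes w: "traj a w" and w': "traj b w'" and ab: "0 \<le> a" "0 \<le> b" and t: "0 \<le> t" "t \<le> T"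
  shows "integrable lborel (\<lambda>\<tau>. integrand w w' t \<xi> \<tau>)"
    and "norm (integrand w w' t \<xi> \<tau>) \<le>
      (16 * decay_mass * a * b * M0 * decay \<xi>) * (indicator {0..t} \<tau> * exp (- \<eta> * (t - \<tau>) * \<bar>\<xi>\<bar>))"
proof -
  let ?C = "16 * decay_mass * a * b * M0 * decay \<xi>"
  have C: "0 \<le> ?C" using ab decay_mass_nonneg M0_pos by simp
  have b: "norm (integrand w w' t \<xi> \<tau>) \<le>
      ?C * (indicator {0..t} \<tau> * exp (- \<eta> * (t - \<tau>) * \<bar>\<xi>\<bar>))" for \<tau>
  proof (cases "\<tau> \<in> {0..t}")
    case True
    have "norm (E (t - \<tau>) \<xi> * conv (w \<tau>) (w' \<tau>) \<xi>) \<le>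
        (M0 * exp (- \<eta> * (t - \<tau>) * \<bar>\<xi>\<bar>)) * (16 * decay_mass * a * b * decay \<xi>)"
      unfolding norm_mult using True t M0_pos by (intro mult_mono E_le conv_traj_le[OF w w' ab]) auto
    then show ?thesis using True by (simp add: mult_ac)
  qed simp
  then show "norm (integrand w w' t \<xi> \<tau>) \<le>
      ?C * (indicator {0..t} \<tau> * exp (- \<eta> * (t - \<tau>) * \<bar>\<xi>\<bar>))" .
  show "integrable lborel (\<lambda>\<tau>. integrand w w' t \<xi> \<tau>)"
  proof (rule Bochner_Integration.integrable_bound[where f = "\<lambda>\<tau>. ?C * indicator {0..t} \<tau>"])
    show "integrable lborel (\<lambda>\<tau>. ?C * indicator {0..t} \<tau>)" using t by (intro integrable_mult_right integrable_real_indicator) simp_all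
    show "AE \<tau> in lborel. norm (integrand w w' t \<xi> \<tau>) \<le> norm (?C * indicator {0..t} \<tau>)"
    proof (rule AE_I2)
      fix \<tau>
      have "indicator {0..t} \<tau> * exp (- \<eta> * (t - \<tau>) * \<bar>\<xi>\<bar>) \<le> indicator {0..t} \<tau> * (1::real)"
        using eta by (cases "\<tau> \<in> {0..t}") auto
      from order_trans[OF b mult_left_mono[OF this C]]
      show "norm (integrand w w' t \<xi> \<tau>) \<le> norm (?C * indicator {0..t} \<tau>)"
        unfolding real_norm_def by simp
    qed
    show "(\<lambda>\<tau>. integrand w w' t \<xi> \<tau>) \<in> borel_measurable lborel"
      by (intro borel_measurable_scaleR borel_measurable_times indicator_Icc_borel E_borel conv_traj_borel'[OF w w']) measurable
  qed
qed

section \<open>The Duhamel operator and Picard iteration\<close>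

text \<open>
  A bound for the norm of the bilinear Duhamel operator with respect to pointwise bounds by
  \<open>decay\<close>.
\<close>

definition K0 :: real where "K0 = 16 * decay_mass * M0 / (2 * pi * \<eta>)"

lemma K0_nonneg: "0 \<le> K0" using decay_mass_nonneg M0_pos eta by (simp add: K0_def)

lemma exp_time_integral:
  assumes t: "0 \<le> t" and x: "0 < x"
  shows "integrable lborel (\<lambda>\<tau>. indicator {0..t} \<tau> * exp (- \<eta> * (t - \<tau>) * x))"
    and "(LBINT \<tau>. indicator {0..t} \<tau> * exp (- \<eta> * (t - \<tau>) * x)) \<le> 1 / (\<eta> * x)"
proof -
  define f where "f \<tau> = exp (- \<eta> * (t - \<tau>) * x)" for \<tau>
  define G where "G \<tau> = exp (- \<eta> * (t - \<tau>) * x) / (\<eta> * x)" for \<tau>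
  have d: "(G has_real_derivative f \<tau>) (at \<tau>)" for \<tau>
  proof -
    have "((\<lambda>\<tau>. exp (- \<eta> * (t - \<tau>) * x)) has_real_derivative exp (- \<eta> * (t - \<tau>) * x) * (\<eta> * x)) (at \<tau>)"
      by (auto intro!: derivative_eq_intros)
    from DERIV_cdivide[OF this, of "\<eta> * x"] show ?thesis
      using eta x by (simp add: f_def G_def[abs_def])
  qed
  have c: "isCont f \<tau>" for \<tau> unfolding f_def[abs_def] by (intro continuous_intros)
  have hb: "has_bochner_integral lborel (\<lambda>\<tau>. f \<tau> * indicator {0..t} \<tau>) (G t - G 0)"
    by (rule has_bochner_integral_FTC_Icc_real[OF t d c])
  then show "integrable lborel (\<lambda>\<tau>. indicator {0..t} \<tau> * exp (- \<eta> * (t - \<tau>) * x))"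
    by (simp add: has_bochner_integral_iff f_def mult.commute)
  have "(LBINT \<tau>. indicator {0..t} \<tau> * exp (- \<eta> * (t - \<tau>) * x)) = G t - G 0"
    using hb by (simp add: has_bochner_integral_iff f_def mult.commute)
  also have "\<dots> \<le> 1 / (\<eta> * x)" using eta x by (simp add: G_def)
  finally show "(LBINT \<tau>. indicator {0..t} \<tau> * exp (- \<eta> * (t - \<tau>) * x)) \<le> 1 / (\<eta> * x)" .
qed

text \<open>
  The derivative is absorbed by \<open>\<bar>\<xi>\<bar> \<integral>\<^sub>0\<^sup>t exp (- \<eta> (t - \<tau>) \<bar>\<xi>\<bar>) d\<tau> \<le> 1 / \<eta>\<close>, uniformly
  in \<open>t\<close> and \<open>\<xi>\<close>.
\<close>

lemma duhamel_le:
  assumes w: "traj a w" and w': "traj b w'" and ab: "0 \<le> a" "0 \<le> b" and t: "0 \<le> t" "t \<le> T"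
  shows "norm (duhamel w w' t \<xi>) \<le> K0 * a * b * decay \<xi>"
proof (cases "\<xi> = 0")
  case True
  then show ?thesis using K0_nonneg ab by (simp add: duhamel_def)
next
  case False
  let ?C = "16 * decay_mass * a * b * M0 * decay \<xi>"
  have x: "0 < \<bar>\<xi>\<bar>" using False by simp
  have C: "0 \<le> ?C" using ab decay_mass_nonneg M0_pos by simp
  have "norm (LBINT \<tau>. integrand w w' t \<xi> \<tau>)
     \<le> (LBINT \<tau>. ?C * (indicator {0..t} \<tau> * exp (- \<eta> * (t - \<tau>) * \<bar>\<xi>\<bar>)))"
    by (rule order_trans[OF integral_norm_bound], rule integral_mono)
      (intro integrable_norm integrable_mult_right duhamel_integrand[OF w w' ab t] exp_time_integral[OF t(1) x])+
  also have "\<dots> = ?C * (LBINT \<tau>. indicator {0..t} \<tau> * exp (- \<eta> * (t - \<tau>) * \<bar>\<xi>\<bar>))"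
    by (rule integral_mult_right_zero)
  also have "\<dots> \<le> ?C * (1 / (\<eta> * \<bar>\<xi>\<bar>))"
    by (intro mult_left_mono exp_time_integral(2)[OF t(1) x] C)
  finally have I: "norm (LBINT \<tau>. integrand w w' t \<xi> \<tau>) \<le> ?C * (1 / (\<eta> * \<bar>\<xi>\<bar>))" .
  have n: "norm (\<i> * complex_of_real \<xi> / complex_of_real (2 * pi)) = \<bar>\<xi>\<bar> / (2 * pi)"
    by (simp add: norm_divide norm_mult)
  have "norm (duhamel w w' t \<xi>) \<le> (\<bar>\<xi>\<bar> / (2 * pi)) * (?C * (1 / (\<eta> * \<bar>\<xi>\<bar>)))"
    unfolding duhamel_def norm_mult[of "\<i> * complex_of_real \<xi> / complex_of_real (2 * pi)"] n by (intro mult_left_mono I) simp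
  also have "\<dots> = K0 * a * b * decay \<xi>" using x by (simp add: K0_def)
  finally show ?thesis .
qed

lemma duhamel_traj:
  assumes "traj a w" "traj b w'" "0 \<le> a" "0 \<le> b"
  shows "traj (K0 * a * b) (duhamel w w')"
  unfolding traj_def using duhamel_borel[OF assms(1,2)] duhamel_le[OF assms] by auto

text \<open>
  Polarisation of the quadratic map \<open>w \<mapsto> duhamel w w\<close>.
\<close>

lemma duhamel_diff:
  assumes w: "traj a w" and w': "traj b w'" and ab: "0 \<le> a" "0 \<le> b" and t: "0 \<le> t" "t \<le> T"
  shows "duhamel w w t \<xi> - duhamel w' w' t \<xi> = duhamel (\<lambda>t \<xi>. w t \<xi> - w' t \<xi>) w t \<xi> + duhamel w' (\<lambda>t \<xi>. w t \<xi> - w' t \<xi>) t \<xi>"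
proof -
  let ?d = "\<lambda>t \<xi>. w t \<xi> - w' t \<xi>"
  note d = traj_diff[OF w w']
  have ab': "0 \<le> a + b" using ab by simp
  have c: "conv (w \<tau>) (w \<tau>) \<xi> - conv (w' \<tau>) (w' \<tau>) \<xi> = conv (?d \<tau>) (w \<tau>) \<xi> + conv (w' \<tau>) (?d \<tau>) \<xi>" if "\<tau> \<in> {0..t}" for \<tau>
  proof -
    have \<tau>: "0 \<le> \<tau>" "\<tau> \<le> T" using that t by auto
    have i: "integrable lborel (\<lambda>\<zeta>. w1 \<tau> \<zeta> * w2 \<tau> (\<xi> - \<zeta>))" if "traj c1 w1" "traj c2 w2" for w1 w2 c1 c2
      by (rule conv_integrand_integrable[OF traj_slice_borel[OF that(1)] traj_slice_borel[OF that(2)]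
            traj_le[OF that(1) \<tau>] traj_le[OF that(2) \<tau>]])
    show ?thesis unfolding conv_def
      Bochner_Integration.integral_diff[OF i[OF w w] i[OF w' w'], symmetric]
      Bochner_Integration.integral_add[OF i[OF d w] i[OF w' d], symmetric]
      by (simp add: algebra_simps)
  qed
  note j = duhamel_integrand(1)[OF w w ab(1) ab(1) t] duhamel_integrand(1)[OF w' w' ab(2) ab(2) t]
    duhamel_integrand(1)[OF d w ab' ab(1) t] duhamel_integrand(1)[OF w' d ab(2) ab' t]
  show ?thesis unfolding duhamel_def distrib_left[symmetric] right_diff_distrib[symmetric]
    Bochner_Integration.integral_diff[OF j(1,2), symmetric] Bochner_Integration.integral_add[OF j(3,4), symmetric]
  proof (intro arg_cong2[where f = "(*)"] refl Bochner_Integration.integral_cong)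
    fix \<tau>
    show "integrand w w t \<xi> \<tau> - integrand w' w' t \<xi> \<tau>
      = integrand ?d w t \<xi> \<tau> + integrand w' ?d t \<xi> \<tau>"
    proof (cases "\<tau> \<in> {0..t}")
      case True
      have "E (t - \<tau>) \<xi> * (conv (w \<tau>) (w \<tau>) \<xi> - conv (w' \<tau>) (w' \<tau>) \<xi>)
          = E (t - \<tau>) \<xi> * (conv (?d \<tau>) (w \<tau>) \<xi> + conv (w' \<tau>) (?d \<tau>) \<xi>)"
        unfolding c[OF True] ..
      then show ?thesis using True by (simp add: right_diff_distrib distrib_left)
    qed simp
  qed
qed

lemma duhamel_diff_le:
  assumes w: "traj a w" and w': "traj b w'" and d: "traj c (\<lambda>t \<xi>. w t \<xi> - w' t \<xi>)"
    and abc: "0 \<le> a" "0 \<le> b" "0 \<le> c" and t: "0 \<le> t" "t \<le> T"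
  shows "norm (duhamel w w t \<xi> - duhamel w' w' t \<xi>) \<le> K0 * c * (a + b) * decay \<xi>"
  unfolding duhamel_diff[OF w w' abc(1,2) t]
  using norm_triangle_ineq[of "duhamel (\<lambda>t \<xi>. w t \<xi> - w' t \<xi>) w t \<xi>" "duhamel w' (\<lambda>t \<xi>. w t \<xi> - w' t \<xi>) t \<xi>"]
    duhamel_le[OF d w abc(3,1) t, of \<xi>] duhamel_le[OF w' d abc(2,3) t, of \<xi>]
  by (simp add: algebra_simps)

lemma traj_mono: "traj a w \<Longrightarrow> a \<le> b \<Longrightarrow> traj b w"
  unfolding traj_def by (meson decay_nonneg mult_right_mono order_trans)

primrec picard :: "(real \<Rightarrow> real \<Rightarrow> complex) \<Rightarrow> nat \<Rightarrow> real \<Rightarrow> real \<Rightarrow> complex" where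
  "picard u 0 = (\<lambda>t \<xi>. 0)"
| "picard u (Suc n) = (\<lambda>t \<xi>. u t \<xi> - duhamel (picard u n) (picard u n) t \<xi>)"

text \<open>
  The smallness condition makes the map a contraction with factor \<open>1 / 2\<close> on the trajectories
  bounded by \<open>2 * \<rho> * decay\<close>.
\<close>

lemma picard_fixpoint:
  assumes u: "traj \<rho> u" and \<rho>: "0 \<le> \<rho>" "8 * K0 * \<rho> \<le> 1"
  shows "\<exists>w. traj (2 * \<rho>) w \<and> (\<forall>t\<in>{0..T}. \<forall>\<xi>. w t \<xi> = u t \<xi> - duhamel w w t \<xi>)"
proof -
  let ?p = "picard u"
  have r2: "0 \<le> 2 * \<rho>" using \<rho> by simp
  have k4: "K0 * (2 * \<rho>) * (2 * \<rho>) \<le> \<rho>"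
    using mult_right_mono[OF \<rho>(2) \<rho>(1)] K0_nonneg \<rho> by (simp add: algebra_simps) 
  have tr: "traj (2 * \<rho>) (?p n)" for n
  proof (induction n)
    case 0
    then show ?case using \<rho> by (simp add: traj_def)
  next
    case (Suc n)
    have "traj (\<rho> + K0 * (2 * \<rho>) * (2 * \<rho>)) (?p (Suc n))"
      using traj_diff[OF u duhamel_traj[OF Suc Suc r2 r2]] by simp
    then show ?case by (rule traj_mono) (use k4 in simp)
  qed
  have contr: "norm (duhamel w w t \<xi> - duhamel w' w' t \<xi>) \<le> c / 2 * decay \<xi>"
    if "traj (2 * \<rho>) w" "traj (2 * \<rho>) w'" "traj c (\<lambda>t \<xi>. w t \<xi> - w' t \<xi>)" "0 \<le> c" "t \<in> {0..T}" for w w' c t \<xi>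
  proof -
    have "norm (duhamel w w t \<xi> - duhamel w' w' t \<xi>) \<le> K0 * c * (2 * \<rho> + 2 * \<rho>) * decay \<xi>"
      using that r2 by (intro duhamel_diff_le) auto
    also have "\<dots> \<le> c / 2 * decay \<xi>"
      using mult_right_mono[OF \<rho>(2) that(4)] by (intro mult_right_mono) (auto simp: algebra_simps)
    finally show ?thesis .
  qed
  have step: "traj (2 * \<rho> / 2 ^ n) (\<lambda>t \<xi>. ?p (Suc n) t \<xi> - ?p n t \<xi>)" for n
  proof (induction n)
    case 0
    show ?case using tr[of 1] by (simp add: traj_def)
  next
    case (Suc n)
    have m: "(\<lambda>(t, \<xi>). ?p (Suc (Suc n)) t \<xi> - ?p (Suc n) t \<xi>) \<in> borel_measurable (borel \<Otimes>\<^sub>M borel)"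
      using traj_diff[OF tr[of "Suc (Suc n)"] tr[of "Suc n"]] by (simp only: traj_def)
    have "norm (?p (Suc (Suc n)) t \<xi> - ?p (Suc n) t \<xi>) \<le> 2 * \<rho> / 2 ^ Suc n * decay \<xi>" if "t \<in> {0..T}" for t \<xi>
    proof -
      have "?p (Suc (Suc n)) t \<xi> - ?p (Suc n) t \<xi> = - (duhamel (?p (Suc n)) (?p (Suc n)) t \<xi> - duhamel (?p n) (?p n) t \<xi>)"
        by (simp only: picard.simps(2)) simp
      also have "norm \<dots> \<le> (2 * \<rho> / 2 ^ n) / 2 * decay \<xi>"
        unfolding norm_minus_cancel using \<rho> that by (intro contr tr Suc) auto
      finally show ?thesis by (simp add: field_simps)
    qed
    with m show ?case unfolding traj_def by blast
  qed
  define w where "w t \<xi> = lim (\<lambda>n. ?p n t \<xi>)" for t \<xi>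
  have lim: "(\<lambda>n. ?p n t \<xi>) \<longlonglongrightarrow> w t \<xi>" if t: "t \<in> {0..T}" for t \<xi>
  proof -
    have "summable (\<lambda>n. ?p (Suc n) t \<xi> - ?p n t \<xi>)"
    proof (rule summable_comparison_test')
      show "summable (\<lambda>n. (2 * \<rho> * decay \<xi>) * (1 / 2) ^ n)" by (intro summable_mult summable_geometric) simp
      show "norm (?p (Suc n) t \<xi> - ?p n t \<xi>) \<le> (2 * \<rho> * decay \<xi>) * (1 / 2) ^ n" for n
        using traj_le[OF step[of n], of t \<xi>] t by (simp add: power_divide mult_ac)
    qed
    moreover have "(\<Sum>i<n. ?p (Suc i) t \<xi> - ?p i t \<xi>) = ?p n t \<xi>" for n
      using sum_lessThan_telescope[of "\<lambda>n. ?p n t \<xi>" n] by (simp del: picard.simps(2))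
    ultimately have "convergent (\<lambda>n. ?p n t \<xi>)"
      by (simp only: summable_iff_convergent)
    then show ?thesis unfolding w_def by (simp add: convergent_LIMSEQ_iff)
  qed
  have dist_n: "norm (w t \<xi> - ?p n t \<xi>) \<le> 4 * \<rho> / 2 ^ n * decay \<xi>" if t: "t \<in> {0..T}" for t \<xi> n
  proof -
    have "norm (?p (n + m) t \<xi> - ?p n t \<xi>) \<le> (4 * \<rho> / 2 ^ n - 4 * \<rho> / 2 ^ (n + m)) * decay \<xi>" for m
    proof (induction m)
      case (Suc m)
      have "norm (?p (n + Suc m) t \<xi> - ?p n t \<xi>) \<le> norm (?p (Suc (n + m)) t \<xi> - ?p (n + m) t \<xi>) + norm (?p (n + m) t \<xi> - ?p n t \<xi>)"
        using norm_triangle_ineq[of "?p (Suc (n + m)) t \<xi> - ?p (n + m) t \<xi>" "?p (n + m) t \<xi> - ?p n t \<xi>"] by (simp del: picard.simps)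
      also have "\<dots> \<le> 2 * \<rho> / 2 ^ (n + m) * decay \<xi> + (4 * \<rho> / 2 ^ n - 4 * \<rho> / 2 ^ (n + m)) * decay \<xi>"
        using traj_le[OF step[of "n + m"], of t \<xi>] t Suc by (intro add_mono) auto
      also have "\<dots> = (4 * \<rho> / 2 ^ n - 4 * \<rho> / 2 ^ (n + Suc m)) * decay \<xi>" by (simp add: field_simps)
      finally show ?case .
    qed simp
    moreover have "(4 * \<rho> / 2 ^ n - 4 * \<rho> / 2 ^ (n + m)) * decay \<xi> \<le> 4 * \<rho> / 2 ^ n * decay \<xi>" for m
      using \<rho> by (intro mult_right_mono) auto
    ultimately have b: "norm (?p (n + m) t \<xi> - ?p n t \<xi>) \<le> 4 * \<rho> / 2 ^ n * decay \<xi>" for m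
      using order_trans by blast
    have "(\<lambda>m. ?p (n + m) t \<xi>) \<longlonglongrightarrow> w t \<xi>" using LIMSEQ_ignore_initial_segment[OF lim[OF t, of \<xi>], of n] by (simp add: add.commute)
    then have "(\<lambda>m. norm (?p (n + m) t \<xi> - ?p n t \<xi>)) \<longlonglongrightarrow> norm (w t \<xi> - ?p n t \<xi>)" by (intro tendsto_intros)
    then show ?thesis by (rule LIMSEQ_le_const2) (use b in auto)
  qed
  have wm: "(\<lambda>(t, \<xi>). w t \<xi>) \<in> borel_measurable (borel \<Otimes>\<^sub>M borel)"
    unfolding w_def case_prod_beta'
    using tr by (intro borel_measurable_lim_metric) (simp add: traj_def case_prod_beta')
  have wtr: "traj (2 * \<rho>) w"
    unfolding traj_def
  proof (intro conjI wm ballI allI)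
    fix t \<xi> assume t: "t \<in> {0..T}"
    have "(\<lambda>n. norm (?p n t \<xi>)) \<longlonglongrightarrow> norm (w t \<xi>)" by (intro tendsto_intros lim t)
    then show "norm (w t \<xi>) \<le> 2 * \<rho> * decay \<xi>"
      by (rule LIMSEQ_le_const2) (use traj_le[OF tr] t in auto)
  qed
  have "w t \<xi> = u t \<xi> - duhamel w w t \<xi>" if t: "t \<in> {0..T}" for t \<xi>
  proof -
    have bd: "norm (w t \<xi> - (u t \<xi> - duhamel w w t \<xi>)) \<le> 4 * \<rho> * decay \<xi> * (1 / 2) ^ n" for n
    proof -
      have dtr: "traj (4 * \<rho> / 2 ^ n) (\<lambda>t \<xi>. w t \<xi> - ?p n t \<xi>)"
        using traj_diff[OF wtr tr[of n]] dist_n[of _ _ n] unfolding traj_def by blast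
      have "w t \<xi> - (u t \<xi> - duhamel w w t \<xi>) = (w t \<xi> - ?p (Suc n) t \<xi>) + (duhamel w w t \<xi> - duhamel (?p n) (?p n) t \<xi>)" by simp
      also have "norm \<dots> \<le> 4 * \<rho> / 2 ^ Suc n * decay \<xi> + (4 * \<rho> / 2 ^ n) / 2 * decay \<xi>"
        using \<rho> by (intro order_trans[OF norm_triangle_ineq add_mono] dist_n contr wtr tr dtr t) auto
      also have "\<dots> = 4 * \<rho> * decay \<xi> * (1 / 2) ^ n" by (simp add: field_simps)
      finally show ?thesis .
    qed
    have "(\<lambda>n. 4 * \<rho> * decay \<xi> * (1 / 2) ^ n) \<longlonglongrightarrow> 0" by (intro tendsto_mult_right_zero LIMSEQ_power_zero) simp
    then have "norm (w t \<xi> - (u t \<xi> - duhamel w w t \<xi>)) \<le> 0" by (rule LIMSEQ_le_const) (use bd in auto)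
    then show ?thesis by simp
  qed
  then show ?thesis using wtr by blast
qed

end

section \<open>Solutions with integrable Fourier transform\<close>

lemma weight_le_1: "s \<le> 0 \<Longrightarrow> weight s \<xi> \<le> 1"
  unfolding weight_def using powr_mono[of s 0 "1 + \<bar>\<xi>\<bar>\<^sup>2"] by (simp split: if_splits)

lemma weight_decay_le:
  fixes z :: complex
  assumes s: "s \<le> 0" and z: "norm z \<le> a * decay \<xi>"
  shows "weight s \<xi> * (norm z)\<^sup>2 \<le> a\<^sup>2 * decay \<xi>"
proof -
  have "weight s \<xi> * (norm z)\<^sup>2 \<le> 1 * (a * decay \<xi>)\<^sup>2"
    using weight_le_1[OF s] z by (intro mult_mono power_mono) auto
  also have "\<dots> = (a\<^sup>2 * decay \<xi>) * decay \<xi>" by (simp add: power2_eq_square mult_ac)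
  also have "\<dots> \<le> (a\<^sup>2 * decay \<xi>) * 1" using decay_le_1 by (intro mult_left_mono) auto
  finally show ?thesis by simp
qed

lemma integrable_weight_decay:
  fixes h :: "real \<Rightarrow> complex"
  assumes s: "s \<le> 0" and [measurable]: "h \<in> borel_measurable borel" and b: "\<And>\<xi>. norm (h \<xi>) \<le> a * decay \<xi>"
  shows "integrable lborel (\<lambda>\<xi>. weight s \<xi> * (norm (h \<xi>))\<^sup>2)"
proof (rule Bochner_Integration.integrable_bound[OF integrable_mult_right[OF integrable_decay, of "a\<^sup>2"]])
  show "AE \<xi> in lborel. norm (weight s \<xi> * (norm (h \<xi>))\<^sup>2) \<le> norm (a\<^sup>2 * decay \<xi>)"
    using weight_decay_le[OF s b] by simp
  show "(\<lambda>\<xi>. weight s \<xi> * (norm (h \<xi>))\<^sup>2) \<in> borel_measurable lborel" by measurable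
qed

context dissipative_symbol begin

lemma E_continuous: "continuous_on S (\<lambda>t. E t \<xi>)"
  unfolding E_def by (intro continuous_intros)

text \<open>
  Since \<open>E (t - \<tau>) = E t * E (- \<tau>)\<close>, the time \<open>t\<close> enters only through a continuous factor
  and through the upper limit of an integral with a bounded integrand.
\<close>

lemma duhamel_continuous:
  assumes w: "traj a w" and a: "0 \<le> a"
  shows "continuous_on {0..T} (\<lambda>t. duhamel w w t \<xi>)"
proof -
  define q where "q \<tau> = E (- \<tau>) \<xi> * conv (w \<tau>) (w \<tau>) \<xi>" for \<tau>
  define Q where "Q = exp (\<eta> * T * \<bar>\<Phi> \<xi>\<bar>) * (16 * decay_mass * a * a * decay \<xi>)"
  define J where "J t = (LBINT \<tau>. indicator {0..t} \<tau> *\<^sub>R q \<tau>)" for t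
  have Q: "norm (q \<tau>) \<le> Q" if \<tau>: "0 \<le> \<tau>" "\<tau> \<le> T" for \<tau>
    unfolding q_def Q_def norm_mult using \<tau> by (intro mult_mono E_backward_le conv_traj_le[OF w w a a]) auto
  have Q0: "0 \<le> Q" using decay_mass_nonneg a by (simp add: Q_def)
  have qm: "q \<in> borel_measurable borel" unfolding q_def[abs_def]
    by (intro borel_measurable_times E_borel conv_traj_borel'[OF w w]) auto
  have ii: "integrable lborel (\<lambda>\<tau>. indicator {0..t} \<tau> *\<^sub>R q \<tau>)" if t: "0 \<le> t" "t \<le> T" for t
  proof (rule Bochner_Integration.integrable_bound[where f = "\<lambda>\<tau>. Q * indicator {0..t} \<tau>"])
    show "integrable lborel (\<lambda>\<tau>. Q * indicator {0..t} \<tau>)"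
      using t by (intro integrable_mult_right integrable_real_indicator) simp_all
    show "AE \<tau> in lborel. norm (indicator {0..t} \<tau> *\<^sub>R q \<tau>) \<le> norm (Q * indicator {0..t} \<tau>)"
      using Q t Q0 by (intro AE_I2) (auto simp: indicator_def)
    show "(\<lambda>\<tau>. indicator {0..t} \<tau> *\<^sub>R q \<tau>) \<in> borel_measurable lborel" using qm by measurable
  qed
  have lip1: "norm (J t' - J t) \<le> Q * (t' - t)" if t: "0 \<le> t" "t \<le> t'" "t' \<le> T" for t t'
  proof -
    have "J t' - J t = (LBINT \<tau>. indicator {0..t'} \<tau> *\<^sub>R q \<tau> - indicator {0..t} \<tau> *\<^sub>R q \<tau>)"
      unfolding J_def using t ii[of t] ii[of t'] by simp
    also have "norm \<dots> \<le> (LBINT \<tau>. Q * indicator {t..t'} \<tau>)"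
    proof (rule order_trans[OF integral_norm_bound], rule integral_mono)
      show "integrable lborel (\<lambda>\<tau>. norm (indicator {0..t'} \<tau> *\<^sub>R q \<tau> - indicator {0..t} \<tau> *\<^sub>R q \<tau>))"
        using t ii[of t] ii[of t'] by (intro integrable_norm Bochner_Integration.integrable_diff) auto
      show "integrable lborel (\<lambda>\<tau>. Q * indicator {t..t'} \<tau>)"
        using t by (intro integrable_mult_right integrable_real_indicator) simp_all
      show "norm (indicator {0..t'} \<tau> *\<^sub>R q \<tau> - indicator {0..t} \<tau> *\<^sub>R q \<tau>) \<le> Q * indicator {t..t'} \<tau>" for \<tau>
        using Q[of \<tau>] t Q0 by (auto simp: indicator_def)
    qed
    also have "\<dots> = Q * (t' - t)" using t by simp
    finally show ?thesis .
  qed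
  have "Q-lipschitz_on {0..T} J"
  proof (rule lipschitz_onI[OF _ Q0])
    fix t t' assume t: "t \<in> {0..T}" "t' \<in> {0..T}"
    show "dist (J t) (J t') \<le> Q * dist t t'"
      using lip1[of t t'] lip1[of t' t] t by (cases "t \<le> t'") (auto simp: dist_norm norm_minus_commute)
  qed
  then have J: "continuous_on {0..T} J" by (rule lipschitz_on_continuous_on)
  have "duhamel w w t \<xi> = (\<i> * of_real \<xi> / of_real (2 * pi)) * (E t \<xi> * J t)" for t
    unfolding duhamel_def J_def q_def integral_mult_right_zero[symmetric]
    by (simp add: E_diff mult.assoc)
  then show ?thesis by (simp only:) (intro continuous_intros J E_continuous)
qed

lemma propagator_freq_dist:
  assumes ae: "AE \<xi> in lebesgue. \<Phi>' \<xi> = \<Phi> \<xi>"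
    and h: "integrable lborel h" and Eh: "integrable lborel (\<lambda>\<xi>. E t \<xi> * h \<xi>)"
  shows "propagator \<eta> \<Phi>' t (freq_dist h) = freq_dist (\<lambda>\<xi>. E t \<xi> * h \<xi>)"
proof -
  have "propagator \<eta> \<Phi>' t (freq_dist h) = fourier_mult (E t) (freq_dist h)"
    unfolding propagator_def
    by (rule fourier_mult_cong_AE) (use ae in \<open>auto elim!: eventually_mono simp: E_multiplier[symmetric]\<close>)
  also have "\<dots> = freq_dist (\<lambda>\<xi>. E t \<xi> * h \<xi>)" by (rule fourier_mult_freq_dist[OF h Eh])
  finally show ?thesis .
qed

lemma E_times_integrable:
  fixes h :: "real \<Rightarrow> complex"
  assumes t: "0 \<le> t" "t \<le> T" and h: "integrable lborel h"
  shows "integrable lborel (\<lambda>\<xi>. E t \<xi> * h \<xi>)"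
  by (rule integrable_bounded_times(1)[OF _ E_le_M0[OF t] h]) (intro E_borel; simp)

lemma traj_free:
  assumes [measurable]: "h \<in> borel_measurable borel" and b: "\<And>\<xi>. norm (h \<xi>) \<le> b * decay \<xi>"
  shows "traj (M0 * b) (\<lambda>t \<xi>. E t \<xi> * h \<xi>)"
  unfolding traj_def
proof (intro conjI ballI allI)
  have "(\<lambda>p. E (fst p) (snd p)) \<in> borel_measurable (borel \<Otimes>\<^sub>M borel)" by (intro E_borel) auto
  then show "(\<lambda>(t, \<xi>). E t \<xi> * h \<xi>) \<in> borel_measurable (borel \<Otimes>\<^sub>M borel)"
    unfolding case_prod_beta' by measurable
  show "norm (E t \<xi> * h \<xi>) \<le> M0 * b * decay \<xi>" if "t \<in> {0..T}" for t \<xi>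
    unfolding norm_mult mult.assoc using that M0_pos by (intro mult_mono E_le_M0 b) auto
qed

context
  fixes w :: "real \<Rightarrow> real \<Rightarrow> complex" and a b s :: real and h :: "real \<Rightarrow> complex" and \<Phi>' :: "real \<Rightarrow> real"
  assumes ae: "AE \<xi> in lebesgue. \<Phi>' \<xi> = \<Phi> \<xi>"
    and s: "s \<le> 0" and a: "0 \<le> a"
    and hb: "h \<in> borel_measurable borel" and h_le: "\<And>\<xi>. norm (h \<xi>) \<le> b * decay \<xi>"
    and w: "traj a w"
    and fixpt: "\<And>t \<xi>. 0 \<le> t \<Longrightarrow> t \<le> T \<Longrightarrow> w t \<xi> = E t \<xi> * h \<xi> - duhamel w w t \<xi>"
begin

lemma w_integrable: "0 \<le> t \<Longrightarrow> t \<le> T \<Longrightarrow> integrable lborel (w t)"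
  by (rule integrable_of_decay(1)[OF traj_slice_borel[OF w] traj_le[OF w]])

lemma w_continuous: "continuous_on {0..T} (\<lambda>t. w t \<xi>)"
proof -
  have "continuous_on {0..T} (\<lambda>t. E t \<xi> * h \<xi> - duhamel w w t \<xi>)"
    by (intro continuous_intros E_continuous duhamel_continuous[OF w a])
  then show ?thesis by (rule continuous_on_eq) (simp add: fixpt)
qed

text \<open>
  At each frequency \<open>w\<close> is continuous in time, and the decay rate is a dominating
  function.
\<close>

lemma curve_in_C_sobolev: "(\<lambda>t. if t \<in> {0..T} then freq_dist (w t) else 0) \<in> car (C_sobolev T s)" (is "?v \<in> _")
proof -
  have d_traj: "norm (w t' \<xi> - w t \<xi>) \<le> (a + a) * decay \<xi>" if "t \<in> {0..T}" "t' \<in> {0..T}" for t t' \<xi>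
    using norm_triangle_ineq4[of "w t' \<xi>" "w t \<xi>"] traj_le[OF w, of t \<xi>] traj_le[OF w, of t' \<xi>] that
    by (simp add: algebra_simps)
  have car: "?v t \<in> car (sobolev s)" if "t \<in> {0..T}" for t
    using that freq_dist_sobolev(1)[OF w_integrable integrable_weight_decay[OF s traj_slice_borel[OF w] traj_le[OF w]]] by simp
  have cont: "\<exists>d>0. \<forall>t'\<in>{0..T}. \<bar>t' - t\<bar> < d \<longrightarrow> nrm (sobolev s) (?v t' - ?v t) < e"
    if t: "t \<in> {0..T}" and e: "0 < e" for t e
  proof -
    define f where "f t' = (LBINT \<xi>. weight s \<xi> * (norm (w t' \<xi> - w t \<xi>))\<^sup>2)" for t'
    have nf: "nrm (sobolev s) (?v t' - ?v t) = sqrt (f t')" if t': "t' \<in> {0..T}" for t'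
    proof -
      have i: "integrable lborel (w t)" "integrable lborel (w t')" using t t' w_integrable by auto
      have "integrable lborel (\<lambda>\<xi>. weight s \<xi> * (norm (w t' \<xi> - w t \<xi>))\<^sup>2)"
        by (rule integrable_weight_decay[OF s _ d_traj[OF t t']])
          (intro borel_measurable_diff traj_slice_borel[OF w])
      then show ?thesis
        using t t' freq_dist_sobolev(2)[of "\<lambda>\<xi>. w t' \<xi> - w t \<xi>" s] i by (simp add: freq_dist_diff f_def)
    qed
    have "(f \<longlongrightarrow> 0) (at t within {0..T})"
      unfolding tendsto_at_iff_sequentially
    proof (intro allI impI)
      fix X :: "nat \<Rightarrow> real" assume X: "\<forall>i. X i \<in> {0..T} - {t}" "X \<longlonglongrightarrow> t"
      have "(\<lambda>n. LBINT \<xi>. weight s \<xi> * (norm (w (X n) \<xi> - w t \<xi>))\<^sup>2) \<longlonglongrightarrow> (LBINT \<xi>. weight s \<xi> * (norm (w t \<xi> - w t \<xi>))\<^sup>2)"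
      proof (rule integral_dominated_convergence[where w = "\<lambda>\<xi>. (a + a)\<^sup>2 * decay \<xi>"])
        have m: "w t \<in> borel_measurable borel" for t by (rule traj_slice_borel[OF w])
        show "(\<lambda>\<xi>. weight s \<xi> * (norm (w (X n) \<xi> - w t \<xi>))\<^sup>2) \<in> borel_measurable lborel" for n
          using m[of t] m[of "X n"] by measurable
        show "integrable lborel (\<lambda>\<xi>. (a + a)\<^sup>2 * decay \<xi>)" by (intro integrable_mult_right integrable_decay)
        show "AE \<xi> in lborel. norm (weight s \<xi> * (norm (w (X n) \<xi> - w t \<xi>))\<^sup>2) \<le> (a + a)\<^sup>2 * decay \<xi>" for n
          using weight_decay_le[OF s d_traj[OF t, of "X n"]] X by simp
        show "AE \<xi> in lborel. (\<lambda>n. weight s \<xi> * (norm (w (X n) \<xi> - w t \<xi>))\<^sup>2) \<longlonglongrightarrow> weight s \<xi> * (norm (w t \<xi> - w t \<xi>))\<^sup>2"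
        proof (rule AE_I2)
          fix \<xi>
          have "(\<lambda>n. w (X n) \<xi>) \<longlonglongrightarrow> w t \<xi>"
            by (rule continuous_on_tendsto_compose[OF w_continuous X(2) t]) (use X in auto)
          then show "(\<lambda>n. weight s \<xi> * (norm (w (X n) \<xi> - w t \<xi>))\<^sup>2) \<longlonglongrightarrow> weight s \<xi> * (norm (w t \<xi> - w t \<xi>))\<^sup>2"
            by (intro tendsto_intros)
        qed
      qed simp
      then show "(f \<circ> X) \<longlonglongrightarrow> 0" by (simp add: o_def f_def)
    qed
    then have "\<forall>\<^sub>F t' in at t within {0..T}. f t' < e\<^sup>2" using e by (intro order_tendstoD) auto
    then obtain d where d: "0 < d" "\<And>t'. t' \<in> {0..T} \<Longrightarrow> t' \<noteq> t \<Longrightarrow> dist t' t < d \<Longrightarrow> f t' < e\<^sup>2"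
      unfolding eventually_at by blast
    have "nrm (sobolev s) (?v t' - ?v t) < e" if t': "t' \<in> {0..T}" "\<bar>t' - t\<bar> < d" for t'
    proof -
      have "f t' < e\<^sup>2"
      proof (cases "t' = t")
        case True
        then show ?thesis using e by (simp add: f_def)
      next
        case False
        then show ?thesis using d(2)[OF t'(1)] t'(2) by (simp add: dist_real_def)
      qed
      then have "sqrt (f t') < sqrt (e\<^sup>2)" by (rule real_sqrt_less_mono)
      then show ?thesis unfolding nf[OF t'(1)] using e by simp
    qed
    then show ?thesis using d(1) by blast
  qed
  show ?thesis unfolding C_sobolev_def using car cont by auto
qed

text \<open>
  The Fourier transform of \<open>(v\<^sup>2)\<^sub>x\<close> at time \<open>\<tau>\<close>.
\<close>

definition flux :: "real \<Rightarrow> real \<Rightarrow> complex"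
  where "flux \<tau> \<xi> = \<i> * of_real \<xi> * (conv (w \<tau>) (w \<tau>) \<xi> / of_real (2 * pi))"

lemma conv_w_borel: "(\<lambda>\<xi>. conv (w \<tau>) (w \<tau>) \<xi>) \<in> borel_measurable borel"
  by (rule conv_traj_borel'[OF w w]) auto

lemma flux_integrable:
  assumes \<tau>: "0 \<le> \<tau>" "\<tau> \<le> T"
  shows "integrable lborel (\<lambda>\<xi>. conv (w \<tau>) (w \<tau>) \<xi> / of_real (2 * pi))" "integrable lborel (flux \<tau>)"
proof -
  have b: "norm (conv (w \<tau>) (w \<tau>) \<xi> / of_real (2 * pi)) \<le> (16 * decay_mass * a * a / (2 * pi)) * decay \<xi>" for \<xi>
    using divide_right_mono[OF conv_traj_le[OF w w a a \<tau>, of \<xi>], of "2 * pi"] by (simp add: norm_divide)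
  have m: "(\<lambda>\<xi>. conv (w \<tau>) (w \<tau>) \<xi> / of_real (2 * pi)) \<in> borel_measurable borel"
    by (intro borel_measurable_divide conv_w_borel) simp
  show "integrable lborel (\<lambda>\<xi>. conv (w \<tau>) (w \<tau>) \<xi> / of_real (2 * pi))" "integrable lborel (flux \<tau>)"
    unfolding flux_def[abs_def] by (rule integrable_of_decay[OF m b])+
qed

lemma nonlinear_term:
  assumes t: "0 \<le> \<tau>" "\<tau> \<le> t" "t \<le> T"
  shows "propagator \<eta> \<Phi>' (t - \<tau>) (dist_deriv (dist_square (freq_dist (w \<tau>)))) = freq_dist (\<lambda>\<xi>. E (t - \<tau>) \<xi> * flux \<tau> \<xi>)"
proof -
  have \<tau>: "0 \<le> \<tau>" "\<tau> \<le> T" using t by auto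
  have "dist_deriv (dist_square (freq_dist (w \<tau>))) = freq_dist (flux \<tau>)"
    unfolding dist_square_freq_dist[OF w_integrable[OF \<tau>]] flux_def[abs_def]
    by (rule dist_deriv_freq_dist[OF flux_integrable(1)[OF \<tau>] flux_integrable(2)[OF \<tau>, unfolded flux_def[abs_def]]])
  then show ?thesis
    using t by (simp add: propagator_freq_dist[OF ae flux_integrable(2)[OF \<tau>] E_times_integrable[OF _ _ flux_integrable(2)[OF \<tau>]]])
qed

text \<open>
  The Duhamel integral of the equation is taken after pairing with \<open>\<psi>\<close>, whereas \<open>duhamel\<close>
  integrates in time at each frequency; the two agree by Fubini.
\<close>

lemma duhamel_pairing:
  assumes t: "0 \<le> t" "t \<le> T" and \<psi>: "\<psi> \<in> schwartz"
  shows "integrable lborel (\<lambda>\<tau>. indicator {0..t} \<tau> *\<^sub>R freq_dist (\<lambda>\<xi>. E (t - \<tau>) \<xi> * flux \<tau> \<xi>) \<psi>)"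
    and "(LBINT \<tau>. indicator {0..t} \<tau> *\<^sub>R freq_dist (\<lambda>\<xi>. E (t - \<tau>) \<xi> * flux \<tau> \<xi>) \<psi>) = freq_dist (duhamel w w t) \<psi>"
proof -
  define k where "k = inv_fourier \<psi>"
  have ks: "k \<in> schwartz" unfolding k_def by (rule inv_fourier_schwartz[OF \<psi>])
  have km: "k \<in> borel_measurable borel" by (rule schwartz_borel[OF ks])
  define N where "N = schwartz_seminorm 0 0 k"
  have kN: "norm (k \<xi>) \<le> N" for \<xi> unfolding N_def by (rule schwartz_bounded[OF ks])
  define G where "G \<tau> \<xi> = indicator {0..t} \<tau> *\<^sub>R ((E (t - \<tau>) \<xi> * flux \<tau> \<xi>) * k \<xi>)" for \<tau> \<xi>
  define C where "C = M0 * (16 * decay_mass * a * a) * N / (2 * pi)"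
  have app: "freq_dist (\<lambda>\<xi>. E (t - \<tau>) \<xi> * flux \<tau> \<xi>) \<psi> = (LBINT \<xi>. (E (t - \<tau>) \<xi> * flux \<tau> \<xi>) * k \<xi>)" if "\<tau> \<in> {0..t}" for \<tau>
    unfolding k_def using that t by (intro freq_dist_apply \<psi> E_times_integrable flux_integrable) auto
  have inner: "indicator {0..t} \<tau> *\<^sub>R freq_dist (\<lambda>\<xi>. E (t - \<tau>) \<xi> * flux \<tau> \<xi>) \<psi> = (LBINT \<xi>. G \<tau> \<xi>)" for \<tau>
    unfolding G_def by (cases "\<tau> \<in> {0..t}") (simp_all add: app)
  have Gm: "(\<lambda>(\<tau>, \<xi>). G \<tau> \<xi>) \<in> borel_measurable (lborel \<Otimes>\<^sub>M lborel)"
  proof -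
    let ?N = "lborel \<Otimes>\<^sub>M lborel :: (real \<times> real) measure"
    have 1: "(\<lambda>x. indicator {0..t} (fst x) :: real) \<in> borel_measurable ?N" by (rule indicator_Icc_borel) measurable
    have 2: "(\<lambda>x. E (t - fst x) (snd x)) \<in> borel_measurable ?N" by (rule E_borel) measurable
    have 3: "(\<lambda>x. conv (w (fst x)) (w (fst x)) (snd x)) \<in> borel_measurable ?N"
      by (rule conv_traj_borel'[OF w w]) measurable
    have 4: "(\<lambda>x. k (snd x)) \<in> borel_measurable ?N" using km by measurable
    show ?thesis unfolding G_def flux_def case_prod_beta' using 1 2 3 4 by measurable
  qed
  have Gb: "norm (G \<tau> \<xi>) \<le> indicator {0..t} \<tau> * (C * (\<bar>\<xi>\<bar> * decay \<xi>))" for \<tau> \<xi>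
  proof (cases "\<tau> \<in> {0..t}")
    case True
    have c: "norm (conv (w \<tau>) (w \<tau>) \<xi>) \<le> 16 * decay_mass * a * a * decay \<xi>"
      using True t by (intro conv_traj_le[OF w w a a]) auto
    have "norm (flux \<tau> \<xi>) = \<bar>\<xi>\<bar> * (norm (conv (w \<tau>) (w \<tau>) \<xi>) / (2 * pi))"
      by (simp add: flux_def norm_mult norm_divide)
    also have "\<dots> \<le> \<bar>\<xi>\<bar> * (16 * decay_mass * a * a * decay \<xi> / (2 * pi))"
      by (intro mult_left_mono divide_right_mono c) auto
    finally have "norm ((E (t - \<tau>) \<xi> * flux \<tau> \<xi>) * k \<xi>) \<le> (M0 * (\<bar>\<xi>\<bar> * (16 * decay_mass * a * a * decay \<xi> / (2 * pi)))) * N"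
      unfolding norm_mult[of _ "k \<xi>"] norm_mult[of "E (t - \<tau>) \<xi>"]
      using True t M0_pos a decay_mass_nonneg by (intro mult_mono kN E_le_M0) auto
    then show ?thesis using True by (simp add: G_def C_def mult_ac)
  qed (simp add: G_def)
  note Gi = integrable_slab[OF t(1) integrable_mult_right[OF integrable_abs_decay] Gm Gb]
  show "integrable lborel (\<lambda>\<tau>. indicator {0..t} \<tau> *\<^sub>R freq_dist (\<lambda>\<xi>. E (t - \<tau>) \<xi> * flux \<tau> \<xi>) \<psi>)"
    unfolding inner using lborel_pair.integrable_fst[OF Gi] by simp
  have "(LBINT \<tau>. LBINT \<xi>. G \<tau> \<xi>) = (LBINT \<xi>. LBINT \<tau>. G \<tau> \<xi>)"
    by (rule lborel_pair.Fubini_integral[OF Gi, symmetric])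
  also have "\<dots> = (LBINT \<xi>. duhamel w w t \<xi> * k \<xi>)"
  proof (rule Bochner_Integration.integral_cong[OF refl])
    fix \<xi>
    have "(LBINT \<tau>. G \<tau> \<xi>) = (LBINT \<tau>. ((\<i> * of_real \<xi> / of_real (2 * pi)) * k \<xi>) * (integrand w w t \<xi> \<tau>))"
      by (intro Bochner_Integration.integral_cong refl) (simp add: G_def flux_def mult_ac)
    also have "\<dots> = ((\<i> * of_real \<xi> / of_real (2 * pi)) * k \<xi>) * (LBINT \<tau>. integrand w w t \<xi> \<tau>)"
      by (rule integral_mult_right_zero)
    also have "\<dots> = duhamel w w t \<xi> * k \<xi>" unfolding duhamel_def by (simp only: mult_ac)
    finally show "(LBINT \<tau>. G \<tau> \<xi>) = duhamel w w t \<xi> * k \<xi>" .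
  qed
  also have "\<dots> = freq_dist (duhamel w w t) \<psi>"
  proof -
    have "integrable lborel (duhamel w w t)"
      using t by (intro integrable_of_decay(1)[OF traj_slice_borel[OF duhamel_traj[OF w w a a]] traj_le[OF duhamel_traj[OF w w a a]]])
    from freq_dist_apply[OF this \<psi>] show ?thesis by (simp add: k_def)
  qed
  finally show "(LBINT \<tau>. indicator {0..t} \<tau> *\<^sub>R freq_dist (\<lambda>\<xi>. E (t - \<tau>) \<xi> * flux \<tau> \<xi>) \<psi>) = freq_dist (duhamel w w t) \<psi>"
    unfolding inner .
qed

text \<open>
  A fixed point of the Picard map on the Fourier side is a solution of the
  integral equation for distributions.
\<close>

lemma freq_curve_is_solution:
  "is_solution \<eta> \<Phi>' s T (freq_dist h) (\<lambda>t. if t \<in> {0..T} then freq_dist (w t) else 0)" (is "is_solution _ _ _ _ _ ?v")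
  unfolding is_solution_def
proof (intro conjI ballI)
  show "?v \<in> car (C_sobolev T s)" by (rule curve_in_C_sobolev)
  have "is_L2 (?v t)" if "t \<in> {0..T}" for t
  proof -
    have b: "norm (w t \<xi>) \<le> a" for \<xi>
      using traj_le[OF w, of t \<xi>] mult_left_mono[OF decay_le_1[of \<xi>] a] that by simp
    show ?thesis using is_L2_freq_dist[OF w_integrable b] that by simp
  qed
  then show "AE t in lebesgue. t \<in> {0..T} \<longrightarrow> is_L2 (?v t)" by simp
next
  fix t \<psi> assume t: "t \<in> {0..T}" and \<psi>: "\<psi> \<in> schwartz"
  have t': "0 \<le> t" "t \<le> T" using t by auto
  let ?R = "\<lambda>\<tau>. propagator \<eta> \<Phi>' (t - \<tau>) (dist_deriv (dist_square (?v \<tau>))) \<psi>"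
  let ?S = "\<lambda>\<tau>. indicator {0..t} \<tau> *\<^sub>R freq_dist (\<lambda>\<xi>. E (t - \<tau>) \<xi> * flux \<tau> \<xi>) \<psi>"
  have RS: "(\<lambda>\<tau>. indicator {0..t} \<tau> *\<^sub>R ?R \<tau>) = ?S"
  proof
    fix \<tau>
    show "indicator {0..t} \<tau> *\<^sub>R ?R \<tau> = ?S \<tau>"
      using nonlinear_term[of \<tau> t] t' by (cases "\<tau> \<in> {0..t}") auto
  qed
  have iS: "integrable lborel ?S" by (rule duhamel_pairing(1)[OF t' \<psi>])
  have mS: "?S \<in> borel_measurable lborel" using iS by (rule borel_measurable_integrable)
  show "set_integrable lebesgue {0..t} ?R"
    unfolding set_integrable_def RS using iS integrable_completion[OF mS] by simp
  have hi: "integrable lborel h" by (rule integrable_of_decay(1)[OF hb h_le])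
  note Eh = E_times_integrable[OF t' hi]
  have di: "integrable lborel (duhamel w w t)"
    using t' by (intro integrable_of_decay(1)[OF traj_slice_borel[OF duhamel_traj[OF w w a a]] traj_le[OF duhamel_traj[OF w w a a]]])
  have "w t = (\<lambda>\<xi>. E t \<xi> * h \<xi> - duhamel w w t \<xi>)" using fixpt[OF t'] by blast
  then have "freq_dist (w t) = freq_dist (\<lambda>\<xi>. E t \<xi> * h \<xi>) - freq_dist (duhamel w w t)"
    using freq_dist_diff[OF Eh di] by simp
  moreover have "(LINT \<tau>:{0..t}|lebesgue. ?R \<tau>) = freq_dist (duhamel w w t) \<psi>"
    unfolding set_lebesgue_integral_def RS integral_completion[OF mS] by (rule duhamel_pairing(2)[OF t' \<psi>])
  ultimately show "?v t \<psi> = propagator \<eta> \<Phi>' t (freq_dist h) \<psi> - (LINT \<tau>:{0..t}|lebesgue. ?R \<tau>)"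
    using t by (simp add: propagator_freq_dist[OF ae hi Eh])
qed

end

section \<open>Second order expansion of the flow\<close>

abbreviation free where "free h \<equiv> (\<lambda>t \<xi>. E t \<xi> * h \<xi>)"

lemma duhamel_scale: "duhamel (\<lambda>t \<xi>. c * u t \<xi>) (\<lambda>t \<xi>. c * u t \<xi>) t \<xi> = c\<^sup>2 * duhamel u u t \<xi>"
proof -
  have 1: "conv (\<lambda>\<xi>. c * u \<tau> \<xi>) (\<lambda>\<xi>. c * u \<tau> \<xi>) \<xi> = c\<^sup>2 * conv (u \<tau>) (u \<tau>) \<xi>" for \<tau>
    unfolding conv_def integral_mult_right_zero[symmetric] by (simp add: power2_eq_square mult_ac)
  have "(LBINT \<tau>. indicator {0..t} \<tau> *\<^sub>R (E (t - \<tau>) \<xi> * (c\<^sup>2 * conv (u \<tau>) (u \<tau>) \<xi>)))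
      = c\<^sup>2 * (LBINT \<tau>. integrand u u t \<xi> \<tau>)"
    unfolding integral_mult_right_zero[symmetric] by (simp add: mult.left_commute)
  then show ?thesis unfolding duhamel_def 1 by (simp only: mult_ac)
qed

text \<open>
  By uniqueness \<open>f\<close> is the Picard solution \<open>w = u - duhamel w w\<close>. The difference \<open>w - u\<close> is
  quadratic in the size of the data, so replacing \<open>w\<close> by the free solution \<open>u\<close> in the Duhamel
  term costs a cubic error.
\<close>

lemma flow_expansion:
  fixes h :: "real \<Rightarrow> complex"
  assumes ae: "AE \<xi> in lebesgue. \<Phi>' \<xi> = \<Phi> \<xi>" and s: "s \<le> 0"
    and kappa: "\<kappa> \<in> borel_measurable borel" and kappa_le: "\<And>\<xi>. norm (\<kappa> \<xi>) \<le> M * indicator {0..1} \<xi>"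
    and h: "h \<in> borel_measurable borel" and h_le: "\<And>\<xi>. norm (h \<xi>) \<le> b * decay \<xi>" and b: "0 \<le> b"
    and \<rho>: "8 * K0 * (M0 * b) \<le> 1"
    and uniq: "\<And>v. is_solution \<eta> \<Phi>' s T (freq_dist h) v \<Longrightarrow> v = f"
  defines "u \<equiv> \<lambda>t \<xi>. E t \<xi> * h \<xi>"
  shows "norm (freq_pairing \<kappa> (f T) - (LBINT \<xi>. \<kappa> \<xi> * u T \<xi>) + (LBINT \<xi>. \<kappa> \<xi> * duhamel u u T \<xi>))
    \<le> (M * 12 * K0\<^sup>2 * decay_mass) * (M0 * b) ^ 3"
proof -
  define r where "r = M0 * b"
  have r: "0 \<le> r" "8 * K0 * r \<le> 1" using b M0_pos \<rho> by (auto simp: r_def)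
  have r2: "0 \<le> 2 * r" using r by simp
  have ut: "traj r u" unfolding u_def r_def by (rule traj_free[OF h h_le])
  from picard_fixpoint[OF ut r] obtain w where wt: "traj (2 * r) w"
    and fixpt: "\<And>t \<xi>. 0 \<le> t \<Longrightarrow> t \<le> T \<Longrightarrow> w t \<xi> = u t \<xi> - duhamel w w t \<xi>" by auto
  have "is_solution \<eta> \<Phi>' s T (freq_dist h) (\<lambda>t. if t \<in> {0..T} then freq_dist (w t) else 0)"
    by (rule freq_curve_is_solution[OF ae s r2 h h_le wt fixpt[unfolded u_def]])
  then have "f T = freq_dist (w T)" using uniq[symmetric] T by auto
  moreover have TT: "0 \<le> T" "T \<le> T" using T by auto
  have iw: "integrable lborel (w T)"
    by (rule integrable_of_decay(1)[OF traj_slice_borel[OF wt] traj_le[OF wt TT]])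
  ultimately have fT: "freq_pairing \<kappa> (f T) = (LBINT \<xi>. \<kappa> \<xi> * w T \<xi>)"
    using freq_pairing_freq_dist[OF kappa kappa_le s] by simp
  note kM = kappa_le_M[OF kappa kappa_le s]
  have ik: "integrable lborel (\<lambda>\<xi>. \<kappa> \<xi> * z T \<xi>)" if "traj a z" for a z
    by (rule integrable_bounded_times(1)[OF kappa kM integrable_of_decay(1)[OF traj_slice_borel[OF that] traj_le[OF that TT]]])
  have dw: "traj (K0 * (2 * r) * (2 * r)) (\<lambda>t \<xi>. w t \<xi> - u t \<xi>)"
    unfolding traj_def
  proof (intro conjI ballI allI)
    show "(\<lambda>(t, \<xi>). w t \<xi> - u t \<xi>) \<in> borel_measurable (borel \<Otimes>\<^sub>M borel)"
      using traj_diff[OF wt ut] by (simp add: traj_def)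
    show "norm (w t \<xi> - u t \<xi>) \<le> K0 * (2 * r) * (2 * r) * decay \<xi>" if "t \<in> {0..T}" for t \<xi>
      using duhamel_le[OF wt wt r2 r2, of t \<xi>] that fixpt[of t \<xi>] by simp
  qed
  have rem: "norm (duhamel w w T \<xi> - duhamel u u T \<xi>) \<le> 12 * K0\<^sup>2 * r ^ 3 * decay \<xi>" for \<xi>
  proof -
    have "norm (duhamel w w T \<xi> - duhamel u u T \<xi>) \<le> K0 * (K0 * (2 * r) * (2 * r)) * (2 * r + r) * decay \<xi>"
      using K0_nonneg r by (intro duhamel_diff_le[OF wt ut dw _ _ _ TT]) auto
    then show ?thesis by (simp add: power2_eq_square power3_eq_cube algebra_simps)
  qed
  have it: "integrable lborel (\<lambda>\<xi>. \<kappa> \<xi> * w T \<xi>)" "integrable lborel (\<lambda>\<xi>. \<kappa> \<xi> * u T \<xi>)" "integrable lborel (\<lambda>\<xi>. \<kappa> \<xi> * duhamel u u T \<xi>)"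
    using ik[OF wt] ik[OF ut] ik[OF duhamel_traj[OF ut ut r(1) r(1)]] by auto
  have eq1: "freq_pairing \<kappa> (f T) - (LBINT \<xi>. \<kappa> \<xi> * u T \<xi>) + (LBINT \<xi>. \<kappa> \<xi> * duhamel u u T \<xi>)
      = (LBINT \<xi>. \<kappa> \<xi> * w T \<xi> - \<kappa> \<xi> * u T \<xi> + \<kappa> \<xi> * duhamel u u T \<xi>)"
    unfolding fT using it by simp
  have eq2: "(LBINT \<xi>. \<kappa> \<xi> * w T \<xi> - \<kappa> \<xi> * u T \<xi> + \<kappa> \<xi> * duhamel u u T \<xi>) = (LBINT \<xi>. - (\<kappa> \<xi> * (duhamel w w T \<xi> - duhamel u u T \<xi>)))"
    by (intro Bochner_Integration.integral_cong refl) (simp add: fixpt[OF TT] algebra_simps)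
  have "norm (LBINT \<xi>. - (\<kappa> \<xi> * (duhamel w w T \<xi> - duhamel u u T \<xi>))) \<le> (LBINT \<xi>. M * (12 * K0\<^sup>2 * r ^ 3 * decay \<xi>))"
  proof (rule order_trans[OF integral_norm_bound], rule integral_mono)
    have "integrable lborel (\<lambda>\<xi>. \<kappa> \<xi> * (duhamel w w T \<xi> - duhamel u u T \<xi>))"
      using ik[OF traj_diff[OF duhamel_traj[OF wt wt r2 r2] duhamel_traj[OF ut ut r(1) r(1)]]] .
    then show "integrable lborel (\<lambda>\<xi>. norm (- (\<kappa> \<xi> * (duhamel w w T \<xi> - duhamel u u T \<xi>))))" by simp
    show "integrable lborel (\<lambda>\<xi>. M * (12 * K0\<^sup>2 * r ^ 3 * decay \<xi>))" by (intro integrable_mult_right integrable_decay)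
    show "norm (- (\<kappa> \<xi> * (duhamel w w T \<xi> - duhamel u u T \<xi>))) \<le> M * (12 * K0\<^sup>2 * r ^ 3 * decay \<xi>)" for \<xi>
      unfolding norm_minus_cancel norm_mult
      using order_trans[OF norm_ge_zero kM] by (intro mult_mono kM rem) auto
  qed
  also have "\<dots> = M * (12 * K0\<^sup>2 * r ^ 3 * decay_mass)"
    unfolding decay_mass_def integral_mult_right_zero by (rule refl)
  also have "\<dots> = (M * 12 * K0\<^sup>2 * decay_mass) * r ^ 3" by (simp only: mult_ac)
  finally show ?thesis unfolding eq1 eq2 r_def .
qed

text \<open>
  For the data \<open>\<theta> h\<close> and \<open>- \<theta> h\<close> the linear terms of the expansion cancel and
  the quadratic terms add up. Division by \<open>\<theta>\<^sup>2\<close> leaves an error of order \<open>\<theta>\<close>, which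
  disappears in the limit, so the bound does not depend on the size \<open>b\<close> of \<open>h\<close>.
\<close>

lemma second_iterate_bound:
  fixes h :: "real \<Rightarrow> complex"
  assumes ae: "AE \<xi> in lebesgue. \<Phi>' \<xi> = \<Phi> \<xi>" and s: "s \<le> 0"
    and kappa: "\<kappa> \<in> borel_measurable borel" and kappa_le: "\<And>\<xi>. norm (\<kappa> \<xi>) \<le> M * indicator {0..1} \<xi>"
    and h: "h \<in> borel_measurable borel" and h_le: "\<And>\<xi>. norm (h \<xi>) \<le> b * decay \<xi>" and b: "0 \<le> b"
    and r: "0 < r"
    and uniq: "\<And>v0 v. v0 \<in> car (sobolev s) \<Longrightarrow> nrm (sobolev s) v0 < r \<Longrightarrow> is_solution \<eta> \<Phi>' s T v0 v \<Longrightarrow> v = F v0"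
    and d: "0 < d" and K: "\<And>\<theta>. 0 < \<theta> \<Longrightarrow> \<theta> < d \<Longrightarrow>
      norm (pairing_difference \<kappa> F T (freq_dist h) \<theta>) \<le> K * \<theta>\<^sup>2"
  shows "2 * norm (LBINT \<xi>. \<kappa> \<xi> * duhamel (free h) (free h) T \<xi>) \<le> K"
proof -
  have hi: "integrable lborel h" by (rule integrable_of_decay(1)[OF h h_le])
  have hc: "freq_dist h \<in> car (sobolev s)"
    by (rule freq_dist_sobolev(1)[OF hi integrable_weight_decay[OF s h h_le]])
  define n where "n = nrm (sobolev s) (freq_dist h)"
  have n: "0 \<le> n" by (simp add: n_def sobolev_nrm_nonneg)
  define L where "L \<theta> = freq_pairing \<kappa> (F (\<theta> *\<^sub>R freq_dist h) T)" for \<theta> :: real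
  define P1 where "P1 = (LBINT \<xi>. \<kappa> \<xi> * (E T \<xi> * h \<xi>))"
  define P2 where "P2 = (LBINT \<xi>. \<kappa> \<xi> * duhamel (free h) (free h) T \<xi>)"
  define C where "C = (M * 12 * K0\<^sup>2 * decay_mass) * (M0 * b) ^ 3"
  \<comment> \<open>Below \<open>e\<close> the data lie in the ball where the flow is known, and the Picard map is a contraction.\<close>
  define e where "e = min d (min (r / (n + 1)) (1 / (8 * K0 * (M0 * b) + 1)))"
  have pos: "0 < r / (n + 1)" "0 < 1 / (8 * K0 * (M0 * b) + 1)"
    using n r K0_nonneg M0_pos b by (auto intro!: divide_pos_pos add_nonneg_pos)
  have e: "0 < e" "e \<le> d" "e \<le> r / (n + 1)" "e \<le> 1 / (8 * K0 * (M0 * b) + 1)" using d pos by (auto simp: e_def)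
  have exp: "norm (L \<theta> - \<theta> *\<^sub>R P1 + \<theta>\<^sup>2 *\<^sub>R P2) \<le> C * \<bar>\<theta>\<bar> ^ 3" if \<theta>: "\<bar>\<theta>\<bar> < e" for \<theta> :: real
  proof -
    let ?h = "\<lambda>\<xi>. of_real \<theta> * h \<xi>"
    have sc: "\<theta> *\<^sub>R freq_dist h = freq_dist ?h" by (rule freq_dist_scaleR[OF hi])
    have "nrm (sobolev s) (\<theta> *\<^sub>R freq_dist h) = \<bar>\<theta>\<bar> * n" by (simp add: sobolev_scaleR(3)[OF hc] n_def)
    also have "\<dots> \<le> \<bar>\<theta>\<bar> * (n + 1)" by (intro mult_left_mono) auto
    also have "\<dots> < r"
    proof -
      have "\<bar>\<theta>\<bar> < r / (n + 1)" using \<theta> e(3) by linarith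
      moreover have "0 < n + 1" using n by simp
      ultimately show ?thesis by (simp only: pos_less_divide_eq)
    qed
    finally have small: "nrm (sobolev s) (\<theta> *\<^sub>R freq_dist h) < r" .
    have "8 * K0 * (M0 * (\<bar>\<theta>\<bar> * b)) = \<bar>\<theta>\<bar> * (8 * K0 * (M0 * b))" by simp
    also have "\<dots> \<le> (1 / (8 * K0 * (M0 * b) + 1)) * (8 * K0 * (M0 * b))"
      using \<theta> e(4) K0_nonneg M0_pos b by (intro mult_right_mono) auto
    also have "\<dots> \<le> 1"
    proof -
      have "(1 / (x + 1)) * x \<le> 1" if "0 \<le> x" for x :: real using that by (simp add: divide_le_eq)
      from this[of "8 * K0 * (M0 * b)"] show ?thesis using K0_nonneg M0_pos b by simp
    qed
    finally have q: "8 * K0 * (M0 * (\<bar>\<theta>\<bar> * b)) \<le> 1" .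
    have hm: "?h \<in> borel_measurable borel" using h by measurable
    have hb: "norm (?h \<xi>) \<le> (\<bar>\<theta>\<bar> * b) * decay \<xi>" for \<xi>
      using mult_left_mono[OF h_le[of \<xi>], of "\<bar>\<theta>\<bar>"] by (simp add: norm_mult mult.assoc)
    have c: "(free ?h) = (\<lambda>t \<xi>. of_real \<theta> * (E t \<xi> * h \<xi>))" by (simp add: mult.left_commute)
    have "norm (freq_pairing \<kappa> (F (\<theta> *\<^sub>R freq_dist h) T) - (LBINT \<xi>. \<kappa> \<xi> * (E T \<xi> * ?h \<xi>))
        + (LBINT \<xi>. \<kappa> \<xi> * duhamel (free ?h) (free ?h) T \<xi>))
        \<le> (M * 12 * K0\<^sup>2 * decay_mass) * (M0 * (\<bar>\<theta>\<bar> * b)) ^ 3"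
    proof (rule flow_expansion[OF ae s kappa kappa_le hm hb _ q])
      show "v = F (\<theta> *\<^sub>R freq_dist h)" if "is_solution \<eta> \<Phi>' s T (freq_dist ?h) v" for v
        using uniq[OF sobolev_scaleR(1)[OF hc] small] that unfolding sc by blast
    qed (use b in simp)
    moreover have "(LBINT \<xi>. \<kappa> \<xi> * (E T \<xi> * ?h \<xi>)) = \<theta> *\<^sub>R P1"
      unfolding P1_def integral_scaleR_right[symmetric] by (simp add: scaleR_conv_of_real mult_ac)
    moreover have "(LBINT \<xi>. \<kappa> \<xi> * duhamel (free ?h) (free ?h) T \<xi>) = \<theta>\<^sup>2 *\<^sub>R P2"
      unfolding P2_def integral_scaleR_right[symmetric] c duhamel_scale by (simp add: scaleR_conv_of_real mult_ac)
    ultimately show ?thesis by (simp add: L_def C_def power_mult_distrib mult_ac)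
  qed
  have "2 * norm P2 \<le> K + 2 * C * \<theta>" if \<theta>: "0 < \<theta>" "\<theta> < e" for \<theta>
  proof -
    have L0: "L 0 = 0" using exp[of 0] e by simp
    have "norm (L \<theta> + L (- \<theta>) - 2 * L 0) \<le> K * \<theta>\<^sup>2"
      using K[of \<theta>] \<theta> e unfolding L_def by simp
    then have 1: "norm (L \<theta> + L (- \<theta>)) \<le> K * \<theta>\<^sup>2" by (simp add: L0)
    have "(2 * \<theta>\<^sup>2) *\<^sub>R P2 = (L \<theta> - \<theta> *\<^sub>R P1 + \<theta>\<^sup>2 *\<^sub>R P2) + (L (- \<theta>) - (- \<theta>) *\<^sub>R P1 + (- \<theta>)\<^sup>2 *\<^sub>R P2) - (L \<theta> + L (- \<theta>))"
      by (simp add: scaleR_conv_of_real algebra_simps)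
    also have "norm \<dots> \<le> C * \<bar>\<theta>\<bar> ^ 3 + C * \<bar>- \<theta>\<bar> ^ 3 + K * \<theta>\<^sup>2"
      using exp[of \<theta>] exp[of "- \<theta>"] 1 \<theta>
      by (intro order_trans[OF norm_triangle_ineq4 add_mono] order_trans[OF norm_triangle_ineq add_mono]) auto
    finally have "\<theta>\<^sup>2 * (2 * norm P2) \<le> \<theta>\<^sup>2 * (K + 2 * C * \<theta>)"
      using \<theta> by (simp add: power3_eq_cube power2_eq_square algebra_simps)
    then show ?thesis using \<theta> by simp
  qed
  then have ev: "\<forall>\<^sub>F \<theta> in at_right 0. 2 * norm P2 \<le> K + 2 * C * \<theta>"
    using e(1) unfolding eventually_at_right_field by blast
  have "((\<lambda>\<theta>. K + 2 * C * \<theta>) \<longlongrightarrow> K + 2 * C * 0) (at_right 0)"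
    by (intro tendsto_intros)
  then have "2 * norm P2 \<le> K + 2 * C * 0"
    by (rule tendsto_lowerbound[OF _ ev]) simp
  then show ?thesis by (simp add: P2_def)
qed

end

section \<open>Interaction of opposite high frequencies\<close>

text \<open>
  The integral equals \<open>(1 - exp (T z)) / (- z)\<close>. The real part of \<open>1 / (- z)\<close> is
  \<open>- Re z / \<bar>z\<bar>\<^sup>2\<close>, which is comparable to \<open>1 / X\<close>, and the exponential is negligible.
\<close>

lemma exp_integral_lower:
  fixes z :: complex
  assumes T: "0 < T" and X: "0 < X" and B: "0 < B1" "0 < B2"
    and re: "B1 * X \<le> - Re z" and nz: "norm z \<le> B2 * X"
    and small: "exp (- T * B1 * X) * B2 \<le> B1 / 2"
  shows "integrable lborel (\<lambda>\<tau>. indicator {0..T} \<tau> *\<^sub>R exp (of_real \<tau> * z))"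
    and "B1 / (2 * B2\<^sup>2) / X \<le> Re (LBINT \<tau>. indicator {0..T} \<tau> *\<^sub>R exp (of_real \<tau> * z))"
proof -
  have z0: "z \<noteq> 0" using re B X by (auto simp: mult_le_0_iff)
  define G where "G \<tau> = exp (of_real \<tau> * z) / z" for \<tau> :: real
  have d: "(G has_vector_derivative exp (of_real \<tau> * z)) (at \<tau> within {0..T})" for \<tau>
  proof -
    have "((\<lambda>w. exp (w * z) / z) has_field_derivative exp (of_real \<tau> * z)) (at (of_real \<tau>))"
      using z0 by (auto intro!: derivative_eq_intros)
    from has_vector_derivative_real_field[OF this] show ?thesis
      unfolding G_def[abs_def] by (rule has_vector_derivative_at_within)
  qed
  have c: "continuous_on {0..T} (\<lambda>\<tau>. exp (of_real \<tau> * z))" by (intro continuous_intros)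
  have hb: "has_bochner_integral lborel (\<lambda>\<tau>. indicator {0..T} \<tau> *\<^sub>R exp (of_real \<tau> * z)) (G T - G 0)"
    using has_bochner_integral_FTC_Icc[of 0 T G "\<lambda>\<tau>. exp (of_real \<tau> * z)"] T d c by simp
  then show "integrable lborel (\<lambda>\<tau>. indicator {0..T} \<tau> *\<^sub>R exp (of_real \<tau> * z))"
    by (simp add: has_bochner_integral_iff)
  have n0: "0 < norm z" using z0 by simp
  have "Re (G T - G 0) = Re ((1 - exp (of_real T * z)) / (- z))"
    by (simp add: G_def diff_divide_distrib)
  also have "\<dots> = Re ((1 - exp (of_real T * z)) * cnj (- z)) / (norm z)\<^sup>2"
    by (simp only: complex_div_cnj[of _ "- z"] norm_minus_cancel of_real_power[symmetric] Re_divide_of_real)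
  also have "Re ((1 - exp (of_real T * z)) * cnj (- z)) = - Re z + Re (exp (of_real T * z) * cnj z)"
    by (simp add: algebra_simps)
  finally have eq: "Re (G T - G 0) = (- Re z + Re (exp (of_real T * z) * cnj z)) / (norm z)\<^sup>2" .
  have "- Re z - norm (exp (of_real T * z) * cnj z) \<le> - Re z + Re (exp (of_real T * z) * cnj z)"
    using abs_Re_le_cmod[of "exp (of_real T * z) * cnj z"] unfolding abs_le_iff by linarith
  then have 1: "(- Re z - norm (exp (of_real T * z) * cnj z)) / (norm z)\<^sup>2 \<le> Re (G T - G 0)"
    unfolding eq by (rule divide_right_mono) simp
  have "norm (exp (of_real T * z)) \<le> exp (- T * B1 * X)"
    using mult_left_mono[OF re, of T] T by (simp add: norm_exp_eq_Re mult.assoc)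
  then have "norm (exp (of_real T * z) * cnj z) \<le> exp (- T * B1 * X) * (B2 * X)"
    unfolding norm_mult using nz by (intro mult_mono) auto
  also have "\<dots> \<le> (B1 / 2) * X" using mult_right_mono[OF small, of X] X by (simp add: mult.assoc)
  finally have 2: "(B1 / 2) * X \<le> - Re z - norm (exp (of_real T * z) * cnj z)" using re by simp
  have "B1 / (2 * B2\<^sup>2) / X = ((B1 / 2) * X) / (B2 * X)\<^sup>2"
    using X by (simp add: power2_eq_square)
  also have "\<dots> \<le> ((B1 / 2) * X) / (norm z)\<^sup>2"
    using n0 nz B X by (intro divide_left_mono power_mono) auto
  also have "\<dots> \<le> (- Re z - norm (exp (of_real T * z) * cnj z)) / (norm z)\<^sup>2"
    by (intro divide_right_mono 2) simp
  finally have "B1 / (2 * B2\<^sup>2) / X \<le> Re (G T - G 0)" using 1 by linarith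
  then show "B1 / (2 * B2\<^sup>2) / X \<le> Re (LBINT \<tau>. indicator {0..T} \<tau> *\<^sub>R exp (of_real \<tau> * z))"
    using hb by (simp add: has_bochner_integral_iff)
qed

context dissipative_symbol begin

text \<open>
  The rate at which the interaction of \<open>\<zeta>\<close> and \<open>\<xi> - \<zeta>\<close>, pulled back by the
  propagator at the frequency \<open>\<xi>\<close>, evolves in time.
\<close>

definition phase :: "real \<Rightarrow> real \<Rightarrow> complex"
  where "phase \<xi> \<zeta> = Complex (\<eta> * (\<Phi> \<zeta> + \<Phi> (\<xi> - \<zeta>) - \<Phi> \<xi>)) (\<zeta> ^ 3 + (\<xi> - \<zeta>) ^ 3 - \<xi> ^ 3)"

abbreviation osc where "osc \<xi> \<zeta> \<equiv> (LBINT \<tau>. indicator {0..T} \<tau> *\<^sub>R exp (of_real \<tau> * phase \<xi> \<zeta>))"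

lemma E_phase: "E (- \<tau>) \<xi> * (E \<tau> \<zeta> * E \<tau> (\<xi> - \<zeta>)) = exp (of_real \<tau> * phase \<xi> \<zeta>)"
proof -
  have E: "E t x = exp (of_real t * Complex (\<eta> * \<Phi> x) (x ^ 3))" for t x
  proof -
    have "of_real t * Complex (\<eta> * \<Phi> x) (x ^ 3) = \<i> * of_real (t * x ^ 3) + of_real (\<eta> * t * \<Phi> x)"
      by (simp add: complex_eq_iff)
    then show ?thesis by (simp only: E_multiplier)
  qed
  show ?thesis unfolding E exp_add[symmetric]
    by (rule arg_cong[of _ _ exp]) (simp add: phase_def complex_eq_iff algebra_simps)
qed

text \<open>
  The factor \<open>- i E (- T) \<xi>\<close> compensates the factor \<open>i \<xi> E T \<xi>\<close> of the Duhamel term, so that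
  the real part of the pairing can be bounded below.
\<close>

definition band :: "real \<Rightarrow> complex"
  where "band \<xi> = - \<i> * indicator {1/4..3/4} \<xi> * E (- T) \<xi>"

lemma band_borel: "band \<in> borel_measurable borel"
proof -
  have "(\<lambda>\<xi>. E (- T) \<xi>) \<in> borel_measurable borel" by (intro E_borel) auto
  then show ?thesis unfolding band_def[abs_def] by measurable
qed

lemma band_duh:
  "band \<xi> * duhamel u u T \<xi> = indicator {1/4..3/4} \<xi> * (of_real (\<xi> / (2 * pi)) *
    (LBINT \<tau>. indicator {0..T} \<tau> *\<^sub>R (E (- \<tau>) \<xi> * conv (u \<tau>) (u \<tau>) \<xi>)))"
proof -
  have "E (- T) \<xi> * (LBINT \<tau>. indicator {0..T} \<tau> *\<^sub>R (E (T - \<tau>) \<xi> * conv (u \<tau>) (u \<tau>) \<xi>))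
      = (LBINT \<tau>. indicator {0..T} \<tau> *\<^sub>R (E (- \<tau>) \<xi> * conv (u \<tau>) (u \<tau>) \<xi>))"
    unfolding integral_mult_right_zero[symmetric]
  proof (rule Bochner_Integration.integral_cong[OF refl])
    fix \<tau>
    have "E (- T) \<xi> * E (T - \<tau>) \<xi> = E (- \<tau>) \<xi>" unfolding E_add[symmetric] by simp
    then show "E (- T) \<xi> * (indicator {0..T} \<tau> *\<^sub>R (E (T - \<tau>) \<xi> * conv (u \<tau>) (u \<tau>) \<xi>))
      = indicator {0..T} \<tau> *\<^sub>R (E (- \<tau>) \<xi> * conv (u \<tau>) (u \<tau>) \<xi>)"
      by (simp add: mult.assoc[symmetric])
  qed
  then show ?thesis unfolding band_def duhamel_def by (simp add: mult_ac)
qed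

text \<open>
  Integrating in time first exhibits the gain \<open>osc\<close> for each pair of interacting
  frequencies.
\<close>

lemma time_integral_swap:
  fixes h :: "real \<Rightarrow> complex"
  assumes h: "h \<in> borel_measurable borel" and h_le: "\<And>\<xi>. norm (h \<xi>) \<le> b * decay \<xi>" and b: "0 \<le> b"
  defines "u \<equiv> \<lambda>t \<xi>. E t \<xi> * h \<xi>"
  shows "(LBINT \<tau>. indicator {0..T} \<tau> *\<^sub>R (E (- \<tau>) \<xi> * conv (u \<tau>) (u \<tau>) \<xi>))
      = (LBINT \<zeta>. h \<zeta> * h (\<xi> - \<zeta>) * (osc \<xi> \<zeta>))"
    and "integrable lborel (\<lambda>\<zeta>. h \<zeta> * h (\<xi> - \<zeta>) * (osc \<xi> \<zeta>))"
proof -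
  define G where "G \<tau> \<zeta> = indicator {0..T} \<tau> *\<^sub>R (E (- \<tau>) \<xi> * ((E \<tau> \<zeta> * h \<zeta>) * (E \<tau> (\<xi> - \<zeta>) * h (\<xi> - \<zeta>))))" for \<tau> \<zeta>
  have Ge: "G \<tau> \<zeta> = (h \<zeta> * h (\<xi> - \<zeta>)) * (indicator {0..T} \<tau> *\<^sub>R exp (of_real \<tau> * phase \<xi> \<zeta>))" for \<tau> \<zeta>
    unfolding G_def E_phase[symmetric] by (simp add: mult_ac)
  define Q where "Q = exp (\<eta> * T * \<bar>\<Phi> \<xi>\<bar>)"
  have EQ: "norm (E (- \<tau>) \<xi>) \<le> Q" if "\<tau> \<in> {0..T}" for \<tau>
    unfolding Q_def using that by (intro E_backward_le) auto
  have hb: "norm (h x) \<le> b" for x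
    using h_le[of x] mult_left_mono[OF decay_le_1[of x] b] by simp
  let ?N = "lborel \<Otimes>\<^sub>M lborel :: (real \<times> real) measure"
  have Gm: "(\<lambda>(\<tau>, \<zeta>). G \<tau> \<zeta>) \<in> borel_measurable ?N"
  proof -
    have 1: "(\<lambda>x. indicator {0..T} (fst x) :: real) \<in> borel_measurable ?N" by (rule indicator_Icc_borel) measurable
    have 2: "(\<lambda>x. E (- fst x) \<xi>) \<in> borel_measurable ?N" by (rule E_borel) measurable
    have 3: "(\<lambda>x. E (fst x) (snd x)) \<in> borel_measurable ?N" by (rule E_borel) measurable
    have 4: "(\<lambda>x. E (fst x) (\<xi> - snd x)) \<in> borel_measurable ?N" by (rule E_borel) measurable
    have 5: "(\<lambda>x. h (snd x)) \<in> borel_measurable ?N" "(\<lambda>x. h (\<xi> - snd x)) \<in> borel_measurable ?N" using h by measurable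
    show ?thesis unfolding G_def case_prod_beta' using 1 2 3 4 5 by measurable
  qed
  define R where "R = Q * (M0 * b) * (M0 * b)"
  have Gb: "norm (G \<tau> \<zeta>) \<le> indicator {0..T} \<tau> * (R * decay \<zeta>)" for \<tau> \<zeta>
  proof (cases "\<tau> \<in> {0..T}")
    case True
    have "norm (E (- \<tau>) \<xi> * ((E \<tau> \<zeta> * h \<zeta>) * (E \<tau> (\<xi> - \<zeta>) * h (\<xi> - \<zeta>)))) \<le> Q * ((M0 * (b * decay \<zeta>)) * (M0 * b))"
      unfolding norm_mult using True M0_pos b
      by (intro mult_mono EQ E_le_M0 h_le hb) (auto simp: Q_def)
    then show ?thesis using True by (simp add: G_def R_def mult_ac)
  qed (simp add: G_def)
  note Gi = integrable_slab[OF less_imp_le[OF T] integrable_mult_right[OF integrable_decay] Gm Gb]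
  have in1: "(LBINT \<zeta>. G \<tau> \<zeta>) = indicator {0..T} \<tau> *\<^sub>R (E (- \<tau>) \<xi> * conv (u \<tau>) (u \<tau>) \<xi>)" for \<tau>
    unfolding G_def u_def conv_def by simp
  have in2: "(LBINT \<tau>. G \<tau> \<zeta>) = h \<zeta> * h (\<xi> - \<zeta>) * (osc \<xi> \<zeta>)" for \<zeta>
    unfolding Ge by (rule integral_mult_right_zero)
  show "(LBINT \<tau>. indicator {0..T} \<tau> *\<^sub>R (E (- \<tau>) \<xi> * conv (u \<tau>) (u \<tau>) \<xi>))
      = (LBINT \<zeta>. h \<zeta> * h (\<xi> - \<zeta>) * (osc \<xi> \<zeta>))"
    unfolding in1[symmetric] in2[symmetric] by (rule lborel_pair.Fubini_integral[OF Gi, symmetric])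
  show "integrable lborel (\<lambda>\<zeta>. h \<zeta> * h (\<xi> - \<zeta>) * (osc \<xi> \<zeta>))"
    unfolding in2[symmetric] using lborel_pair.integrable_snd[OF Gi] by simp
qed

text \<open>
  All contributions have a nonnegative real part, so it is enough to count the pairs with
  \<open>\<zeta>\<close> in \<open>[N + 3/4, N + 1]\<close>; for these \<open>\<xi> - \<zeta>\<close> lies in the opposite half of the support.
\<close>

lemma second_iterate_lower:
  fixes H m c N :: real
  defines "h \<equiv> \<lambda>\<xi>. complex_of_real (H * indicator {x. N \<le> \<bar>x\<bar> \<and> \<bar>x\<bar> \<le> N + 1} \<xi>)"
  assumes H: "0 \<le> H" and h_le: "\<And>\<xi>. norm (h \<xi>) \<le> b * decay \<xi>" and b: "0 \<le> b" and N: "0 \<le> N"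
    and c: "0 \<le> c"
    and J: "\<And>\<xi> \<zeta>. \<xi> \<in> {1/4..3/4} \<Longrightarrow> N \<le> \<bar>\<zeta>\<bar> \<Longrightarrow> \<bar>\<zeta>\<bar> \<le> N + 1 \<Longrightarrow> N \<le> \<bar>\<xi> - \<zeta>\<bar> \<Longrightarrow> \<bar>\<xi> - \<zeta>\<bar> \<le> N + 1 \<Longrightarrow>
      c \<le> Re (osc \<xi> \<zeta>)"
    and band_le: "\<And>\<xi>. norm (band \<xi>) \<le> M * indicator {0..1} \<xi>"
  shows "c * H\<^sup>2 / (64 * pi) \<le> norm (LBINT \<xi>. band \<xi> * duhamel (free h) (free h) T \<xi>)"
proof -
  let ?S = "{x. N \<le> \<bar>x\<bar> \<and> \<bar>x\<bar> \<le> N + 1}"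
  let ?u = "free h"
  have Sm: "?S \<in> sets borel" by measurable
  have hm: "h \<in> borel_measurable borel" unfolding h_def using Sm by measurable
  \<comment> \<open>Frequencies \<open>\<zeta>\<close> with \<open>\<zeta>\<close> or \<open>\<xi> - \<zeta>\<close> outside the support contribute nothing.\<close>
  have inner: "c * H\<^sup>2 / 4 \<le> Re (LBINT \<zeta>. h \<zeta> * h (\<xi> - \<zeta>) * osc \<xi> \<zeta>)" if \<xi>: "\<xi> \<in> {1/4..3/4}" for \<xi>
  proof -
    note i = time_integral_swap(2)[OF hm h_le b, of \<xi>]
    have "c * H\<^sup>2 / 4 = (LBINT \<zeta>. (c * H\<^sup>2) * indicator {N + 3/4..N + 1} \<zeta>)" by simp
    also have "\<dots> \<le> (LBINT \<zeta>. Re (h \<zeta> * h (\<xi> - \<zeta>) * osc \<xi> \<zeta>))"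
    proof (rule integral_mono)
      show "integrable lborel (\<lambda>\<zeta>. (c * H\<^sup>2) * indicator {N + 3/4..N + 1} \<zeta>)"
        by (intro integrable_mult_right integrable_real_indicator) simp_all
      show "integrable lborel (\<lambda>\<zeta>. Re (h \<zeta> * h (\<xi> - \<zeta>) * osc \<xi> \<zeta>))" by (rule integrable_Re[OF i])
      fix \<zeta>
      show "(c * H\<^sup>2) * indicator {N + 3/4..N + 1} \<zeta> \<le> Re (h \<zeta> * h (\<xi> - \<zeta>) * osc \<xi> \<zeta>)"
      proof (cases "\<zeta> \<in> ?S \<and> \<xi> - \<zeta> \<in> ?S")
        case True
        have "h \<zeta> * h (\<xi> - \<zeta>) * osc \<xi> \<zeta> = of_real (H\<^sup>2) * osc \<xi> \<zeta>"
          using True by (simp add: h_def power2_eq_square)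
        then have "Re (h \<zeta> * h (\<xi> - \<zeta>) * osc \<xi> \<zeta>) = H\<^sup>2 * Re (osc \<xi> \<zeta>)"
          by (simp only: Re_complex_of_real Im_complex_of_real times_complex.sel mult_zero_left diff_zero)
        moreover have "H\<^sup>2 * c \<le> H\<^sup>2 * Re (osc \<xi> \<zeta>)" using True \<xi> by (intro mult_left_mono J) auto
        moreover have "(c * H\<^sup>2) * indicator {N + 3/4..N + 1} \<zeta> \<le> H\<^sup>2 * c" using c by (simp add: indicator_def)
        ultimately show ?thesis by linarith
      next
        case False
        then have "\<zeta> \<notin> {N + 3/4..N + 1}" using \<xi> N by auto
        then have "indicator {N + 3/4..N + 1} \<zeta> = (0::real)" by simp
        moreover have "h \<zeta> = 0 \<or> h (\<xi> - \<zeta>) = 0" using False by (auto simp: h_def)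
        then have "h \<zeta> * h (\<xi> - \<zeta>) * osc \<xi> \<zeta> = 0" by (simp only: mult_eq_0_iff simp_thms)
        ultimately show ?thesis by (simp only: zero_complex.sel mult_zero_right order_refl)
      qed
    qed
    also have "\<dots> = Re (LBINT \<zeta>. h \<zeta> * h (\<xi> - \<zeta>) * osc \<xi> \<zeta>)" by (rule integral_Re[OF i])
    finally show ?thesis .
  qed
  have tr: "traj (M0 * b) ?u" by (rule traj_free[OF hm h_le])
  have M0b: "0 \<le> M0 * b" using M0_pos b by simp
  have dt: "traj (K0 * (M0 * b) * (M0 * b)) (duhamel ?u ?u)" by (rule duhamel_traj[OF tr tr M0b M0b])
  note bM = kappa_le_M[OF band_borel band_le order_refl]
  have bi: "integrable lborel (\<lambda>\<xi>. band \<xi> * duhamel ?u ?u T \<xi>)"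
    using T by (intro integrable_bounded_times(1)[OF band_borel bM] integrable_of_decay(1)[OF traj_slice_borel[OF dt] traj_le[OF dt]]) auto
  have "c * H\<^sup>2 / (64 * pi) = (LBINT \<xi>. (c * H\<^sup>2 / (32 * pi)) * indicator {1/4..3/4::real} \<xi>)" by simp
  also have "\<dots> \<le> (LBINT \<xi>. Re (band \<xi> * duhamel ?u ?u T \<xi>))"
  proof (rule integral_mono)
    show "integrable lborel (\<lambda>\<xi>. (c * H\<^sup>2 / (32 * pi)) * indicator {1/4..3/4::real} \<xi>)"
      by (intro integrable_mult_right integrable_real_indicator emeasure_bounded_finite) auto
    show "integrable lborel (\<lambda>\<xi>. Re (band \<xi> * duhamel ?u ?u T \<xi>))" by (rule integrable_Re[OF bi])
    fix \<xi>
    show "(c * H\<^sup>2 / (32 * pi)) * indicator {1/4..3/4} \<xi> \<le> Re (band \<xi> * duhamel ?u ?u T \<xi>)"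
    proof (cases "\<xi> \<in> {1/4..3/4}")
      case True
      have "band \<xi> * duhamel ?u ?u T \<xi> = of_real (\<xi> / (2 * pi)) * (LBINT \<zeta>. h \<zeta> * h (\<xi> - \<zeta>) * osc \<xi> \<zeta>)"
        unfolding band_duh time_integral_swap(1)[OF hm h_le b] using True by simp
      then have "Re (band \<xi> * duhamel ?u ?u T \<xi>) = \<xi> / (2 * pi) * Re (LBINT \<zeta>. h \<zeta> * h (\<xi> - \<zeta>) * osc \<xi> \<zeta>)"
        by (simp only: Re_complex_of_real Im_complex_of_real times_complex.sel mult_zero_left diff_zero)
      also have "\<dots> \<ge> (1 / 4) / (2 * pi) * (c * H\<^sup>2 / 4)"
        using True c by (intro mult_mono inner divide_right_mono) auto
      finally show ?thesis using True by simp
    qed (simp add: band_def)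
  qed
  also have "\<dots> = Re (LBINT \<xi>. band \<xi> * duhamel ?u ?u T \<xi>)" by (rule integral_Re[OF bi])
  also have "\<dots> \<le> norm (LBINT \<xi>. band \<xi> * duhamel ?u ?u T \<xi>)" by (rule complex_Re_le_cmod)
  finally show ?thesis .
qed

end

section \<open>Growth of the second iterate\<close>

text \<open>
  The power \<open>\<bar>\<xi>\<bar> powr p\<close> dominates both \<open>\<bar>\<xi>\<bar>\<close> and \<open>\<bar>\<xi>\<bar> powr q\<close> at infinity.
\<close>

lemma symbol_upper_bound:
  fixes p q C :: real
  assumes "2 \<le> p" "0 \<le> q" "q < p"
  shows "\<exists>A. \<forall>\<xi> y. \<bar>y\<bar> \<le> C * (1 + \<bar>\<xi>\<bar> powr q) \<longrightarrow> - (\<bar>\<xi>\<bar> powr p) + y \<le> A - \<bar>\<xi>\<bar>"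
proof -
  have "\<forall>\<^sub>F x in at_top. x - x powr p + C * (1 + x powr q) \<le> (0::real)"
  proof -
    have "((\<lambda>x. x powr (1 - p) + C * (x powr (- p) + x powr (q - p))) \<longlongrightarrow> 0 + C * (0 + 0)) at_top"
      using assms by (intro tendsto_intros tendsto_neg_powr filterlim_ident) auto
    then have "\<forall>\<^sub>F x in at_top. x powr (1 - p) + C * (x powr (- p) + x powr (q - p)) < 1"
      by (rule order_tendstoD) simp
    then show ?thesis using eventually_gt_at_top[of 0]
    proof eventually_elim
      case (elim x)
      have "x powr p * (x powr (1 - p) + C * (x powr (- p) + x powr (q - p))) \<le> x powr p * 1"
        using elim by (intro mult_left_mono) auto
      moreover have "x powr p * (x powr (1 - p) + C * (x powr (- p) + x powr (q - p))) = x + C * (1 + x powr q)"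
        using elim(2) by (simp add: distrib_left mult.left_commute[of "x powr p"] powr_add[symmetric])
      ultimately show ?case by simp
    qed
  qed
  then obtain R where R: "\<And>x. R \<le> x \<Longrightarrow> x - x powr p + C * (1 + x powr q) \<le> 0"
    unfolding eventually_at_top_linorder by blast
  define A where "A = max 0 (max 0 R + \<bar>C\<bar> * (1 + max 0 R powr q))"
  have "- (\<bar>\<xi>\<bar> powr p) + y \<le> A - \<bar>\<xi>\<bar>" if y: "\<bar>y\<bar> \<le> C * (1 + \<bar>\<xi>\<bar> powr q)" for \<xi> y :: real
  proof (cases "R \<le> \<bar>\<xi>\<bar>")
    case True
    have "0 \<le> A" by (simp add: A_def)
    then show ?thesis using R[OF True] y by linarith
  next
    case False
    have "C * (1 + \<bar>\<xi>\<bar> powr q) \<le> \<bar>C\<bar> * (1 + \<bar>\<xi>\<bar> powr q)" by (intro mult_right_mono) auto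
    also have "\<dots> \<le> \<bar>C\<bar> * (1 + max 0 R powr q)"
      using False assms by (intro mult_left_mono add_left_mono powr_mono2) auto
    finally have "\<bar>\<xi>\<bar> + y \<le> A" using y False unfolding A_def by linarith
    moreover have "0 \<le> \<bar>\<xi>\<bar> powr p" by simp
    ultimately show ?thesis by linarith
  qed
  then show ?thesis by blast
qed

lemma powr_tends_to_infinity: "0 < (a::real) \<Longrightarrow> filterlim (\<lambda>N::real. N powr a) at_top at_top"
  by real_asymp

lemma high_frequency_eventually:
  fixes p q C T \<eta> B :: real
  assumes p: "2 \<le> p" and q: "0 \<le> q" "q < p" and T: "0 < T" and eta: "0 < \<eta>"
  shows "\<forall>\<^sub>F N in at_top. 2 \<le> N \<and> 1 + 2 * C * (2 + (2 * N) powr q) \<le> N powr p \<and> exp (- T * \<eta> * N powr p) * B \<le> \<eta> / 2"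
proof -
  have P: "filterlim (\<lambda>N::real. N powr p) at_top at_top" using p by (intro powr_tends_to_infinity) auto
  have "((\<lambda>N. N powr (- p) + 2 * C * (2 * N powr (- p) + 2 powr q * N powr (q - p))) \<longlongrightarrow> 0 + 2 * C * (2 * 0 + 2 powr q * 0)) at_top"
    using assms by (intro tendsto_intros tendsto_neg_powr filterlim_ident) auto
  then have "\<forall>\<^sub>F N in at_top. N powr (- p) + 2 * C * (2 * N powr (- p) + 2 powr q * N powr (q - p)) < 1"
    by (rule order_tendstoD) simp
  moreover have "\<forall>\<^sub>F N in at_top. exp (- T * \<eta> * N powr p) * B < \<eta> / 2"
  proof -
    have "filterlim (\<lambda>N. (T * \<eta>) * N powr p) at_top at_top"
      using T eta by (intro filterlim_tendsto_pos_mult_at_top[OF tendsto_const _ P]) auto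
    then have "filterlim (\<lambda>N. - ((T * \<eta>) * N powr p)) at_bot at_top" by (simp add: filterlim_uminus_at_bot)
    then have "((\<lambda>N. exp (- ((T * \<eta>) * N powr p))) \<longlongrightarrow> 0) at_top"
      by (rule filterlim_compose[OF exp_at_bot])
    then have "((\<lambda>N. exp (- ((T * \<eta>) * N powr p)) * B) \<longlongrightarrow> 0 * B) at_top" by (intro tendsto_intros)
    then have "\<forall>\<^sub>F N in at_top. exp (- ((T * \<eta>) * N powr p)) * B < \<eta> / 2"
      by (rule order_tendstoD) (use eta in simp)
    then show ?thesis by simp
  qed
  ultimately show ?thesis using eventually_ge_at_top[of 2]
  proof eventually_elim
    case (elim N)
    have "N powr p * (N powr (- p) + 2 * C * (2 * N powr (- p) + 2 powr q * N powr (q - p))) \<le> N powr p * 1"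
      using elim by (intro mult_left_mono) auto
    moreover have "N powr p * (N powr (- p) + 2 * C * (2 * N powr (- p) + 2 powr q * N powr (q - p))) = 1 + 2 * C * (2 + (2 * N) powr q)"
      using elim(3) by (simp add: distrib_left mult.left_commute[of "N powr p"] powr_add[symmetric] powr_mult)
    ultimately show ?case using elim by simp
  qed
qed

text \<open>
  The imaginary part is \<open>- 3 \<xi> \<zeta> (\<xi> - \<zeta>)\<close>, of order \<open>N\<^sup>2\<close>; it is dominated by the
  dissipation \<open>N powr p\<close> because \<open>p \<ge> 2\<close>. The lower order part of the symbol is absorbed for large
  \<open>N\<close>.
\<close>

lemma (in dissipative_symbol) phase_bounds:
  fixes p q C N \<xi> \<zeta> :: real
  assumes Phi: "\<And>\<xi>. \<bar>\<Phi> \<xi> + \<bar>\<xi>\<bar> powr p\<bar> \<le> C * (1 + \<bar>\<xi>\<bar> powr q)"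
    and p: "2 \<le> p" and q: "0 \<le> q" and N: "2 \<le> N" and big: "1 + 2 * C * (2 + (2 * N) powr q) \<le> N powr p"
    and \<xi>: "\<xi> \<in> {1/4..3/4}" and \<zeta>: "N \<le> \<bar>\<zeta>\<bar>" "\<bar>\<zeta>\<bar> \<le> N + 1" "N \<le> \<bar>\<xi> - \<zeta>\<bar>" "\<bar>\<xi> - \<zeta>\<bar> \<le> N + 1"
  shows "\<eta> * N powr p \<le> - Re (phase \<xi> \<zeta>)" and "norm (phase \<xi> \<zeta>) \<le> (12 + \<eta> * (2 * 2 powr p + 1)) * N powr p"
proof -
  have C: "0 \<le> C" using order_trans[OF abs_ge_zero Phi[of 0]] by (simp split: if_splits)
  define X where "X = N powr p"
  define D where "D = C * (1 + (2 * N) powr q)"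
  have xp: "0 \<le> \<bar>\<xi>\<bar> powr p" "\<bar>\<xi>\<bar> powr p \<le> 1" "\<bar>\<xi>\<bar> powr q \<le> 1"
    using \<xi> p q by (auto intro!: powr_le1)
  have hi: "X \<le> \<bar>x\<bar> powr p" "\<bar>x\<bar> powr p \<le> 2 powr p * X" "\<bar>\<Phi> x + \<bar>x\<bar> powr p\<bar> \<le> D" if x: "N \<le> \<bar>x\<bar>" "\<bar>x\<bar> \<le> N + 1" for x
  proof -
    show "X \<le> \<bar>x\<bar> powr p" unfolding X_def using x N p by (intro powr_mono2) auto
    have "\<bar>x\<bar> powr p \<le> (2 * N) powr p" using x N p by (intro powr_mono2) auto
    then show "\<bar>x\<bar> powr p \<le> 2 powr p * X" unfolding X_def using N by (simp add: powr_mult)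
    have "\<bar>x\<bar> powr q \<le> (2 * N) powr q" using x N q by (intro powr_mono2) auto
    then have "C * (1 + \<bar>x\<bar> powr q) \<le> D" unfolding D_def using C by (intro mult_left_mono) auto
    then show "\<bar>\<Phi> x + \<bar>x\<bar> powr p\<bar> \<le> D" using Phi[of x] by linarith
  qed
  have lo: "\<bar>\<Phi> \<xi> + \<bar>\<xi>\<bar> powr p\<bar> \<le> 2 * C"
    using Phi[of \<xi>] mult_left_mono[OF xp(3) C] by (simp add: algebra_simps)
  have b: "1 + 2 * D + 2 * C \<le> X" using big by (simp add: X_def D_def algebra_simps)
  define R where "R = - (\<Phi> \<zeta> + \<Phi> (\<xi> - \<zeta>) - \<Phi> \<xi>)"
  have R1: "X \<le> R" using hi[OF \<zeta>(1,2)] hi[OF \<zeta>(3,4)] lo xp b unfolding R_def by linarith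
  have "R \<le> 2 * (2 powr p * X) + X"
    using hi[OF \<zeta>(1,2)] hi[OF \<zeta>(3,4)] lo xp b unfolding R_def by linarith
  then have R2: "R \<le> (2 * 2 powr p + 1) * X" by (simp add: algebra_simps)
  have re: "- Re (phase \<xi> \<zeta>) = \<eta> * R" by (simp add: phase_def R_def algebra_simps)
  show "\<eta> * N powr p \<le> - Re (phase \<xi> \<zeta>)"
    unfolding re X_def[symmetric] using R1 eta by (intro mult_left_mono) auto
  have X0: "0 \<le> X" by (simp add: X_def)
  have "\<bar>Re (phase \<xi> \<zeta>)\<bar> \<le> \<eta> * ((2 * 2 powr p + 1) * X)"
  proof -
    have "\<bar>Re (phase \<xi> \<zeta>)\<bar> = \<eta> * R" using re R1 X0 eta by (simp add: abs_if mult_nonneg_nonneg) (smt (verit) mult_nonneg_nonneg)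
    also have "\<dots> \<le> \<eta> * ((2 * 2 powr p + 1) * X)" using R2 eta by (intro mult_left_mono) auto
    finally show ?thesis .
  qed
  moreover have "\<bar>Im (phase \<xi> \<zeta>)\<bar> \<le> 12 * X"
  proof -
    have "Im (phase \<xi> \<zeta>) = - 3 * \<xi> * \<zeta> * (\<xi> - \<zeta>)"
      by (simp add: phase_def power3_eq_cube algebra_simps)
    then have "\<bar>Im (phase \<xi> \<zeta>)\<bar> = 3 * \<bar>\<xi>\<bar> * \<bar>\<zeta>\<bar> * \<bar>\<xi> - \<zeta>\<bar>" by (simp add: abs_mult)
    also have "\<dots> \<le> 3 * 1 * (2 * N) * (2 * N)"
      using \<xi> \<zeta> N by (intro mult_mono) auto
    also have "\<dots> = 12 * N powr 2" using N by (simp add: powr_numeral power2_eq_square)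
    also have "\<dots> \<le> 12 * X" unfolding X_def using N p by (intro mult_left_mono powr_mono) auto
    finally show ?thesis .
  qed
  ultimately have "norm (phase \<xi> \<zeta>) \<le> \<eta> * ((2 * 2 powr p + 1) * X) + 12 * X"
    using cmod_le[of "phase \<xi> \<zeta>"] by linarith
  then show "norm (phase \<xi> \<zeta>) \<le> (12 + \<eta> * (2 * 2 powr p + 1)) * N powr p" by (simp add: X_def algebra_simps)
qed

text \<open>
  The height is chosen such that the norm in \<open>H\<^sup>s\<close> stays at most \<open>1\<close> for all \<open>N\<close>.
\<close>

definition bump :: "real \<Rightarrow> real \<Rightarrow> real \<Rightarrow> complex"
  where "bump s N \<xi> = complex_of_real ((N powr (- s) / 2) * indicator {x. N \<le> \<bar>x\<bar> \<and> \<bar>x\<bar> \<le> N + 1} \<xi>)"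

lemma bump_borel: "bump s N \<in> borel_measurable borel"
proof -
  have "{x::real. N \<le> \<bar>x\<bar> \<and> \<bar>x\<bar> \<le> N + 1} \<in> sets borel" by measurable
  then show ?thesis unfolding bump_def[abs_def] by measurable
qed

lemma bump_le: "norm (bump s N \<xi>) \<le> (N powr (- s) / 2 * (1 + (N + 1)\<^sup>2)\<^sup>2) * decay \<xi>"
proof (cases "N \<le> \<bar>\<xi>\<bar> \<and> \<bar>\<xi>\<bar> \<le> N + 1")
  case True
  have "\<xi>\<^sup>2 \<le> (N + 1)\<^sup>2" using True by (intro abs_le_square_iff[THEN iffD1]) auto
  then have "(1 + \<xi>\<^sup>2)\<^sup>2 \<le> (1 + (N + 1)\<^sup>2)\<^sup>2" by (intro power_mono) auto
  then have "(1 + \<xi>\<^sup>2)\<^sup>2 * decay \<xi> \<le> (1 + (N + 1)\<^sup>2)\<^sup>2 * decay \<xi>" by (intro mult_right_mono) auto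
  moreover have "(1 + \<xi>\<^sup>2)\<^sup>2 * decay \<xi> = 1"
  proof -
    have "0 < 1 + \<xi>\<^sup>2" by (intro add_pos_nonneg) auto
    then have "(1 + \<xi>\<^sup>2)\<^sup>2 \<noteq> 0" by simp
    then show ?thesis unfolding decay_def by (rule right_inverse)
  qed
  ultimately have "(N powr (- s) / 2) * 1 \<le> (N powr (- s) / 2) * ((1 + (N + 1)\<^sup>2)\<^sup>2 * decay \<xi>)"
    by (intro mult_left_mono) auto
  then show ?thesis using True by (simp add: bump_def mult.assoc)
qed (simp add: bump_def)

lemma bump_nrm_le:
  assumes s: "s \<le> 0" and N: "0 < N"
  shows "nrm (sobolev s) (freq_dist (bump s N)) \<le> 1"
proof -
  have i: "integrable lborel (bump s N)" by (rule integrable_of_decay(1)[OF bump_borel bump_le])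
  have iw: "integrable lborel (\<lambda>\<xi>. weight s \<xi> * (norm (bump s N \<xi>))\<^sup>2)" by (rule integrable_weight_decay[OF s bump_borel bump_le])
  have pw: "weight s \<xi> * (norm (bump s N \<xi>))\<^sup>2 \<le> (1/4) * (indicator {N..N+1} \<xi> + indicator {-(N+1)..-N} \<xi>)" for \<xi>
  proof (cases "N \<le> \<bar>\<xi>\<bar> \<and> \<bar>\<xi>\<bar> \<le> N + 1")
    case True
    have "N\<^sup>2 \<le> \<bar>\<xi>\<bar>\<^sup>2" using True N by (intro power_mono) auto
    then have "weight s \<xi> \<le> (N\<^sup>2) powr s" unfolding weight_def using s N by (intro powr_mono2') auto
    also have "N\<^sup>2 = N powr 2" using N by (simp add: powr_numeral)
    also have "(N powr 2) powr s = N powr (2 * s)" by (rule powr_powr)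
    finally have "weight s \<xi> * (N powr (- s) / 2)\<^sup>2 \<le> N powr (2 * s) * (N powr (- s) / 2)\<^sup>2" by (intro mult_right_mono) auto
    also have "\<dots> = 1 / 4" using N by (simp add: power_divide power2_eq_square powr_add[symmetric])
    finally have "weight s \<xi> * (norm (bump s N \<xi>))\<^sup>2 \<le> 1 / 4" using True by (simp add: bump_def)
    moreover have "(1::real) \<le> indicator {N..N+1} \<xi> + indicator {-(N+1)..-N} \<xi>"
      using True N by (auto simp: indicator_def)
    then have "(1/4) * 1 \<le> (1/4) * (indicator {N..N+1} \<xi> + indicator {-(N+1)..-N} \<xi> :: real)"
      by (intro mult_left_mono) auto
    ultimately show ?thesis unfolding mult_1_right by (rule order_trans)
  qed (simp add: bump_def)
  have "(LBINT \<xi>. weight s \<xi> * (norm (bump s N \<xi>))\<^sup>2) \<le> (LBINT \<xi>. (1/4) * (indicator {N..N+1} \<xi> + indicator {-(N+1)..-N} \<xi>))"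
    by (rule integral_mono[OF iw _ pw]) (intro integrable_mult_right Bochner_Integration.integrable_add integrable_real_indicator; simp)
  also have "\<dots> \<le> 1" by simp
  finally show ?thesis unfolding freq_dist_sobolev(2)[OF i iw] by simp
qed

theorem theorem1p3:
  fixes \<eta> p s q C :: real and \<Phi> \<Phi>1 :: "real \<Rightarrow> real"
  assumes "\<eta> > 0" and "p \<ge> 2" and "s < - p / 2"
    and "\<Phi> \<in> borel_measurable lebesgue"
    and "\<And>\<xi>. \<Phi> \<xi> = - (\<bar>\<xi>\<bar> powr p) + \<Phi>1 \<xi>"
    and "0 \<le> q" and "q < p"
    and "\<And>\<xi>. \<bar>\<Phi>1 \<xi>\<bar> \<le> C * (1 + \<bar>\<xi>\<bar> powr q)"
  shows "\<not> (\<exists>T>0. \<exists>r>0. \<exists>F :: functional \<Rightarrow> real \<Rightarrow> functional.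
    (\<forall>v0\<in>car (sobolev s). nrm (sobolev s) v0 < r \<longrightarrow>
       is_solution \<eta> \<Phi> s T v0 (F v0) \<and> (\<forall>v. is_solution \<eta> \<Phi> s T v0 v \<longrightarrow> v = F v0)) \<and>
    C2_at (sobolev s) (C_sobolev T s) F 0)"
proof (rule notI, elim exE conjE)
  fix T r :: real and F :: "functional \<Rightarrow> real \<Rightarrow> functional"
  assume T: "T > 0" and r: "r > 0"
    and flow: "\<forall>v0\<in>car (sobolev s). nrm (sobolev s) v0 < r \<longrightarrow>
       is_solution \<eta> \<Phi> s T v0 (F v0) \<and> (\<forall>v. is_solution \<eta> \<Phi> s T v0 v \<longrightarrow> v = F v0)"
    and C2: "C2_at (sobolev s) (C_sobolev T s) F 0"
  note eta = assms(1) and p = assms(2) and q = assms(6,7)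
  have s: "s \<le> 0" using assms(2,3) by simp
  have C: "0 \<le> C" using order_trans[OF abs_ge_zero assms(8)[of 0]] by (simp split: if_splits)
  \<comment> \<open>\<open>\<Phi>\<close> is only Lebesgue measurable. \<open>\<Psi>\<close> is a Borel function that agrees with it almost everywhere
    and satisfies the same bounds at every point.\<close>
  obtain \<Phi>b where \<Phi>b: "\<Phi>b \<in> borel_measurable lborel" and ae0: "AE \<xi> in lborel. \<Phi> \<xi> = \<Phi>b \<xi>"
    using completion_ex_borel_measurable_real[OF assms(4)] by blast
  define \<Psi> where "\<Psi> \<xi> = (if \<bar>\<Phi>b \<xi> + \<bar>\<xi>\<bar> powr p\<bar> \<le> C * (1 + \<bar>\<xi>\<bar> powr q) then \<Phi>b \<xi> else - (\<bar>\<xi>\<bar> powr p))" for \<xi>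
  have \<Psi>m: "\<Psi> \<in> borel_measurable borel" unfolding \<Psi>_def[abs_def] using \<Phi>b by measurable
  have "AE \<xi> in lborel. \<Phi> \<xi> = \<Psi> \<xi>" using ae0
  proof eventually_elim
    case (elim \<xi>)
    have "\<Phi> \<xi> + \<bar>\<xi>\<bar> powr p = \<Phi>1 \<xi>" using assms(5)[of \<xi>] by simp
    then show ?case using assms(8)[of \<xi>] elim by (simp add: \<Psi>_def)
  qed
  then have ae: "AE \<xi> in lebesgue. \<Phi> \<xi> = \<Psi> \<xi>" by (rule AE_completion)
  have \<Psi>b: "\<bar>\<Psi> \<xi> + \<bar>\<xi>\<bar> powr p\<bar> \<le> C * (1 + \<bar>\<xi>\<bar> powr q)" for \<xi>
    using C by (simp add: \<Psi>_def)
  obtain A where A: "\<And>\<xi> y. \<bar>y\<bar> \<le> C * (1 + \<bar>\<xi>\<bar> powr q) \<Longrightarrow> - (\<bar>\<xi>\<bar> powr p) + y \<le> A - \<bar>\<xi>\<bar>"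
    using symbol_upper_bound[OF p q] by blast
  have \<Psi>A: "\<Psi> \<xi> \<le> A - \<bar>\<xi>\<bar>" for \<xi> using A[OF \<Psi>b[of \<xi>]] by simp
  interpret dissipative_symbol \<eta> T A \<Psi>
    by unfold_locales (use eta T \<Psi>m \<Psi>A in auto)
  define M where "M = exp (\<eta> * T * (1 + 2 * C))"
  have band_le: "norm (band \<xi>) \<le> M * indicator {0..1} \<xi>" for \<xi>
  proof (cases "\<xi> \<in> {1/4..3/4}")
    case True
    have "\<bar>\<xi>\<bar> powr p \<le> 1" "\<bar>\<xi>\<bar> powr q \<le> 1" using True p q by (auto intro!: powr_le1)
    then have "- \<Psi> \<xi> \<le> 1 + 2 * C" using \<Psi>b[of \<xi>] mult_left_mono[of "\<bar>\<xi>\<bar> powr q" 1 C] C by (simp add: algebra_simps)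
    then have "\<eta> * T * (- \<Psi> \<xi>) \<le> \<eta> * T * (1 + 2 * C)" using eta T by (intro mult_left_mono) auto
    then have "norm (E (- T) \<xi>) \<le> M" unfolding norm_E M_def by simp
    then show ?thesis using True by (simp add: band_def norm_mult)
  qed (simp add: band_def M_def)
  from C2_flow_second_difference[OF band_borel band_le s less_imp_le[OF T] C2]
  obtain K where K: "\<And>\<phi>. \<phi> \<in> car (sobolev s) \<Longrightarrow> nrm (sobolev s) \<phi> \<le> 1 \<Longrightarrow> \<exists>d>0. \<forall>\<theta>. 0 < \<theta> \<and> \<theta> < d \<longrightarrow>
    norm (pairing_difference band F T \<phi> \<theta>) \<le> K * \<theta>\<^sup>2"
    by blast
  define B where "B = 12 + \<eta> * (2 * 2 powr p + 1)"
  have B: "0 < B" using eta by (auto simp: B_def intro!: add_pos_nonneg)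
  define c0 where "c0 = \<eta> / (2 * B\<^sup>2) / (256 * pi)"
  have c0: "0 < c0" using eta B by (simp add: c0_def)
  have "\<forall>\<^sub>F N in at_top. c0 * N powr (- 2 * s - p) \<le> K / 2"
    using high_frequency_eventually[OF p q T eta, of C B]
  proof eventually_elim
    case (elim N)
    then have N: "2 \<le> N" and big: "1 + 2 * C * (2 + (2 * N) powr q) \<le> N powr p"
      and small: "exp (- T * \<eta> * N powr p) * B \<le> \<eta> / 2" by auto
    have Np: "0 < N powr p" using N by simp
    let ?h = "bump s N"
    let ?b = "N powr (- s) / 2 * (1 + (N + 1)\<^sup>2)\<^sup>2"
    have car: "freq_dist ?h \<in> car (sobolev s)"
      by (rule freq_dist_sobolev(1)[OF integrable_of_decay(1)[OF bump_borel bump_le] integrable_weight_decay[OF s bump_borel bump_le]])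
    have "nrm (sobolev s) (freq_dist ?h) \<le> 1" using N by (intro bump_nrm_le s) auto
    from K[OF car this] obtain d where d: "0 < d" and Kd: "\<And>\<theta>. 0 < \<theta> \<Longrightarrow> \<theta> < d \<Longrightarrow>
      norm (pairing_difference band F T (freq_dist ?h) \<theta>) \<le> K * \<theta>\<^sup>2"
      by blast
    have upper: "2 * norm (LBINT \<xi>. band \<xi> * duhamel (free ?h) (free ?h) T \<xi>) \<le> K"
    proof (rule second_iterate_bound[OF ae s band_borel band_le bump_borel bump_le _ r])
      show "v = F v0" if "v0 \<in> car (sobolev s)" "nrm (sobolev s) v0 < r" "is_solution \<eta> \<Phi> s T v0 v" for v0 v
        using flow that by blast
      show "0 < d" by (rule d)
      show "norm (pairing_difference band F T (freq_dist ?h) \<theta>) \<le> K * \<theta>\<^sup>2" if "0 < \<theta>" "\<theta> < d" for \<theta>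
        by (rule Kd[OF that])
    qed simp
    have lower: "(\<eta> / (2 * B\<^sup>2) / N powr p) * (N powr (- s) / 2)\<^sup>2 / (64 * pi)
      \<le> norm (LBINT \<xi>. band \<xi> * duhamel (free ?h) (free ?h) T \<xi>)"
      unfolding bump_def
    proof (rule second_iterate_lower[OF _ bump_le[unfolded bump_def] _ _ _ _ band_le])
      fix \<xi> \<zeta> :: real
      assume a: "\<xi> \<in> {1/4..3/4}" "N \<le> \<bar>\<zeta>\<bar>" "\<bar>\<zeta>\<bar> \<le> N + 1" "N \<le> \<bar>\<xi> - \<zeta>\<bar>" "\<bar>\<xi> - \<zeta>\<bar> \<le> N + 1"
      show "\<eta> / (2 * B\<^sup>2) / N powr p \<le> Re (osc \<xi> \<zeta>)"
        by (rule exp_integral_lower(2)[OF T Np eta B _ _ small])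
          (use phase_bounds[OF \<Psi>b p q(1) N big a] in \<open>simp_all add: B_def\<close>)
    qed (use N eta in auto)
    have "c0 * N powr (- 2 * s - p) = (\<eta> / (2 * B\<^sup>2) / N powr p) * (N powr (- s) / 2)\<^sup>2 / (64 * pi)"
    proof -
      have "N powr (- 2 * s - p) = N powr (- s) * N powr (- s) / N powr p"
        using N by (simp add: powr_add[symmetric] powr_diff[symmetric])
      then show ?thesis by (simp add: c0_def power2_eq_square)
    qed
    then show ?case using lower upper by linarith
  qed
  moreover have "filterlim (\<lambda>N. c0 * N powr (- 2 * s - p)) at_top at_top"
    using assms(3) c0 by (intro filterlim_tendsto_pos_mult_at_top[OF tendsto_const] powr_tends_to_infinity) auto
  then have "\<forall>\<^sub>F N in at_top. K / 2 < c0 * N powr (- 2 * s - p)"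
    by (rule filterlim_at_top_dense[THEN iffD1, rule_format])
  ultimately have "\<forall>\<^sub>F N :: real in at_top. False" by eventually_elim simp
  then show False by simp
qed

end
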